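(* Let $A\in\mathbb{R}_+^{n\times n}$ have max-algebraic factor rank $r$, and let $k$ be a critical node of $A$. Let $H$ be the component of $\mathcal{C}(A)$ containing $k$. Fix a representation $A=\bigoplus_{\alpha=1}^r v_\alpha\otimes w_\alpha^T$ with $v_\alpha,w_\alpha\in\mathbb{R}_+^n$, let $V,W$ be the $n\times r$ matrices with columns $v_\alpha$, resp. $w_\alpha$, and let $Z=\begin{pmatrix}0_{n\times n}&V\\ W^T&0_{r\times r}\end{pmatrix}\in\mathbb{R}_+^{(n+r)\times(n+r)}$. Let $G$ be the component of $\mathcal{C}(Z)$ containing $k$, let $m'$ be the number of nodes of $G$ lying in $\{n+1,\dots,n+r\}$, and set $h=\min(\lvert H\rvert,m')$ (so $h\le\min(\lvert H\rvert,r)$). Then the following are upper bounds on the transient of the $k$-th row and of the $k$-th column of $A$: (i) $\mathrm{Wi}(r)+1$; (ii) $(r-2)\cdot g(H)+h+1$. If moreover $A$ is irreducible and $d$ is the cyclicity of $\mathcal{G}(A)$, then also: (iii) $d\cdot\mathrm{Wi}\left(\lfloor r/d\rfloor\right)+(r\bmod d)+1$; (iv) $\left(\lfloor r/d\rfloor-2\right)\cdot g(H)+\min\big(r,\ h+(r\bmod d)\big)+1$.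
   Context: Max algebra: $\mathbb{R}_+=[0,\infty)$ with $a\oplus b=\max(a,b)$ and usual multiplication; $(A\otimes B)_{i,j}=\max_l a_{i,l}b_{l,j}$; $A^{\otimes t}$ the $t$-th max-algebraic power with entries $a^{(t)}_{i,j}$. The max-algebraic factor rank of $A$ is the least $r$ such that $A=\bigoplus_{\alpha=1}^r v_\alpha\otimes w_\alpha^T$ (entrywise max of outer products) for some $v_\alpha,w_\alpha\in\mathbb{R}_+^n$. $\mathcal{G}(A)$ is the weighted digraph on $\{1,\dots,n\}$ with edge $(i,j)$ of weight $a_{i,j}$ iff $a_{i,j}>0$; walk weights are products of edge weights. $\lambda(A)$ is the maximal geometric mean $p(C)^{1/\ell(C)}$ over nonempty cycles $C$ ($0$ if none); critical cycles attain it, and the critical graph $\mathcal{C}(A)$ consists of nodes and edges of critical cycles; its components are its connected (equivalently strongly connected) components. $A$ is irreducible if $\mathcal{G}(A)$ is strongly connected; cyclicity = gcd of cycle lengths; girth $g(H)$ = least length of a nonempty cycle in $H$. The transient of the $k$-th row is the least $t\ge0$ such that for some $p>0$, $a^{(s+p)}_{k,i}=\lambda(A)^pa^{(s)}_{k,i}$ for all $i$ and all $s\ge t$; similarly for columns. $\mathrm{Wi}(1)=0$, $\mathrm{Wi}(m)=(m-1)^2+1$ for $m>1$. (A critical node $k$ of $A$ is also a node of $\mathcal{C}(Z)$.) *)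

theory Defs
  imports
    Complex_Main
    "Jordan_Normal_Form.Matrix"
    "Graph_Theory.Graph_Theory"
begin

text \<open>
  Matrices over the max-times semiring are nonnegative real matrices. Rows, columns and
  nodes are numbered from 0, so an n by n matrix has node set \<open>{0..<n}\<close>.
\<close>

definition nonneg_mat :: "real mat \<Rightarrow> bool" where
  "nonneg_mat A \<longleftrightarrow> (\<forall>i<dim_row A. \<forall>j<dim_col A. 0 \<le> A $$ (i, j))"

definition nonneg_vec :: "real vec \<Rightarrow> bool" where
  "nonneg_vec v \<longleftrightarrow> (\<forall>i<dim_vec v. 0 \<le> v $ i)"

text \<open>
  Inserting 0, the neutral element of max on the nonnegative reals, gives the empty
  maximum its value and does not affect any other maximum.
\<close>

definition max_sum :: "(nat \<Rightarrow> real) \<Rightarrow> nat set \<Rightarrow> real" where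
  "max_sum f I = Max (insert 0 (f ` I))"

definition max_mult :: "real mat \<Rightarrow> real mat \<Rightarrow> real mat" where
  "max_mult A B = mat (dim_row A) (dim_col B)
     (\<lambda>(i, j). max_sum (\<lambda>l. A $$ (i, l) * B $$ (l, j)) {0..<dim_col A})"

primrec max_pow :: "real mat \<Rightarrow> nat \<Rightarrow> real mat" where
  "max_pow A 0 = 1\<^sub>m (dim_row A)"
| "max_pow A (Suc t) = max_mult (max_pow A t) A"

definition max_factorization ::
    "nat \<Rightarrow> nat \<Rightarrow> real mat \<Rightarrow> (nat \<Rightarrow> real vec) \<Rightarrow> (nat \<Rightarrow> real vec) \<Rightarrow> bool" where
  "max_factorization n r A v w \<longleftrightarrow>
     (\<forall>\<alpha><r. v \<alpha> \<in> carrier_vec n \<and> nonneg_vec (v \<alpha>) \<and> w \<alpha> \<in> carrier_vec n \<and> nonneg_vec (w \<alpha>)) \<and>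
     A = mat n n (\<lambda>(i, j). max_sum (\<lambda>\<alpha>. v \<alpha> $ i * w \<alpha> $ j) {0..<r})"

definition factor_rank :: "real mat \<Rightarrow> nat" where
  "factor_rank A = (LEAST r. \<exists>v w. max_factorization (dim_row A) r A v w)"

definition block_mat ::
    "nat \<Rightarrow> nat \<Rightarrow> (nat \<Rightarrow> real vec) \<Rightarrow> (nat \<Rightarrow> real vec) \<Rightarrow> real mat" where
  "block_mat n r v w =
     (let V = mat_of_cols n (map v [0..<r]); W = mat_of_cols n (map w [0..<r])
      in four_block_mat (0\<^sub>m n n) V (transpose_mat W) (0\<^sub>m r r))"

definition digraph_of :: "real mat \<Rightarrow> (nat, nat \<times> nat) pre_digraph" where
  "digraph_of A = \<lparr> verts = {0..<dim_row A},
     arcs = {(i, j). i < dim_row A \<and> j < dim_col A \<and> 0 < A $$ (i, j)},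
     tail = fst, head = snd \<rparr>"

definition walk_weight :: "real mat \<Rightarrow> (nat \<times> nat) awalk \<Rightarrow> real" where
  "walk_weight A p = prod_list (map (\<lambda>e. A $$ e) p)"

definition cycle_mean :: "real mat \<Rightarrow> (nat \<times> nat) awalk \<Rightarrow> real" where
  "cycle_mean A p = root (length p) (walk_weight A p)"

text \<open>
  Cycles are elementary and nonempty by the definition of
  \<open>pre_digraph.cycle\<close>, and loops are cycles; in particular there are only finitely many
  cycles, so the maximum below is a maximum of a finite set.
\<close>

definition max_eigenvalue :: "real mat \<Rightarrow> real" where
  "max_eigenvalue A =
     (if \<exists>p. pre_digraph.cycle (digraph_of A) p
      then Max (cycle_mean A ` {p. pre_digraph.cycle (digraph_of A) p}) else 0)"

definition critical_cycle :: "real mat \<Rightarrow> (nat \<times> nat) awalk \<Rightarrow> bool" where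
  "critical_cycle A p \<longleftrightarrow>
     pre_digraph.cycle (digraph_of A) p \<and> cycle_mean A p = max_eigenvalue A"

text \<open>
  The nodes of a cycle are the tails of its arcs. Every arc here lies on a cycle, so the
  components of this digraph are its strongly connected components \<open>pre_digraph.sccs\<close>.
\<close>

definition critical_digraph :: "real mat \<Rightarrow> (nat, nat \<times> nat) pre_digraph" where
  "critical_digraph A = \<lparr> verts = (\<Union>p\<in>{p. critical_cycle A p}. fst ` set p),
     arcs = (\<Union>p\<in>{p. critical_cycle A p}. set p),
     tail = fst, head = snd \<rparr>"

definition irreducible_mat :: "real mat \<Rightarrow> bool" where
  "irreducible_mat A \<longleftrightarrow> strongly_connected (digraph_of A)"

definition girth :: "('a, 'b) pre_digraph \<Rightarrow> nat" where
  "girth D = (LEAST l. \<exists>p. pre_digraph.cycle D p \<and> length p = l)"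

definition cyclicity :: "('a, 'b) pre_digraph \<Rightarrow> nat" where
  "cyclicity D = Gcd {length p | p. pre_digraph.cycle D p}"

definition row_periodic_from :: "real mat \<Rightarrow> nat \<Rightarrow> nat \<Rightarrow> bool" where
  "row_periodic_from A k t \<longleftrightarrow>
     (\<exists>p>0. \<forall>i<dim_col A. \<forall>s\<ge>t.
        max_pow A (s + p) $$ (k, i) = max_eigenvalue A ^ p * max_pow A s $$ (k, i))"

definition col_periodic_from :: "real mat \<Rightarrow> nat \<Rightarrow> nat \<Rightarrow> bool" where
  "col_periodic_from A k t \<longleftrightarrow>
     (\<exists>p>0. \<forall>i<dim_row A. \<forall>s\<ge>t.
        max_pow A (s + p) $$ (i, k) = max_eigenvalue A ^ p * max_pow A s $$ (i, k))"

definition row_transient :: "real mat \<Rightarrow> nat \<Rightarrow> nat" where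
  "row_transient A k = (LEAST t. row_periodic_from A k t)"

definition col_transient :: "real mat \<Rightarrow> nat \<Rightarrow> nat" where
  "col_transient A k = (LEAST t. col_periodic_from A k t)"

text \<open>
  A LEAST over an empty set is unspecified, so existence is part of the bound. The bound is
  an integer because the bounds of interest contain differences that can be negative.
\<close>

definition transients_bounded_by :: "real mat \<Rightarrow> nat \<Rightarrow> int \<Rightarrow> bool" where
  "transients_bounded_by A k b \<longleftrightarrow>
     (\<exists>t. row_periodic_from A k t) \<and> int (row_transient A k) \<le> b \<and>
     (\<exists>t. col_periodic_from A k t) \<and> int (col_transient A k) \<le> b"

text \<open>Wielandt's number; the value at 0 is a convention.\<close>

definition Wi :: "nat \<Rightarrow> nat" where
  "Wi m = (if m \<le> 1 then 0 else (m - 1)\<^sup>2 + 1)"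

end

theory Submission
  imports Defs "HOL-Number_Theory.Cong"
begin

text \<open>All walks are studied in the bipartite digraph of the block matrix \<open>Z\<close>, whose powers
  with even exponent restrict to the powers of \<open>A\<close>. After dividing by the eigenvalue, closed walks
  weigh at most 1, and a row that is periodic from \<open>T\<close> on stays so, up to a shift by \<open>j\<close>, for every
  node from which a critical walk of length \<open>j\<close> leads to it.

  A node \<open>z\<close> on a shortest critical cycle, of length \<open>2g\<close> in \<open>Z\<close>, is a critical loop of \<open>Z\<close> to the
  power \<open>2g\<close> restricted to the cyclic class \<open>S\<close> of \<open>z\<close>. Cutting cycles out of a walk of
  \<open>card S\<close> such steps and repeating the loop instead bounds the transient of \<open>z\<close> by
  \<open>2g * (card S - 1)\<close>. It remains to count how far \<open>k\<close> is from a node of a critical cycle in a class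
  \<open>S\<close> with at most \<open>r div d\<close> nodes on the side of the \<open>r\<close> factors. Wielandt's bound follows in the
  same way inside such a class, unless a critical cycle passes through all nodes of it. In that case
  a walk is determined up to critical arcs by its other arcs, and a minimal choice of these whose
  total shift modulo the cycle length is prescribed gives a short walk.\<close>

subsection \<open>Powers over the max-times semiring\<close>

text \<open>The bounds involve r instead of n because all pigeonhole arguments take place among the
  factor nodes \<open>n..<n + r\<close>: a row is followed for 2 * i + 1 critical steps, to a factor
  node, and cycles are cut out only there. The obstacle is to pay for i. The cyclic classes of
  factor nodes average r / d nodes, but the class met first may be larger. If a class has fewer than
  r div d nodes, its smaller bound compensates for waiting up to d - 1 double steps until it is met;
  otherwise one of any r mod d + 1 consecutive classes has exactly r div d nodes, which is where r
  mod d comes from. Cutting cycles alone would give the coefficient r div d - 1 of the girth g. It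
  drops to r div d - 2 because a shortest critical path to the girth cycle avoids the g nodes of
  that cycle on its own side of the bipartition, so its length plus g is at most the size of that
  side of the component: |H| on one side, m' on the other. Columns are rows of the transposed
  weights. Weights are functions on a node set so that powers, restriction to a class, diagonal
  scaling and transposition stay within one setting.\<close>

primrec mpow :: "'a set \<Rightarrow> ('a \<Rightarrow> 'a \<Rightarrow> real) \<Rightarrow> nat \<Rightarrow> 'a \<Rightarrow> 'a \<Rightarrow> real" where
  "mpow X a 0 x y = of_bool (x = y)"
| "mpow X a (Suc t) x y = Max (insert 0 ((\<lambda>l. mpow X a t x l * a l y) ` X))"

declare mpow.simps(2) [simp del]

text \<open>There is no factor for the eigenvalue: the notion is used for weights normalised to
  eigenvalue 1.\<close>

definition row_per :: "'a set \<Rightarrow> ('a \<Rightarrow> 'a \<Rightarrow> real) \<Rightarrow> 'a \<Rightarrow> nat \<Rightarrow> bool" where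
  "row_per X a x T \<longleftrightarrow>
     (\<exists>p>0. \<forall>t\<ge>T. \<forall>y\<in>X. mpow X a (t + p) x y = mpow X a t x y)"

lemma row_per_mono: "row_per X a x T \<Longrightarrow> T \<le> T' \<Longrightarrow> row_per X a x T'"
  unfolding row_per_def by (meson order_trans)

lemma Max_insert_0_mult:
  fixes f :: "'a \<Rightarrow> real"
  assumes "finite X" "0 \<le> c"
  shows "Max (insert 0 ((\<lambda>x. c * f x) ` X)) = c * Max (insert 0 (f ` X))"
proof -
  have "mono ((*) c)" using assms(2) by (simp add: mono_def mult_left_mono)
  then have "c * Max (insert 0 (f ` X)) = Max ((*) c ` insert 0 (f ` X))"
    using assms(1) by (intro mono_Max_commute) auto
  also have "(*) c ` insert 0 (f ` X) = insert 0 ((\<lambda>x. c * f x) ` X)" by auto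
  finally show ?thesis by simp
qed

text \<open>Serves two rescalings: constant \<open>\<phi>\<close> divides by the eigenvalue, and
  \<open>c = 1\<close> is the diagonal similarity given by a potential.\<close>

lemma mpow_scale:
  assumes "finite X" "0 < c" "\<And>x. x \<in> X \<Longrightarrow> 0 < \<phi> x" "x \<in> X" "y \<in> X"
  shows "mpow X (\<lambda>x y. c * \<phi> x * a x y / \<phi> y) t x y = c ^ t * \<phi> x * mpow X a t x y / \<phi> y"
  using assms(5)
proof (induction t arbitrary: y)
  case 0
  then show ?case using assms(3)[of y] by auto
next
  case (Suc t)
  let ?b = "\<lambda>x y. c * \<phi> x * a x y / \<phi> y"
  let ?c = "c ^ Suc t * \<phi> x / \<phi> y"
  have "(\<lambda>l. mpow X ?b t x l * ?b l y) ` X = (\<lambda>l. ?c * (mpow X a t x l * a l y)) ` X"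
  proof (rule image_cong[OF refl])
    fix l assume "l \<in> X"
    then show "mpow X ?b t x l * ?b l y = ?c * (mpow X a t x l * a l y)"
      using Suc.IH[of l] assms(3)[of l] by simp
  qed
  moreover have "0 \<le> ?c" using assms(2) assms(3)[OF assms(4)] assms(3)[OF Suc.prems] by simp
  ultimately show ?case
    unfolding mpow.simps(2) using Max_insert_0_mult[OF assms(1), of ?c] by simp
qed

lemma mpow_cong:
  assumes "\<And>x y. x \<in> X \<Longrightarrow> y \<in> X \<Longrightarrow> a x y = b x y" "y \<in> X"
  shows "mpow X a t x y = mpow X b t x y"
  using assms(2)
proof (induction t arbitrary: y)
  case (Suc t)
  have "(\<lambda>l. mpow X a t x l * a l y) ` X = (\<lambda>l. mpow X b t x l * b l y) ` X"
    using Suc assms(1) by (intro image_cong) auto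
  then show ?case by (simp add: mpow.simps(2))
qed simp

locale max_walks =
  fixes X :: "'a set" and a :: "'a \<Rightarrow> 'a \<Rightarrow> real"
  assumes fin: "finite X" and nonneg: "\<And>x y. x \<in> X \<Longrightarrow> y \<in> X \<Longrightarrow> 0 \<le> a x y"
begin

abbreviation pw where "pw \<equiv> mpow X a"

lemma pw_nonneg [simp]: "0 \<le> pw t x y"
  by (cases t) (use fin in \<open>auto simp: mpow.simps(2)\<close>)

lemma pw_Suc_ge: "l \<in> X \<Longrightarrow> pw t x l * a l y \<le> pw (Suc t) x y"
  using fin by (auto simp: mpow.simps(2) intro: Max_ge)

lemma pw_SucE:
  assumes "0 < pw (Suc t) x y"
  obtains l where "l \<in> X" "pw (Suc t) x y = pw t x l * a l y"
proof -
  have "pw (Suc t) x y \<in> insert 0 ((\<lambda>l. pw t x l * a l y) ` X)"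
    unfolding mpow.simps using fin by (intro Max_in) auto
  with assms that show ?thesis by auto
qed

lemma pw_1: "x \<in> X \<Longrightarrow> y \<in> X \<Longrightarrow> pw 1 x y = a x y"
proof -
  assume xy: "x \<in> X" "y \<in> X"
  have "Max (insert 0 ((\<lambda>l. of_bool (x = l) * a l y) ` X)) = a x y"
    using xy fin nonneg by (intro Max_eqI) auto
  then show ?thesis by (simp add: mpow.simps(2))
qed

lemma pw_mult_le:
  assumes "y \<in> X" "z \<in> X"
  shows "pw s x y * pw t y z \<le> pw (s + t) x z"
  using assms(2)
proof (induction t arbitrary: z)
  case (Suc t)
  show ?case
  proof (cases "pw (Suc t) y z > 0")
    case True
    then obtain l where l: "l \<in> X" "pw (Suc t) y z = pw t y l * a l z" by (rule pw_SucE)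
    have "pw s x y * pw (Suc t) y z = pw s x y * pw t y l * a l z" using l by simp
    also have "\<dots> \<le> pw (s + t) x l * a l z"
      using Suc l nonneg by (intro mult_right_mono) auto
    also have "\<dots> \<le> pw (s + Suc t) x z" using pw_Suc_ge[OF l(1)] by simp
    finally show ?thesis .
  next
    case False
    then have "pw (Suc t) y z = 0" using pw_nonneg[of "Suc t" y z] by linarith
    then show ?thesis by simp
  qed
qed auto

lemma pw_mult3_le:
  assumes "y \<in> X" "z \<in> X" "u \<in> X"
  shows "pw s x y * pw t y z * pw r z u \<le> pw (s + t + r) x u"
proof -
  have "pw s x y * pw t y z * pw r z u \<le> pw (s + t) x z * pw r z u"
    using assms by (intro mult_right_mono pw_mult_le) auto
  also have "\<dots> \<le> pw (s + t + r) x u" using assms by (intro pw_mult_le)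
  finally show ?thesis .
qed

lemma pw_walk:
  assumes "0 < pw t x y" "x \<in> X" "y \<in> X"
  obtains f where "f 0 = x" "f t = y" "\<And>i. f i \<in> X" "pw t x y = (\<Prod>l<t. a (f l) (f (Suc l)))"
proof -
  have "\<exists>f. f 0 = x \<and> f t = y \<and> (\<forall>i. f i \<in> X) \<and> pw t x y = (\<Prod>l<t. a (f l) (f (Suc l)))"
    using assms
  proof (induction t arbitrary: y)
    case 0
    then show ?case by (intro exI[of _ "\<lambda>_. x"]) (auto split: if_splits)
  next
    case (Suc t)
    obtain l where l: "l \<in> X" "pw (Suc t) x y = pw t x l * a l y"
      using pw_SucE[OF Suc.prems(1)] .
    have "pw t x l \<noteq> 0" using l Suc.prems(1) by auto
    then have "0 < pw t x l" using pw_nonneg[of t x l] by linarith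
    then obtain f where f: "f 0 = x" "f t = l" "\<forall>i. f i \<in> X"
        "pw t x l = (\<Prod>l<t. a (f l) (f (Suc l)))"
      using Suc.IH[of l] Suc.prems l by auto
    have "(\<Prod>i<t. a (f i) (f (Suc i))) =
        (\<Prod>i<t. a ((f(Suc t := y)) i) ((f(Suc t := y)) (Suc i)))"
      by (intro prod.cong) auto
    then show ?case using f l Suc.prems
      by (intro exI[of _ "f(Suc t := y)"]) auto
  qed
  with that show ?thesis by blast
qed

lemma walk_le_pw:
  assumes "\<And>i. f i \<in> X"
  shows "(\<Prod>l<t. a (f (i + l)) (f (Suc (i + l)))) \<le> pw t (f i) (f (i + t))"
proof (induction t)
  case (Suc t)
  have "(\<Prod>l<Suc t. a (f (i + l)) (f (Suc (i + l))))
      \<le> pw t (f i) (f (i + t)) * a (f (i + t)) (f (Suc (i + t)))"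
    using Suc assms nonneg by (simp add: mult_right_mono)
  also have "\<dots> \<le> pw (Suc t) (f i) (f (i + Suc t))"
    using pw_Suc_ge[of "f (i + t)" t "f i" "f (i + Suc t)"] assms by simp
  finally show ?case .
qed auto

text \<open>Sections of an optimal walk are optimal between their ends. One walk \<open>f\<close>
  serves all \<open>i\<close> and \<open>j\<close> at once, so repeated nodes can be looked for in
  it and the closed section between them cut out.\<close>

lemma pw_walk_split:
  assumes "0 < pw t x y" "x \<in> X" "y \<in> X"
  obtains f where "f 0 = x" "f t = y" "\<And>i. f i \<in> X"
    "\<And>i j. i \<le> j \<Longrightarrow> j \<le> t \<Longrightarrow>
       pw t x y = pw i x (f i) * pw (j - i) (f i) (f j) * pw (t - j) (f j) y"
proof -
  obtain f where f: "f 0 = x" "f t = y" "\<And>i. f i \<in> X"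
      "pw t x y = (\<Prod>l<t. a (f l) (f (Suc l)))"
    using pw_walk[OF assms] by blast
  have "pw t x y = pw i x (f i) * pw (j - i) (f i) (f j) * pw (t - j) (f j) y"
    if ij: "i \<le> j" "j \<le> t" for i j
  proof (rule antisym)
    define h where "h l = a (f l) (f (Suc l))" for l
    have h0: "0 \<le> h l" for l unfolding h_def using f nonneg by auto
    have shift: "(\<Prod>l\<in>{i..<j}. h l) = (\<Prod>l<j - i. h (i + l))" if "i \<le> j" for i j
      using prod.shift_bounds_nat_ivl[of h 0 i "j - i"] that
      by (simp add: atLeast0LessThan add.commute)
    have le: "(\<Prod>l\<in>{i..<j}. h l) \<le> pw (j - i) (f i) (f j)" if "i \<le> j" for i j
      unfolding shift[OF that] using walk_le_pw[of f i "j - i"] f(3) that by (simp add: h_def)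
    have "pw t x y = (\<Prod>l\<in>{0..<t}. h l)" using f(4) by (simp add: h_def atLeast0LessThan)
    also have "\<dots> = (\<Prod>l\<in>{0..<i}. h l) * (\<Prod>l\<in>{i..<j}. h l) * (\<Prod>l\<in>{j..<t}. h l)"
      using ij by (simp add: prod.atLeastLessThan_concat)
    also have "\<dots> \<le> pw i x (f i) * pw (j - i) (f i) (f j) * pw (t - j) (f j) y"
      using le[of 0 i] le[of i j] le[of j t] ij f
      by (intro mult_mono mult_nonneg_nonneg prod_nonneg) (auto simp: h0)
    finally show "pw t x y \<le> pw i x (f i) * pw (j - i) (f i) (f j) * pw (t - j) (f j) y" .
    show "pw i x (f i) * pw (j - i) (f i) (f j) * pw (t - j) (f j) y \<le> pw t x y"
      using pw_mult3_le[of "f i" "f j" y i x "j - i" "t - j"] ij f assms by simp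
  qed
  with f that show ?thesis by blast
qed

lemma pw_splitE:
  assumes "0 < pw (s + t) x z" "x \<in> X" "z \<in> X"
  obtains y where "y \<in> X" "pw (s + t) x z = pw s x y * pw t y z"
proof -
  obtain f where f: "f 0 = x" "f (s + t) = z" "\<And>i. f i \<in> X"
    "\<And>i j. i \<le> j \<Longrightarrow> j \<le> s + t \<Longrightarrow>
       pw (s + t) x z = pw i x (f i) * pw (j - i) (f i) (f j) * pw (s + t - j) (f j) z"
    using pw_walk_split[OF assms] by blast
  have "pw (s + t) x z = pw s x (f s) * pw t (f s) z"
    using f(4)[of s "s"] by simp
  then show ?thesis using that[OF f(3)] by blast
qed

lemma pw_power_le:
  assumes "x \<in> X"
  shows "pw t x x ^ m \<le> pw (t * m) x x"
proof (induction m)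
  case (Suc m)
  have "pw t x x ^ Suc m \<le> pw t x x * pw (t * m) x x"
    using Suc by (simp add: mult_left_mono)
  also have "\<dots> \<le> pw (t * Suc m) x x"
    using pw_mult_le[OF assms assms, of t x "t * m"] by simp
  finally show ?case .
qed simp

text \<open>Each row of a power determines the next, so a single coincidence of two rows already
  gives periodicity.\<close>

lemma row_perI:
  assumes "0 < p" "x \<in> X" "\<And>y. y \<in> X \<Longrightarrow> pw (T + p) x y = pw T x y"
  shows "row_per X a x T"
proof -
  have "pw (T + u + p) x y = pw (T + u) x y" if "y \<in> X" for u y
    using that
  proof (induction u arbitrary: y)
    case 0
    then show ?case using assms by simp
  next
    case (Suc u)
    have "(\<lambda>l. pw (T + u + p) x l * a l y) ` X = (\<lambda>l. pw (T + u) x l * a l y) ` X"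
      using Suc by (intro image_cong) auto
    then show ?case by (simp add: mpow.simps(2))
  qed
  then have "\<forall>t\<ge>T. \<forall>y\<in>X. pw (t + p) x y = pw t x y" by (metis le_Suc_ex)
  then show ?thesis using assms(1) unfolding row_per_def by auto
qed

lemma mpow_transpose:
  assumes "x \<in> X" "y \<in> X"
  shows "mpow X (\<lambda>x y. a y x) t x y = pw t y x"
  using assms
proof (induction t arbitrary: x y)
  case (Suc t)
  interpret tr: max_walks X "\<lambda>x y. a y x" by unfold_locales (use fin nonneg in auto)
  show ?case
  proof (rule antisym)
    show "tr.pw (Suc t) x y \<le> pw (Suc t) y x"
    proof (cases "0 < tr.pw (Suc t) x y")
      case True
      then obtain l where l: "l \<in> X" "tr.pw (Suc t) x y = tr.pw t x l * a y l" by (rule tr.pw_SucE)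
      then have "tr.pw (Suc t) x y = pw 1 y l * pw t l x"
        using Suc.IH[OF Suc.prems(1) l(1)] pw_1[OF Suc.prems(2) l(1)] by simp
      then show ?thesis using pw_mult_le[of l x 1 y t] l(1) Suc.prems by simp
    next
      case False
      then show ?thesis using pw_nonneg[of "Suc t" y x] by linarith
    qed
    show "pw (Suc t) y x \<le> tr.pw (Suc t) x y"
    proof (cases "0 < pw (1 + t) y x")
      case True
      then obtain l where l: "l \<in> X" "pw (1 + t) y x = pw 1 y l * pw t l x"
        using Suc.prems pw_splitE by blast
      then have "pw (Suc t) y x = tr.pw t x l * a y l"
        using Suc.IH[OF Suc.prems(1) l(1)] pw_1[OF Suc.prems(2) l(1)] by simp
      then show ?thesis using tr.pw_Suc_ge[OF l(1), of t x y] by simp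
    next
      case False
      then have "pw (Suc t) y x \<le> 0" by simp
      then show ?thesis using tr.pw_nonneg by (rule order_trans)
    qed
  qed
qed auto

text \<open>Closure under forward \<open>q\<close>-steps suffices: a walk that starts in
  \<open>S\<close> never leaves \<open>S\<close> at multiples of \<open>q\<close>.\<close>

lemma mpow_restrict:
  assumes S: "S \<subseteq> X" and closed: "\<And>x y. x \<in> S \<Longrightarrow> y \<in> X \<Longrightarrow> 0 < pw q x y \<Longrightarrow> y \<in> S"
    and "x \<in> S" "y \<in> S"
  shows "mpow S (pw q) t x y = pw (q * t) x y"
  using assms(4)
proof (induction t arbitrary: y)
  case (Suc t)
  have fS: "finite S" using S fin finite_subset by blast
  interpret sub: max_walks S "pw q" by unfold_locales (auto simp: fS)
  have reach: "l \<in> S" if "0 < pw (q * t) x l" "l \<in> X" for t l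
    using that
  proof (induction t arbitrary: l)
    case 0
    then show ?case using assms(3) by (auto split: if_splits)
  next
    case (Suc t)
    have "0 < pw (q * t + q) x l" using Suc.prems by (simp add: algebra_simps)
    then obtain z where z: "z \<in> X" "pw (q * t + q) x l = pw (q * t) x z * pw q z l"
      using pw_splitE[of "q * t" q x l] assms(3) S Suc.prems(2) by auto
    then have "pw (q * t) x z > 0" "pw q z l > 0"
      using \<open>0 < pw (q * t + q) x l\<close> pw_nonneg[of "q * t" x z] pw_nonneg[of q z l]
      by (auto simp: zero_less_mult_iff simp del: pw_nonneg)
    then show ?case using Suc.IH closed z(1) Suc.prems(2) by blast
  qed
  have IH: "sub.pw t x l = pw (q * t) x l" if "l \<in> S" for l using Suc.IH that .
  show ?case
  proof (rule antisym)
    show "sub.pw (Suc t) x y \<le> pw (q * Suc t) x y"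
    proof (cases "0 < sub.pw (Suc t) x y")
      case True
      then obtain l where l: "l \<in> S" "sub.pw (Suc t) x y = sub.pw t x l * pw q l y"
        by (rule sub.pw_SucE)
      then show ?thesis
        using pw_mult_le[of l y "q * t" x q] IH[OF l(1)] Suc.prems S by (auto simp: algebra_simps)
    next
      case False
      then show ?thesis using pw_nonneg[of "q * Suc t" x y] by linarith
    qed
    show "pw (q * Suc t) x y \<le> sub.pw (Suc t) x y"
    proof (cases "0 < pw (q * t + q) x y")
      case True
      then obtain l where l: "l \<in> X" "pw (q * t + q) x y = pw (q * t) x l * pw q l y"
        using pw_splitE[of "q * t" q x y] assms(3) S Suc.prems by auto
      have "pw (q * t) x l \<noteq> 0" using l True by auto
      then have "0 < pw (q * t) x l" using pw_nonneg[of "q * t" x l] by linarith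
      then have lS: "l \<in> S" using reach l(1) by blast
      have "pw (q * Suc t) x y = sub.pw t x l * pw q l y"
        using l(2) IH[OF lS] by (simp add: algebra_simps)
      then show ?thesis using sub.pw_Suc_ge[OF lS, of t x y] by simp
    next
      case False
      then show ?thesis using sub.pw_nonneg[of "Suc t" x y] by (simp add: algebra_simps del: sub.pw_nonneg)
    qed
  qed
qed simp

text \<open>Periodicity inside \<open>S\<close> speaks only of multiples of \<open>q\<close>. At
  such times the row vanishes off \<open>S\<close>, so two complete rows coincide, and
  \<open>row_perI\<close> passes from there to all later times.\<close>

lemma row_per_restrict:
  assumes S: "S \<subseteq> X" and closed: "\<And>x y. x \<in> S \<Longrightarrow> y \<in> X \<Longrightarrow> 0 < pw q x y \<Longrightarrow> y \<in> S"
    and "x \<in> S" "0 < q" "row_per S (pw q) x T"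
  shows "row_per X a x (q * T)"
proof -
  obtain p where p: "p > 0"
    "\<And>t y. T \<le> t \<Longrightarrow> y \<in> S \<Longrightarrow> mpow S (pw q) (t + p) x y = mpow S (pw q) t x y"
    using assms(5) unfolding row_per_def by blast
  have sub: "mpow S (pw q) t x y = pw (q * t) x y" if "y \<in> S" for t y
    by (rule mpow_restrict[OF S closed]) (use assms(3) that in auto)
  have outside: "pw (q * t) x y = 0" if "y \<in> X" "y \<notin> S" for t y
    using that
  proof (induction t arbitrary: y)
    case 0
    then show ?case using assms(3) by auto
  next
    case (Suc t)
    show ?case
    proof (rule ccontr)
      assume "pw (q * Suc t) x y \<noteq> 0"
      then have "0 < pw (q * t + q) x y" using pw_nonneg[of "q * Suc t" x y]
        by (simp add: algebra_simps del: pw_nonneg)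
      then obtain l where l: "l \<in> X" "pw (q * t + q) x y = pw (q * t) x l * pw q l y"
        using pw_splitE[of "q * t" q x y] assms(3) S Suc.prems by auto
      have n0: "pw (q * t) x l \<noteq> 0" "pw q l y \<noteq> 0" using l \<open>0 < pw (q * t + q) x y\<close> by auto
      have "l \<in> S" using Suc.IH[OF l(1)] n0 by blast
      then show False
        using closed[OF _ Suc.prems(1)] n0 Suc.prems(2) pw_nonneg[of q l y] by fastforce
    qed
  qed
  show ?thesis
  proof (rule row_perI)
    show "0 < q * p" using p assms by simp
    show "x \<in> X" using assms by auto
    fix y assume y: "y \<in> X"
    show "pw (q * T + q * p) x y = pw (q * T) x y"
    proof (cases "y \<in> S")
      case True
      then show ?thesis using p(2)[of T y] by (simp add: sub flip: distrib_left)
    next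
      case False
      then show ?thesis using outside[OF y] by (simp flip: distrib_left)
    qed
  qed
qed

end

subsection \<open>Critical walks\<close>

lemma mult_eq_1_pair:
  fixes p q p' q' :: real
  assumes "p * q = 1" "p' * q' = 1"
  shows "(p * p') * (q' * q) = 1"
proof -
  have "(p * p') * (q' * q) = (p * q) * (p' * q')" by (simp add: mult_ac)
  then show ?thesis using assms by simp
qed

locale crit_walks = max_walks +
  assumes closed_le: "x \<in> X \<Longrightarrow> pw t x x \<le> 1"
begin

text \<open>The eigenvalue is normalised to 1, so a critical walk is a walk that belongs to a closed
  walk of weight 1. Only the weight of an optimal walk of length \<open>j\<close> matters.\<close>

definition crit :: "nat \<Rightarrow> 'a \<Rightarrow> 'a \<Rightarrow> bool" where
  "crit j x y \<longleftrightarrow> (\<exists>s. pw j x y * pw s y x = 1)"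

definition component :: "'a \<Rightarrow> 'a set" where
  "component x = {y \<in> X. \<exists>j. crit j x y}"

lemma finite_comp: "finite (component x)" using fin by (simp add: component_def)

lemma round_trip_le: "x \<in> X \<Longrightarrow> y \<in> X \<Longrightarrow> pw s x y * pw t y x \<le> 1"
  using pw_mult_le[of y x s x t] closed_le[of x "s + t"] by linarith

text \<open>Round trips weigh at most 1, so criticality reduces to an inequality, which is what
  concatenating walks provides.\<close>

lemma crit_iff_ge:
  assumes "x \<in> X" "y \<in> X"
  shows "crit j x y \<longleftrightarrow> (\<exists>s. 1 \<le> pw j x y * pw s y x)"
  unfolding crit_def using round_trip_le[OF assms] by (metis order_antisym order_refl)

lemma crit_pos: "crit j x y \<Longrightarrow> 0 < pw j x y"
  unfolding crit_def using pw_nonneg[of j x y] by (metis less_eq_real_def mult_zero_left zero_neq_one)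

lemma crit_0 [simp]: "crit 0 x x"
  unfolding crit_def by (intro exI[of _ 0]) simp

lemma crit_sym: "crit j x y \<Longrightarrow> \<exists>s. crit s y x"
  unfolding crit_def by (metis mult.commute)

lemma crit_trans:
  assumes "crit i x y" "crit j y z" "x \<in> X" "y \<in> X" "z \<in> X"
  shows "crit (i + j) x z"
proof -
  obtain s where s: "pw i x y * pw s y x = 1" using assms(1) unfolding crit_def by auto
  obtain s' where s': "pw j y z * pw s' z y = 1" using assms(2) unfolding crit_def by auto
  have "1 = (pw i x y * pw j y z) * (pw s' z y * pw s y x)"
    using mult_eq_1_pair[OF s s'] by simp
  also have "\<dots> \<le> pw (i + j) x z * pw (s' + s) z x"
    using assms by (intro mult_mono pw_mult_le mult_nonneg_nonneg) auto
  finally show ?thesis using crit_iff_ge assms by blast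
qed

lemma crit_closed:
  assumes "x \<in> X"
  shows "crit t x x \<longleftrightarrow> pw t x x = 1"
proof
  assume "crit t x x"
  then obtain s where s: "pw t x x * pw s x x = 1" unfolding crit_def by auto
  have "pw t x x * pw s x x \<le> pw t x x * 1"
    using closed_le[OF assms, of s] by (intro mult_left_mono) auto
  then show "pw t x x = 1" using s closed_le[OF assms, of t] by linarith
next
  assume "pw t x x = 1"
  then show "crit t x x" unfolding crit_def by (intro exI[of _ 0]) simp
qed

lemma crit_power:
  assumes "crit t x x" "x \<in> X"
  shows "crit (t * m) x x"
  by (induction m) (use assms crit_trans[of t x x] in auto)

lemma crit_comp: "y \<in> component x \<Longrightarrow> x \<in> X \<Longrightarrow> component y = component x"
  unfolding component_def using crit_sym crit_trans by (auto; meson)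

lemma crit_in_comp: "crit j x y \<Longrightarrow> y \<in> X \<Longrightarrow> y \<in> component x"
  by (auto simp: component_def)

lemma comp_subset: "component x \<subseteq> X" by (auto simp: component_def)

lemma self_in_comp: "x \<in> X \<Longrightarrow> x \<in> component x"
  using crit_0 unfolding component_def by blast

text \<open>Hence all critical walks from \<open>x\<close> to \<open>y\<close> have the same weight, which serves as a
  potential.\<close>

lemma crit_inverse:
  assumes "crit i x y" "crit j y x" "x \<in> X" "y \<in> X"
  shows "pw i x y * pw j y x = 1"
proof -
  obtain s where s: "pw i x y * pw s y x = 1" using assms(1) unfolding crit_def by auto
  obtain s' where s': "pw j y x * pw s' x y = 1" using assms(2) unfolding crit_def by auto
  have "1 = (pw i x y * pw j y x) * (pw s' x y * pw s y x)"
    using mult_eq_1_pair[OF s s'] by simp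
  also have "\<dots> \<le> (pw i x y * pw j y x) * 1"
    using assms round_trip_le by (intro mult_left_mono) auto
  finally show ?thesis using round_trip_le[OF assms(3,4), of i j] by linarith
qed

text \<open>No walk of length \<open>i + j\<close> from \<open>x\<close> to \<open>z\<close> beats a
  detour through \<open>y\<close> made of critical walks: it would give a closed walk heavier than 1
  with the returns. This makes the potential multiplicative along critical walks.\<close>

lemma crit_mult:
  assumes "crit i x y" "crit j y z" "x \<in> X" "y \<in> X" "z \<in> X"
  shows "pw (i + j) x z = pw i x y * pw j y z"
proof -
  obtain s where s: "crit s y x" using crit_sym assms(1) by blast
  obtain s' where s': "crit s' z y" using crit_sym assms(2) by blast
  have 1: "pw (i + j) x z * pw (s' + s) z x = 1"
    using assms s s' by (intro crit_inverse crit_trans)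
  have 2: "pw i x y * pw j y z * (pw s' z y * pw s y x) = 1"
    using crit_inverse[OF assms(1) s] crit_inverse[OF assms(2) s'] assms
    by (intro mult_eq_1_pair)
  have "pw (i + j) x z * (pw s' z y * pw s y x) \<le> 1"
    using 1 pw_mult_le[of y x s' z s] assms
    by (metis mult_left_mono pw_nonneg)
  moreover have "0 < pw s' z y * pw s y x" using s s' crit_pos by simp
  ultimately have "pw (i + j) x z \<le> pw i x y * pw j y z"
    using 2 by (metis mult_le_cancel_right_pos)
  then show ?thesis using pw_mult_le[of y z i x j] assms by simp
qed

text \<open>For a section from \<open>f i\<close> to \<open>f j\<close>, the rest of the closed
  walk, through \<open>y\<close> and \<open>x\<close>, is the return walk that witnesses
  criticality.\<close>

lemma crit_walk:
  assumes "crit t x y" "x \<in> X" "y \<in> X"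
  obtains f where "f 0 = x" "f t = y" "\<And>i. f i \<in> X"
    "\<And>i j. i \<le> j \<Longrightarrow> j \<le> t \<Longrightarrow> crit (j - i) (f i) (f j)"
proof -
  obtain f where f: "f 0 = x" "f t = y" "\<And>i. f i \<in> X"
    "\<And>i j. i \<le> j \<Longrightarrow> j \<le> t \<Longrightarrow>
       pw t x y = pw i x (f i) * pw (j - i) (f i) (f j) * pw (t - j) (f j) y"
    using pw_walk_split[OF crit_pos[OF assms(1)] assms(2,3)] by blast
  obtain s where s: "pw t x y * pw s y x = 1" using assms(1) unfolding crit_def by auto
  have "crit (j - i) (f i) (f j)" if "i \<le> j" "j \<le> t" for i j
  proof -
    have "1 = pw (j - i) (f i) (f j) * (pw (t - j) (f j) y * pw s y x * pw i x (f i))"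
      using s f(4)[OF that] by (simp add: algebra_simps)
    also have "\<dots> \<le> pw (j - i) (f i) (f j) * pw (t - j + s + i) (f j) (f i)"
      using assms f by (intro mult_left_mono pw_mult3_le) auto
    finally show ?thesis using crit_iff_ge f(3) by blast
  qed
  with f that show ?thesis by blast
qed

text \<open>The closed walk is unrolled into an infinite periodic one, so that it can be entered at
  any position and followed for any length.\<close>

lemma crit_cycle_walk:
  assumes "crit l x x" "x \<in> X" "0 < l"
  obtains F where "F 0 = x" "\<And>i. F i \<in> X" "\<And>i. F (i + l) = F i"
    "\<And>i j. crit j (F i) (F (i + j))"
proof -
  obtain f where f: "f 0 = x" "f l = x" "\<And>i. f i \<in> X"
    "\<And>i j. i \<le> j \<Longrightarrow> j \<le> l \<Longrightarrow> crit (j - i) (f i) (f j)"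
    using crit_walk[OF assms(1,2,2)] by blast
  define F where "F i = f (i mod l)" for i
  have step: "crit 1 (F i) (F (Suc i))" for i
  proof -
    have "crit 1 (f (i mod l)) (f (Suc (i mod l)))"
      using f(4)[of "i mod l" "Suc (i mod l)"] assms(3) by (simp add: Suc_leI)
    moreover have "f (Suc (i mod l)) = f (Suc i mod l)"
      using f(1,2) assms(3) by (simp add: mod_Suc)
    ultimately show ?thesis by (simp add: F_def)
  qed
  have "crit j (F i) (F (i + j))" for i j
  proof (induction j)
    case (Suc j)
    then show ?case using crit_trans[OF Suc step] f(3) by (simp add: F_def)
  qed simp
  moreover have "F 0 = x" "\<And>i. F i \<in> X" "\<And>i. F (i + l) = F i"
    using f assms by (auto simp: F_def)
  ultimately show ?thesis using that by blast
qed

text \<open>A repetition within \<open>l\<close> consecutive positions would close a critical walk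
  shorter than \<open>l\<close>.\<close>

lemma minimal_cycle_inj:
  assumes "\<And>i. F i \<in> X" "\<And>i j. crit j (F i) (F (i + j))"
    and "\<And>i m. 0 < m \<Longrightarrow> crit m (F i) (F i) \<Longrightarrow> l \<le> m"
  shows "inj_on F {i..<i + l}"
proof (rule linorder_inj_onI)
  fix u v assume uv: "u < v" "u \<in> {i..<i + l}" "v \<in> {i..<i + l}"
  show "F u \<noteq> F v"
  proof
    assume "F u = F v"
    then have "crit (v - u) (F u) (F u)" using assms(2)[of "v - u" u] uv by simp
    then have "l \<le> v - u" using assms(3) uv by simp
    then show False using uv by auto
  qed
qed auto

text \<open>Minimality of the length keeps the walk out of \<open>Y\<close> before its end and free
  of repetitions, since a repeated section could be cut out. Steps of length \<open>e\<close> allow,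
  with \<open>e = 2\<close>, walks that stay on one side of a bipartite digraph.\<close>

lemma shortest_crit_walk:
  assumes "crit (e * j) x y" "y \<in> Y" "x \<in> X" "Y \<subseteq> X"
  obtains l h where "h 0 = x" "h l \<in> Y" "\<And>i. h i \<in> X" "\<And>i. i < l \<Longrightarrow> h i \<notin> Y"
    "\<And>i j. i \<le> j \<Longrightarrow> j \<le> l \<Longrightarrow> crit (e * (j - i)) (h i) (h j)" "inj_on h {..<l}"
proof -
  define l where "l = (LEAST l. \<exists>y\<in>Y. crit (e * l) x y)"
  have ex: "\<exists>y\<in>Y. crit (e * l) x y"
    unfolding l_def by (rule LeastI[of _ j]) (use assms in auto)
  then obtain z where z: "z \<in> Y" "crit (e * l) x z" by blast
  have least: "l \<le> l'" if "y \<in> Y" "crit (e * l') x y" for l' y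
    unfolding l_def by (rule Least_le) (use that in auto)
  have zX: "z \<in> X" using z assms by auto
  obtain f where f: "f 0 = x" "f (e * l) = z" "\<And>i. f i \<in> X"
    "\<And>i j. i \<le> j \<Longrightarrow> j \<le> e * l \<Longrightarrow> crit (j - i) (f i) (f j)"
    using crit_walk[OF z(2) assms(3) zX] by blast
  define h where "h i = f (e * i)" for i
  have c: "crit (e * (j - i)) (h i) (h j)" if "i \<le> j" "j \<le> l" for i j
    using f(4)[of "e * i" "e * j"] that by (simp add: h_def diff_mult_distrib2)
  show ?thesis
  proof (rule that)
    show "h 0 = x" "h l \<in> Y" "\<And>i. h i \<in> X" using f z by (auto simp: h_def)
    show "crit (e * (j - i)) (h i) (h j)" if "i \<le> j" "j \<le> l" for i j using c that .
    show "h i \<notin> Y" if "i < l" for i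
      using least[of "h i" i] c[of 0 i] that f(1) by (auto simp: h_def)
    show "inj_on h {..<l}"
    proof (rule linorder_inj_onI)
      fix u v assume uv: "u < v" "u \<in> {..<l}" "v \<in> {..<l}"
      show "h u \<noteq> h v"
      proof
        assume eq: "h u = h v"
        have "crit (e * u) (h 0) (h u)" "crit (e * (l - v)) (h v) (h l)"
          using uv c[of 0 u] c[of v l] by auto
        then have "crit (e * u + e * (l - v)) (h 0) (h l)"
          using eq f(3) crit_trans[of "e * u" "h 0" "h u" "e * (l - v)" "h l"] by (simp add: h_def)
        moreover have "h l \<in> Y" using f z by (simp add: h_def)
        ultimately have "l \<le> u + (l - v)"
          using least[of "h l" "u + (l - v)"] f(1) by (simp add: h_def distrib_left)
        then show False using uv by auto
      qed
    qed auto
  qed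
qed

text \<open>A long walk from \<open>x\<close> is preceded by the critical return from
  \<open>z\<close>, shortened by periodicity of the row of \<open>z\<close>, and preceded again by
  the critical walk from \<open>x\<close> to \<open>z\<close>. The two critical weights
  cancel.\<close>

lemma row_per_propagate:
  assumes "crit j x z" "x \<in> X" "z \<in> X" "row_per X a z T"
  shows "row_per X a x (T + j)"
proof -
  obtain s where s: "pw j x z * pw s z x = 1" using assms(1) unfolding crit_def by auto
  obtain p where p: "0 < p" "\<And>t y. T \<le> t \<Longrightarrow> y \<in> X \<Longrightarrow> pw (t + p) z y = pw t z y"
    using assms(4) unfolding row_per_def by blast
  have pm: "pw (t + p * m) z y = pw t z y" if "T \<le> t" "y \<in> X" for t m y
  proof (induction m)
    case (Suc m)
    then show ?case using p(2)[of "t + p * m" y] that by (simp add: algebra_simps)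
  qed simp
  show ?thesis
  proof (cases "j + s = 0")
    case True
    then have "x = z" using s by (cases "x = z") auto
    then show ?thesis using assms(4) True by (auto intro: row_per_mono)
  next
    case False
    \<comment> \<open>\<open>P\<close> is a multiple of \<open>j + s\<close>, so there is a critical
      closed walk of length \<open>P\<close> at \<open>x\<close>, and \<open>P + (j + s)\<close> is
      a multiple of \<open>p\<close>, so the row of \<open>z\<close> returns exactly to time
      \<open>T\<close>. The factor \<open>2 * p - 1\<close> instead of \<open>p - 1\<close> keeps
      \<open>P\<close> positive when \<open>p = 1\<close>.\<close>
    define P where "P = (j + s) * (2 * p - 1)"
    have P: "P + (j + s) = p * (2 * (j + s))" using p(1)
      by (cases p) (auto simp: P_def algebra_simps)
    have "crit (j + s) x x"
      using crit_trans[OF assms(1), of s x] s assms(2,3)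
      by (auto simp: crit_def mult.commute)
    then have loop: "pw P x x = 1" unfolding P_def
      using crit_power crit_closed assms(2) by blast
    show ?thesis
    proof (rule row_perI)
      show "0 < P" using False p(1) by (auto simp: P_def)
      show "x \<in> X" by fact
      fix y assume y: "y \<in> X"
      show "pw (T + j + P) x y = pw (T + j) x y"
      proof (rule antisym)
        have "pw (T + j + P) x y = pw j x z * (pw s z x * pw (T + j + P) x y)"
          using s by (simp add: mult.assoc[symmetric])
        also have "\<dots> \<le> pw j x z * pw (s + (T + j + P)) z y"
          using assms y by (intro mult_left_mono pw_mult_le) auto
        also have "s + (T + j + P) = T + p * (2 * (j + s))" using P by simp
        also have "pw \<dots> z y = pw T z y" using pm y by blast
        also have "pw j x z * pw T z y \<le> pw (T + j) x y"
          using pw_mult_le[of z y j x T] assms y by (simp add: add.commute)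
        finally show "pw (T + j + P) x y \<le> pw (T + j) x y" .
        show "pw (T + j) x y \<le> pw (T + j + P) x y"
          using pw_mult_le[of x y P x "T + j"] loop assms y by (simp add: add.commute)
      qed
    qed
  qed
qed

text \<open>A walk with \<open>card X\<close> arcs repeats a node. The closed section between the
  two visits has at least one arc; it is cut out and all but one of its arcs are replaced by copies
  of the loop at \<open>z\<close>, so the length drops by exactly one without loss of
  weight.\<close>

lemma row_per_loop:
  assumes "z \<in> X" "crit 1 z z"
  shows "row_per X a z (card X - 1)"
proof (rule row_perI)
  let ?n = "card X"
  have n: "0 < ?n" using assms(1) fin by (auto simp: card_gt_0_iff)
  have loop: "pw m z z = 1" for m
    using crit_power[OF assms(2,1), of m] crit_closed[OF assms(1)] by simp
  show "0 < (1::nat)" "z \<in> X" using assms by auto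
  fix y assume y: "y \<in> X"
  show "pw (?n - 1 + 1) z y = pw (?n - 1) z y"
  proof (rule antisym)
    show "pw (?n - 1) z y \<le> pw (?n - 1 + 1) z y"
      using pw_mult_le[of z y 1 z "?n - 1"] loop[of 1] assms y by (simp add: add.commute)
    show "pw (?n - 1 + 1) z y \<le> pw (?n - 1) z y"
    proof (cases "0 < pw ?n z y")
      case True
      then obtain f where f: "f 0 = z" "f ?n = y" "\<And>i. f i \<in> X"
        "\<And>i j. i \<le> j \<Longrightarrow> j \<le> ?n \<Longrightarrow>
          pw ?n z y = pw i z (f i) * pw (j - i) (f i) (f j) * pw (?n - j) (f j) y"
        using pw_walk_split[OF True assms(1) y] by blast
      have "f ` {..?n} \<subseteq> X" using f by auto
      then have "card (f ` {..?n}) \<le> ?n" using fin by (rule card_mono[rotated])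
      then have "\<not> inj_on f {..?n}" using card_image[of f "{..?n}"] by auto
      then obtain i j where ij: "i < j" "j \<le> ?n" "f i = f j"
        unfolding inj_on_def by (metis atMost_iff linorder_neqE_nat)
      have "pw ?n z y = pw i z (f i) * pw (j - i) (f i) (f i) * pw (?n - j) (f i) y"
        using f(4)[of i j] ij by simp
      also have "\<dots> \<le> pw i z (f i) * 1 * pw (?n - j) (f i) y"
        using closed_le f(3) by (intro mult_right_mono mult_left_mono) auto
      also have "\<dots> = pw (j - i - 1) z z * pw i z (f i) * pw (?n - j) (f i) y"
        using loop by simp
      also have "\<dots> \<le> pw (j - i - 1 + i + (?n - j)) z y"
        using assms f y by (intro pw_mult3_le) auto
      also have "j - i - 1 + i + (?n - j) = ?n - 1" using ij by simp
      finally show ?thesis using n by simp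
    next
      case False
      then have "pw (?n - 1 + 1) z y \<le> 0" using n by simp
      then show ?thesis using pw_nonneg by (rule order_trans)
    qed
  qed
qed

lemma crit_walks_restrict:
  assumes S: "S \<subseteq> X" and closed: "\<And>x y. x \<in> S \<Longrightarrow> y \<in> X \<Longrightarrow> 0 < pw q x y \<Longrightarrow> y \<in> S"
  shows "crit_walks S (pw q)"
proof -
  have fS: "finite S" using S fin finite_subset by blast
  show ?thesis
  proof
    fix x t assume "x \<in> S"
    then have "mpow S (pw q) t x x = pw (q * t) x x"
      by (intro mpow_restrict[OF S closed])
    then show "mpow S (pw q) t x x \<le> 1" using closed_le S \<open>x \<in> S\<close> by auto
  qed (use fS in auto)
qed

lemma row_per_restrict_loop:
  assumes S: "S \<subseteq> X" and closed: "\<And>x y. x \<in> S \<Longrightarrow> y \<in> X \<Longrightarrow> 0 < pw q x y \<Longrightarrow> y \<in> S"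
    and "z \<in> S" "0 < q" "crit q z z"
  shows "row_per X a z (q * (card S - 1))"
proof -
  interpret sub: crit_walks S "pw q" by (rule crit_walks_restrict[OF S closed])
  have "sub.pw 1 z z = pw (q * 1) z z"
    using assms(3) by (intro mpow_restrict[OF S closed])
  then have "sub.pw 1 z z = 1" using crit_closed[of z q] assms(3,5) S by auto
  then have "row_per S (pw q) z (card S - 1)"
    using sub.row_per_loop sub.crit_closed assms(3) by blast
  then show ?thesis by (intro row_per_restrict[OF S closed] assms(3,4))
qed

end

subsection \<open>Critical Hamiltonian cycles\<close>

text \<open>This is the Davenport constant of the cyclic group of order \<open>n\<close> with its
  extremal case. Prefix sums in any order of \<open>J\<close> are distinct modulo \<open>n\<close>,
  because the difference of two of them is a sum over a nonempty subset.\<close>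

lemma subset_sum_zero_free:
  fixes s :: "'b \<Rightarrow> int"
  assumes "finite J" and free: "\<And>K. K \<subseteq> J \<Longrightarrow> K \<noteq> {} \<Longrightarrow> \<not> [sum s K = 0] (mod int n)"
    and n: "0 < n"
  shows "card J \<le> n - 1"
    and "card J = n - 1 \<Longrightarrow> x \<in> J \<Longrightarrow> y \<in> J \<Longrightarrow> [s x = s y] (mod int n)"
proof -
  define S where "S xs i = (\<Sum>z\<in>set (take i xs). s z) mod int n" for xs i
  have diff: "[sum s (set (take j xs) - set (take i xs)) = S xs j - S xs i] (mod int n)"
    if "i \<le> j" for xs i j
  proof -
    have "set (take i xs) \<subseteq> set (take j xs)" using that by (rule set_take_subset_set_take)
    then have "sum s (set (take j xs) - set (take i xs)) =
        sum s (set (take j xs)) - sum s (set (take i xs))" by (intro sum_diff) auto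
    then show ?thesis by (simp add: S_def cong_def mod_diff_eq)
  qed
  have inj: "inj_on (S xs) {..card J}" if xs: "set xs = J" "distinct xs" for xs
  proof (rule linorder_inj_onI)
    fix i j assume ij: "i < j" "i \<in> {..card J}" "j \<in> {..card J}"
    have len: "length xs = card J" using xs distinct_card by metis
    have "xs ! i \<in> set (take j xs)" using ij len by (auto simp: in_set_conv_nth)
    moreover have "xs ! i \<notin> set (take i xs)"
      using ij len xs(2) by (auto simp: in_set_conv_nth nth_eq_iff_index_eq)
    ultimately have ne: "set (take j xs) - set (take i xs) \<noteq> {}" by blast
    have sub: "set (take j xs) - set (take i xs) \<subseteq> J" using xs set_take_subset by fastforce
    show "S xs i \<noteq> S xs j"
    proof
      assume "S xs i = S xs j"
      then show False using diff[of i j xs] free[OF sub ne] ij by simp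
    qed
  qed auto
  have range: "S xs ` A \<subseteq> {0..<int n}" for xs A using n by (auto simp: S_def)
  obtain xs where xs: "set xs = J" "distinct xs" using finite_distinct_list[OF assms(1)] by blast
  have "card (S xs ` {..card J}) \<le> card {0..<int n}" by (intro card_mono range) auto
  then have "Suc (card J) \<le> n" using card_image[OF inj[OF xs]] by simp
  then show "card J \<le> n - 1" by simp
  assume J: "card J = n - 1" and x: "x \<in> J" and y: "y \<in> J"
  show "[s x = s y] (mod int n)"
  proof (cases "x = y")
    case False
    obtain zs where zs: "set zs = J - {x, y}" "distinct zs"
      using finite_distinct_list[of "J - {x, y}"] assms(1) by blast
    let ?xs = "x # y # zs"
    have xs: "set ?xs = J" "distinct ?xs" using zs x y False by auto
    \<comment> \<open>The \<open>n\<close> distinct prefix sums exhaust the residues, so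
      \<open>s y\<close> is one of them in the order that begins with \<open>x, y\<close>. The empty
      prefix and every prefix containing \<open>y\<close> would produce a zero-sum subset, which
      leaves only the prefix \<open>x\<close>.\<close>
    have "card (S ?xs ` {..card J}) = n" using card_image[OF inj[OF xs]] J n by simp
    then have "S ?xs ` {..card J} = {0..<int n}" by (intro card_subset_eq range) auto
    moreover have "s y mod int n \<in> {0..<int n}" using n by simp
    ultimately obtain j where j: "j \<le> card J" "s y mod int n = S ?xs j" by (metis atMost_iff imageE)
    consider "j = 0" | "j = 1" | m where "j = Suc (Suc m)" by (metis One_nat_def not0_implies_Suc)
    then show ?thesis
    proof cases
      case 1
      then have "[sum s {y} = 0] (mod int n)" using j by (simp add: S_def cong_def)
      then show ?thesis using free[of "{y}"] y by simp
    next
      case 2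
      then show ?thesis using j by (simp add: S_def cong_def)
    next
      case 3
      let ?K = "insert x (set (take m zs))"
      have K: "y \<notin> ?K" using zs False set_take_subset[of m zs] by auto
      have "set (take j ?xs) = insert y ?K" using 3 by auto
      then have "S ?xs j = (s y + sum s ?K) mod int n" using K by (simp add: S_def)
      then have "[s y = s y + sum s ?K] (mod int n)" using j by (simp add: cong_def)
      then have "[sum s ?K = 0] (mod int n)"
        using cong_add_lcancel[of "s y" 0 "sum s ?K"] by (simp add: cong_sym_eq)
      moreover have "?K \<subseteq> J" using x zs set_take_subset[of m zs] by auto
      ultimately show ?thesis using free[of ?K] by blast
    qed
  qed simp
qed

context max_walks
begin

text \<open>The weights are normalised so that every arc weighs at most 1 and the arcs of the
  Hamiltonian cycle \<open>F\<close> weigh 1. The other arcs of a walk from \<open>F 0\<close> are its jumps. Only the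
  sum of the shifts of the jumps modulo \<open>n\<close> matters for the lengths of the walks that use them,
  so a minimal set \<open>J\<close> of jumps with the same sum is kept, and the jumps are joined by pieces
  of the cycle. \<open>J\<close> is free of zero-sum subsets; if it has the maximal size \<open>n - 1\<close>, all shifts
  agree and the best jump can be repeated.\<close>

lemma hamiltonian_normalised:
  fixes F :: "nat \<Rightarrow> 'a"
  defines "n \<equiv> card X"
  assumes n2: "2 \<le> n" and F: "F ` {..<n} = X" "\<And>i. F (i + n) = F i"
    and le1: "\<And>x y. x \<in> X \<Longrightarrow> y \<in> X \<Longrightarrow> a x y \<le> 1"
    and step1: "\<And>i. a (F i) (F (Suc i)) = 1"
    and y: "y \<in> X"
  shows "pw ((n - 1)\<^sup>2 + 1 + n) (F 0) y \<le> pw ((n - 1)\<^sup>2 + 1) (F 0) y"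
proof -
  let ?T = "(n - 1)\<^sup>2 + 1"
  have n0: "0 < n" using n2 by simp
  have Fmod: "F (i mod n) = F i" for i
  proof -
    have "F (j + n * m) = F j" for j m
      by (induction m) (use F(2)[of "j + n * _"] in \<open>auto simp: algebra_simps\<close>)
    then show ?thesis by (metis mod_mult_div_eq)
  qed
  have FX: "F i \<in> X" for i using F(1) Fmod[of i] n0 by (metis imageI lessThan_iff mod_less_divisor)
  have Fstep: "1 \<le> pw j (F i) (F (i + j))" for i j
    using walk_le_pw[of F i j] FX step1 by simp
  define ix where "ix x = (SOME i. i < n \<and> F i = x)" for x
  have ix: "F (ix x) = x" if "x \<in> X" for x
  proof -
    have "\<exists>i. i < n \<and> F i = x" using F(1) that by (metis imageE lessThan_iff)
    then show ?thesis unfolding ix_def by (metis (mono_tags, lifting) someI_ex)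
  qed
  \<comment> \<open>Any two nodes are joined along the cycle by fewer than \<open>n\<close> arcs of
    weight 1; the number of arcs is the difference of their positions modulo
    \<open>n\<close>.\<close>
  have cyc: "\<exists>L<n. [int L = int (ix z) - int (ix x)] (mod int n) \<and> 1 \<le> pw L x z"
    if xz: "x \<in> X" "z \<in> X" for x z
  proof -
    let ?L = "nat ((int (ix z) - int (ix x)) mod int n)"
    have L: "int ?L = (int (ix z) - int (ix x)) mod int n" using n0 by simp
    have c: "[int ?L = int (ix z) - int (ix x)] (mod int n)" unfolding L by (simp add: cong_def)
    then have "[int (ix x) + int ?L = int (ix z)] (mod int n)"
      using cong_add_lcancel[of "int (ix x)" "int ?L" "int (ix z) - int (ix x)"] by simp
    then have "[ix x + ?L = ix z] (mod n)" by (metis cong_int_iff of_nat_add)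
    then have "F (ix x + ?L) = z" using Fmod ix[OF xz(2)] unfolding cong_def by metis
    then have "1 \<le> pw ?L x z" using Fstep[of ?L "ix x"] ix[OF xz(1)] by simp
    moreover have "?L < n" using L n0 by (metis nat_int of_nat_0_less_iff pos_mod_bound zless_nat_eq_int_zless)
    ultimately show ?thesis using c by blast
  qed
  show ?thesis
  proof (cases "0 < pw (?T + n) (F 0) y")
    case False
    then show ?thesis using pw_nonneg[of ?T "F 0" y] by linarith
  next
    case True
    let ?N = "?T + n"
    obtain f where f: "f 0 = F 0" "f ?N = y" "\<And>i. f i \<in> X"
      "pw ?N (F 0) y = (\<Prod>l<?N. a (f l) (f (Suc l)))"
      using pw_walk[OF True FX y] by blast
    define b where "b l = a (f l) (f (Suc l))" for l
    \<comment> \<open>The shift compares an arc with one step of the cycle. It is 0 modulo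
      \<open>n\<close> exactly for arcs along the cycle, so a zero-sum-free set consists of jumps
      only.\<close>
    define s where "s l = int (ix (f (Suc l))) - int (ix (f l)) - 1" for l
    have b01: "0 \<le> b l" "b l \<le> 1" for l using f nonneg le1 by (auto simp: b_def)
    have tele: "(\<Sum>l<?N. s l) = int (ix y) - int (ix (F 0)) - int ?N"
      using sum_lessThan_telescope[of "\<lambda>l. int (ix (f l))" ?N] f(1,2)
      by (simp add: s_def sum_subtractf)
    define good where "good J \<longleftrightarrow> J \<subseteq> {..<?N} \<and> [sum s J = sum s {..<?N}] (mod int n)" for J
    define J where "J = (ARG_MIN card J. good J)"
    have gJ: "good J" and Jmin: "\<And>K. good K \<Longrightarrow> card J \<le> card K"
      using arg_min_nat_lemma[of good "{..<?N}" card] unfolding J_def good_def by auto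
    have Jsub: "J \<subseteq> {..<?N}" and Jc: "[sum s J = sum s {..<?N}] (mod int n)"
      using gJ by (auto simp: good_def)
    have finJ: "finite J" using Jsub finite_subset by blast
    have free: "\<not> [sum s K = 0] (mod int n)" if K: "K \<subseteq> J" "K \<noteq> {}" for K
    proof
      assume "[sum s K = 0] (mod int n)"
      then have "[sum s J - sum s K = sum s {..<?N} - 0] (mod int n)" using Jc by (intro cong_diff)
      then have "good (J - K)" using Jsub K sum_diff[OF finJ K(1), of s] by (auto simp: good_def)
      then have "card J \<le> card (J - K)" by (rule Jmin)
      then show False using K finJ
        by (metis card_Diff_subset card_gt_0_iff card_mono diff_less finite_subset leD order_less_le_trans)
    qed
    \<comment> \<open>Dropping arcs cannot lower the product, since all weights are at most
      1.\<close>
    have wJ: "pw ?N (F 0) y \<le> prod b J"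
    proof -
      have "pw ?N (F 0) y = prod b ({..<?N} - J) * prod b J"
        using prod.subset_diff[OF Jsub, of b] f(4) by (simp add: b_def)
      also have "\<dots> \<le> 1 * prod b J"
        using b01 by (intro mult_right_mono prod_le_1 prod_nonneg) auto
      finally show ?thesis by simp
    qed
    \<comment> \<open>The congruence makes \<open>L\<close> equal to \<open>?T\<close> modulo
      \<open>n\<close>. Hence a length below \<open>?T + n\<close> is already at most
      \<open>?T\<close>, and full rounds of the cycle fill up the difference.\<close>
    have "\<exists>L. L \<le> ?T + n - 1 \<and> [int L = int (ix y) - int (ix (F 0)) - sum s J] (mod int n)
        \<and> prod b J \<le> pw L (F 0) y"
    proof (cases "card J \<le> n - 2")
      case True
      \<comment> \<open>A jump together with the piece of cycle leading to it costs at most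
        \<open>n\<close> arcs, and the final piece at most \<open>n - 1\<close>.\<close>
      have "\<exists>L. L \<le> n - 1 + n * card K \<and> [int L = int (ix y) - int (ix x) - sum s K] (mod int n)
          \<and> prod b K \<le> pw L x y" if "finite K" "x \<in> X" for K x
        using that
      proof (induction K arbitrary: x rule: finite_induct)
        case empty
        obtain L where "L < n" "[int L = int (ix y) - int (ix x)] (mod int n)" "1 \<le> pw L x y"
          using cyc[OF empty y] by blast
        then show ?case by (intro exI[of _ L]) auto
      next
        case (insert e K)
        obtain L1 where L1: "L1 < n" "[int L1 = int (ix (f e)) - int (ix x)] (mod int n)"
            "1 \<le> pw L1 x (f e)"
          using cyc[OF insert.prems, of "f e"] f(3) by blast
        obtain L2 where L2: "L2 \<le> n - 1 + n * card K"
            "[int L2 = int (ix y) - int (ix (f (Suc e))) - sum s K] (mod int n)"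
            "prod b K \<le> pw L2 (f (Suc e)) y"
          using insert.IH[of "f (Suc e)"] f(3) by blast
        have "[int L1 + 1 + int L2 = (int (ix (f e)) - int (ix x)) + 1
            + (int (ix y) - int (ix (f (Suc e))) - sum s K)] (mod int n)"
          using L1 L2 by (intro cong_add) auto
        moreover have "(int (ix (f e)) - int (ix x)) + 1
            + (int (ix y) - int (ix (f (Suc e))) - sum s K) = int (ix y) - int (ix x) - sum s (insert e K)"
          using insert.hyps by (simp add: s_def)
        ultimately have c: "[int (L1 + 1 + L2) = int (ix y) - int (ix x) - sum s (insert e K)] (mod int n)"
          by (simp only: of_nat_add of_nat_1)
        have "prod b (insert e K) = 1 * b e * prod b K" using insert.hyps by simp
        also have "\<dots> \<le> pw L1 x (f e) * pw 1 (f e) (f (Suc e)) * pw L2 (f (Suc e)) y"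
          using L1 L2 b01 f(3) by (intro mult_mono mult_nonneg_nonneg prod_nonneg) (auto simp: pw_1[unfolded One_nat_def] b_def)
        also have "\<dots> \<le> pw (L1 + 1 + L2) x y" using f(3) y by (intro pw_mult3_le)
        finally have "prod b (insert e K) \<le> pw (L1 + 1 + L2) x y" .
        moreover have "L1 + 1 + L2 \<le> n - 1 + n * card (insert e K)"
          using L1 L2 insert.hyps by simp
        ultimately show ?case using c by blast
      qed
      from this[OF finJ FX] obtain L where L: "L \<le> n - 1 + n * card J"
        "[int L = int (ix y) - int (ix (F 0)) - sum s J] (mod int n)" "prod b J \<le> pw L (F 0) y"
        by blast
      obtain m where m: "n = m + 2" using n2 by (metis le_iff_add add.commute)
      have "n - 1 + n * card J \<le> n - 1 + n * (n - 2)" using True by simp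
      also have "\<dots> \<le> ?T + n - 1" unfolding m by (simp add: power2_eq_square)
      finally show ?thesis using L by (meson order_trans)
    next
      case False
      then have cJ: "card J = n - 1"
        using subset_sum_zero_free(1)[OF finJ free n0] by simp
      then have neJ: "J \<noteq> {}" using n2 by auto
      \<comment> \<open>Joining \<open>n - 1\<close> different jumps could take n^2 - 1 arcs, more
        than the allowed n^2 - n + 1 if n > 2. Since all shifts agree, the heaviest jump
        \<open>e\<close> may stand for all of them, and repeating one jump is cheaper.\<close>
      define e where "e = (ARG_MAX b e. e \<in> J)"
      have e: "e \<in> J" "\<And>j. j \<in> J \<Longrightarrow> b j \<le> b e"
      proof -
        have "Max (b ` J) \<in> b ` J" using finJ neJ by (intro Max_in) auto
        then obtain j where j: "j \<in> J" "b j = Max (b ` J)" by auto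
        then have "\<And>i. i \<in> J \<Longrightarrow> b i \<le> b j" using finJ by simp
        then have "is_arg_max b (\<lambda>e. e \<in> J) j" using j(1) by (auto simp: is_arg_max_linorder)
        then have "is_arg_max b (\<lambda>e. e \<in> J) e" unfolding e_def arg_max_def by (rule someI)
        then show "e \<in> J" "\<And>j. j \<in> J \<Longrightarrow> b j \<le> b e" by (auto simp: is_arg_max_linorder)
      qed
      have "prod b J \<le> (\<Prod>j\<in>J. b e)" using e b01 by (intro prod_mono) auto
      also have "\<dots> = b e ^ Suc (n - 2)" using cJ n2 Suc_diff_le[of 2 n] by simp
      also have "\<dots> = b e * b e ^ (n - 2)" by simp
      finally have pJ: "prod b J \<le> b e * b e ^ (n - 2)" .
      have "[sum s J = (\<Sum>j\<in>J. s e)] (mod int n)"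
        by (intro cong_sum subset_sum_zero_free(2)[OF finJ free n0 cJ] e)
      then have sJ: "[sum s J = int (n - 1) * s e] (mod int n)" using cJ by simp
      obtain L1 where L1: "L1 < n" "[int L1 = int (ix (f e)) - int (ix (F 0))] (mod int n)"
          "1 \<le> pw L1 (F 0) (f e)"
        using cyc[OF FX[of 0], of "f e"] f(3) by blast
      obtain L2 where L2: "L2 < n" "[int L2 = int (ix y) - int (ix (f (Suc e)))] (mod int n)"
          "1 \<le> pw L2 (f (Suc e)) y"
        using cyc[OF f(3)[of "Suc e"] y] by blast
      obtain M where M: "M < n" "[int M = int (ix (f e)) - int (ix (f (Suc e)))] (mod int n)"
          "1 \<le> pw M (f (Suc e)) (f e)"
        using cyc[OF f(3)[of "Suc e"] f(3)[of e]] by blast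
      have Ms: "[int M = - s e - 1] (mod int n)" using M(2) by (simp add: s_def)
      \<comment> \<open>If the way back along the cycle had \<open>n - 1\<close> arcs, the jump
        would be a step of the cycle. So each repetition of \<open>e\<close> saves one arc, and the
        total (n - 1 + 1) + (n - 1)(n - 2) + (n - 1) is exactly the allowed length.\<close>
      have "M \<noteq> n - 1"
      proof
        assume "M = n - 1"
        then have "[int n - 1 + 1 = - s e - 1 + 1] (mod int n)"
          using Ms n0 by (intro cong_add) (auto simp: of_nat_diff)
        then have "[0 = - s e] (mod int n)" by (simp add: cong_def)
        then have "[s e = 0] (mod int n)" by (metis cong_minus_minus_iff minus_zero cong_sym)
        then show False using free[of "{e}"] e by simp
      qed
      then have Mn: "M + 1 \<le> n - 1" using M by simp
      have "b e \<le> pw M (f (Suc e)) (f e) * pw 1 (f e) (f (Suc e))"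
        using M(3) b01(1)[of e] f(3) by (simp add: pw_1[unfolded One_nat_def] b_def mult_le_cancel_right1)
      also have "\<dots> \<le> pw (M + 1) (f (Suc e)) (f (Suc e))" using f(3) by (intro pw_mult_le)
      finally have "b e ^ (n - 2) \<le> pw (M + 1) (f (Suc e)) (f (Suc e)) ^ (n - 2)"
        using b01 by (intro power_mono)
      also have "\<dots> \<le> pw ((M + 1) * (n - 2)) (f (Suc e)) (f (Suc e))" by (rule pw_power_le[OF f(3)])
      finally have loops: "b e ^ (n - 2) \<le> pw ((M + 1) * (n - 2)) (f (Suc e)) (f (Suc e))" .
      let ?L = "(L1 + 1) + (M + 1) * (n - 2) + L2"
      have "b e \<le> pw L1 (F 0) (f e) * pw 1 (f e) (f (Suc e))"
        using L1(3) b01(1)[of e] f(3) by (simp add: pw_1[unfolded One_nat_def] b_def mult_le_cancel_right1)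
      also have "\<dots> \<le> pw (L1 + 1) (F 0) (f (Suc e))" using f(3) by (intro pw_mult_le)
      finally have first: "b e \<le> pw (L1 + 1) (F 0) (f (Suc e))" .
      have "b e * b e ^ (n - 2) = b e * b e ^ (n - 2) * 1" by simp
      also have "\<dots> \<le> pw (L1 + 1) (F 0) (f (Suc e))
          * pw ((M + 1) * (n - 2)) (f (Suc e)) (f (Suc e)) * pw L2 (f (Suc e)) y"
        using first loops L2 b01 by (intro mult_mono mult_nonneg_nonneg) auto
      also have "\<dots> \<le> pw ?L (F 0) y" using f(3) y by (intro pw_mult3_le)
      finally have w: "prod b J \<le> pw ?L (F 0) y" using pJ by simp
      have "(M + 1) * (n - 2) \<le> (n - 1) * (n - 2)" using Mn by (intro mult_right_mono) auto
      then have "?L \<le> (n - 1 + 1) + (n - 1) * (n - 2) + (n - 1)" using L1 L2 by linarith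
      also have "\<dots> = ?T + n - 1"
      proof -
        obtain m where m: "n = m + 2" using n2 by (metis le_iff_add add.commute)
        show ?thesis unfolding m by (simp add: power2_eq_square)
      qed
      finally have len: "?L \<le> ?T + n - 1" .
      have "[(int L1 + 1) + (int M + 1) * int (n - 2) + int L2
          = (int (ix (f e)) - int (ix (F 0)) + 1) + (- s e - 1 + 1) * int (n - 2)
            + (int (ix y) - int (ix (f (Suc e))))] (mod int n)"
        using L1 L2 Ms by (intro cong_add cong_mult) auto
      also have "(int (ix (f e)) - int (ix (F 0)) + 1) + (- s e - 1 + 1) * int (n - 2)
            + (int (ix y) - int (ix (f (Suc e)))) = int (ix y) - int (ix (F 0)) - int (n - 1) * s e"
        using n2 by (simp add: s_def of_nat_diff algebra_simps)
      finally have "[int ?L = int (ix y) - int (ix (F 0)) - int (n - 1) * s e] (mod int n)"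
        by (simp only: of_nat_add of_nat_mult of_nat_1)
      moreover have "[int (ix y) - int (ix (F 0)) - int (n - 1) * s e
          = int (ix y) - int (ix (F 0)) - sum s J] (mod int n)"
        using sJ by (intro cong_diff) (auto simp: cong_sym_eq)
      ultimately show ?thesis using len w cong_trans by blast
    qed
    then obtain L where L: "L \<le> ?T + n - 1" "prod b J \<le> pw L (F 0) y"
      "[int L = int (ix y) - int (ix (F 0)) - sum s J] (mod int n)" by blast
    have "[int (ix y) - int (ix (F 0)) - sum s J
        = int (ix y) - int (ix (F 0)) - sum s {..<?N}] (mod int n)"
      using Jc by (intro cong_diff) auto
    then have "[int L = int ?N] (mod int n)" using L(3) cong_trans tele by fastforce
    then have "[L = ?N] (mod n)" by (simp only: cong_int_iff)
    then have "[L = ?T] (mod n)" by (simp only: cong_def mod_add_self2)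
    moreover have "L < ?T + n" using L(1) n0 by linarith
    ultimately have "L \<le> ?T \<and> n dvd ?T - L"
    proof -
      assume c: "[L = ?T] (mod n)" and l: "L < ?T + n"
      show ?thesis
      proof (cases "L \<le> ?T")
        case True
        then show ?thesis using cong_altdef_nat[OF True, of n] cong_sym[OF c] by blast
      next
        case False
        then have "n dvd L - ?T" using c cong_altdef_nat[of ?T L n] by simp
        then have "n \<le> L - ?T" using False by (intro dvd_imp_le) auto
        then show ?thesis using l False by linarith
      qed
    qed
    then obtain q where q: "?T = n * q + L" by (metis dvdE le_add_diff_inverse2)
    have "F (0 + n * q) = F 0" using Fmod[of "n * q"] by (metis Fmod add_0 mod_mult_self1_is_0)
    then have "1 \<le> pw (n * q) (F 0) (F 0)" using Fstep[of "n * q" 0] by simp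
    then have "pw L (F 0) y \<le> pw (n * q) (F 0) (F 0) * pw L (F 0) y"
      using mult_right_mono[of 1 "pw (n * q) (F 0) (F 0)" "pw L (F 0) y"] by simp
    also have "\<dots> \<le> pw ?T (F 0) y" unfolding q using FX y by (intro pw_mult_le)
    finally show ?thesis using L(2) wJ by linarith
  qed
qed

end

context crit_walks
begin

text \<open>The weight of critical walks from \<open>x\<close> is a potential. The diagonal
  similarity it defines gives the arcs of the cycle weight 1 and all others weight at most 1, which
  is the normalised situation.\<close>

lemma row_per_hamiltonian:
  assumes "x \<in> X" "2 \<le> card X" and F: "F 0 = x" "F ` {..<card X} = X" "\<And>i. F (i + card X) = F i"
    and c: "\<And>i j. crit j (F i) (F (i + j))"
  shows "row_per X a x ((card X - 1)\<^sup>2 + 1)"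
proof -
  let ?n = "card X" and ?T = "(card X - 1)\<^sup>2 + 1"
  have Fmod: "F (i mod ?n) = F i" for i
  proof -
    have "F (j + ?n * m) = F j" for j m
      by (induction m) (use F(3)[of "j + ?n * _"] in \<open>auto simp: algebra_simps\<close>)
    then show ?thesis by (metis mod_mult_div_eq)
  qed
  have FX: "F i \<in> X" for i
    using F(2) Fmod[of i] assms(2)
    by (metis imageI lessThan_iff mod_less_divisor not_numeral_le_zero not_gr_zero)
  have ex: "\<exists>j. crit j x z" if "z \<in> X" for z
    using F that c[of _ 0] by (metis add_0 imageE)
  define \<phi> where "\<phi> z = pw (SOME j. crit j x z) x z" for z
  have phi: "pw j x z = \<phi> z" if "crit j x z" "z \<in> X" for j z
  proof -
    have c': "crit (SOME j. crit j x z) x z" using ex[OF that(2)] by (rule someI_ex)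
    have "\<exists>s. crit s z x" using crit_sym[OF that(1)] .
    then obtain s where s: "crit s z x" by blast
    have "pw j x z * pw s z x = \<phi> z * pw s z x"
      using crit_inverse[OF that(1) s] crit_inverse[OF c' s] that(2) assms(1) by (simp add: \<phi>_def)
    then show ?thesis using crit_pos[OF s] by simp
  qed
  have phi0: "0 < \<phi> z" if "z \<in> X" for z
    using ex[OF that] phi crit_pos that by metis
  define b where "b u z = 1 * \<phi> u * a u z / \<phi> z" for u z
  interpret sc: max_walks X b
    by unfold_locales (use fin nonneg phi0 in \<open>auto simp: b_def intro!: divide_nonneg_pos mult_nonneg_nonneg less_imp_le[OF phi0]\<close>)
  have sc: "sc.pw t u z = \<phi> u * pw t u z / \<phi> z" if "u \<in> X" "z \<in> X" for t u z
    using mpow_scale[OF fin, of 1 \<phi> u z a t] phi0 that by (simp add: b_def[abs_def])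
  \<comment> \<open>A heavier arc, put between a critical walk from \<open>x\<close> to
    \<open>u\<close> and a return from \<open>z\<close> to \<open>x\<close>, would give a closed
    walk of weight above 1.\<close>
  have le1: "b u z \<le> 1" if uz: "u \<in> X" "z \<in> X" for u z
  proof -
    obtain j where j: "crit j x u" using ex uz by blast
    obtain i where i: "crit i x z" using ex uz by blast
    obtain s where s: "crit s z x" using crit_sym[OF i] by blast
    have "\<phi> u * a u z = pw j x u * pw 1 u z" using phi j uz pw_1 by simp
    also have "\<dots> \<le> pw (j + 1) x z" using uz by (intro pw_mult_le)
    finally have "\<phi> u * a u z * pw s z x \<le> pw (j + 1) x z * pw s z x"
      by (intro mult_right_mono) auto
    also have "\<dots> \<le> \<phi> z * pw s z x"
      using round_trip_le[OF assms(1) uz(2), of "j + 1" s] crit_inverse[OF i s assms(1) uz(2)]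
        phi[OF i uz(2)] by simp
    finally have "\<phi> u * a u z \<le> \<phi> z" using crit_pos[OF s] by simp
    then show ?thesis using phi0 uz by (simp add: b_def)
  qed
  have step1: "b (F i) (F (Suc i)) = 1" for i
  proof -
    have "\<phi> (F (Suc i)) = pw (i + 1) x (F (Suc i))"
      using phi[OF _ FX, of "Suc i" "Suc i"] c[of "Suc i" 0] F(1) by simp
    also have "\<dots> = pw i x (F i) * pw 1 (F i) (F (Suc i))"
      using crit_mult[of i x "F i" 1 "F (Suc i)"] c[of i 0] c[of 1 i] FX F(1) assms(1) by simp
    also have "\<dots> = \<phi> (F i) * a (F i) (F (Suc i))"
      using phi[OF _ FX, of i i] c[of i 0] F(1) pw_1[OF FX FX] by simp
    finally have eq: "\<phi> (F i) * a (F i) (F (Suc i)) = \<phi> (F (Suc i))" by simp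
    show ?thesis using phi0[OF FX, of "Suc i"] by (simp add: b_def eq)
  qed
  show ?thesis
  proof (rule row_perI)
    show "0 < ?n" using assms by linarith
    show "x \<in> X" by fact
    fix y assume y: "y \<in> X"
    show "pw (?T + ?n) x y = pw ?T x y"
    proof (rule antisym)
      have "sc.pw (?T + ?n) (F 0) y \<le> sc.pw ?T (F 0) y"
        using assms(2) F le1 step1 y by (intro sc.hamiltonian_normalised)
      then show "pw (?T + ?n) x y \<le> pw ?T x y"
        using sc[OF assms(1) y] phi0[OF y] phi0[OF assms(1)] F(1)
        by (simp add: divide_le_cancel)
      have "crit ?n x x" using c[of ?n 0] F(1) F(3)[of 0] by simp
      then have "pw ?n x x = 1" using crit_closed assms(1) by blast
      then show "pw ?T x y \<le> pw (?T + ?n) x y"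
        using pw_mult_le[of x y ?n x ?T] assms(1) y by (simp add: add.commute)
    qed
  qed
qed

end

subsection \<open>Wielandt's bound for critical rows\<close>

lemma Wi_mono: "m \<le> m' \<Longrightarrow> Wi m \<le> Wi m'"
  by (auto simp: Wi_def power_mono)

text \<open>Strictness fails between 0 and 1, where both values are 0, hence the lower bound on
  \<open>m\<close>.\<close>

lemma Wi_less: "1 \<le> m \<Longrightarrow> m < m' \<Longrightarrow> Wi m < Wi m'"
  by (auto simp: Wi_def intro!: power_strict_mono)

context crit_walks
begin

text \<open>Let \<open>l\<close> be the least length of a critical cycle in the component of
  \<open>x\<close>. If \<open>l = card X\<close>, the cycle is Hamiltonian or a loop. Otherwise a
  critical path of at most \<open>card X - l\<close> arcs leads from \<open>x\<close> to the cycle,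
  whose nodes have transient at most \<open>l * (card X - 1)\<close>.\<close>

lemma row_per_Wi:
  assumes x: "x \<in> X" and t: "crit t x x" "0 < t"
  shows "row_per X a x (Wi (card X))"
proof -
  let ?n = "card X"
  define l where "l = (LEAST l. 0 < l \<and> (\<exists>y\<in>component x. crit l y y))"
  have "0 < l \<and> (\<exists>y\<in>component x. crit l y y)"
    unfolding l_def by (rule LeastI[of _ t]) (use assms self_in_comp in auto)
  then obtain z where l0: "0 < l" and z: "z \<in> component x" "crit l z z" by blast
  have least: "l \<le> m" if "0 < m" "y \<in> component x" "crit m y y" for m y
    unfolding l_def by (rule Least_le) (use that in auto)
  have zX: "z \<in> X" using z comp_subset by auto
  obtain F where F: "F 0 = z" "\<And>i. F i \<in> X" "\<And>i. F (i + l) = F i"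
    "\<And>i j. crit j (F i) (F (i + j))"
    using crit_cycle_walk[OF z(2) zX l0] by blast
  have Fc: "F i \<in> component x" for i
    using crit_comp[OF z(1) x] crit_in_comp[of i z "F i"] F(1,2) F(4)[of i 0] by simp
  have inj: "inj_on F {..<l}"
    using minimal_cycle_inj[of F l 0, OF F(2) F(4) least[OF _ Fc]] by (simp add: atLeast0LessThan)
  define Y where "Y = F ` {..<l}"
  have cY: "card Y = l" using inj by (simp add: Y_def card_image)
  have YX: "Y \<subseteq> component x" using Fc by (auto simp: Y_def)
  have ln: "l \<le> ?n" using cY card_mono[OF fin subset_trans[OF YX comp_subset]] by simp
  have loops: "crit l y y" if "y \<in> Y" for y
  proof -
    from that obtain i where "y = F i" unfolding Y_def by blast
    then show ?thesis using F(4)[of l i] by (simp only: F(3))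
  qed
  show ?thesis
  proof (cases "l = ?n")
    case True
    then have "Y = X" using cY YX comp_subset fin card_subset_eq by (metis subset_trans)
    then have lx: "crit l x x" using loops x by simp
    show ?thesis
    proof (cases "l = 1")
      case True
      then show ?thesis using row_per_loop[OF x] lx \<open>l = ?n\<close> by (simp add: Wi_def)
    next
      case False
      then have n2: "2 \<le> ?n" using l0 True by simp
      \<comment> \<open>The Hamiltonian bound concerns the row of the node where the cycle starts.
        \<open>F\<close> starts at \<open>z\<close>, so a critical cycle is unrolled afresh from
        \<open>x\<close>.\<close>
      obtain F' where F': "F' 0 = x" "\<And>i. F' i \<in> X" "\<And>i. F' (i + l) = F' i"
        "\<And>i j. crit j (F' i) (F' (i + j))"
        using crit_cycle_walk[OF lx x l0] by blast
      have F'c: "F' i \<in> component x" for i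
        using crit_in_comp[of i x "F' i"] F'(1,2) F'(4)[of i 0] by simp
      have "inj_on F' {..<l}"
        using minimal_cycle_inj[of F' l 0, OF F'(2) F'(4) least[OF _ F'c]]
        by (simp add: atLeast0LessThan)
      then have "card (F' ` {..<l}) = ?n" using True by (simp add: card_image)
      moreover have "F' ` {..<l} \<subseteq> X" using F'(2) by auto
      ultimately have "F' ` {..<?n} = X" using fin card_subset_eq True by metis
      moreover have "F' (i + ?n) = F' i" for i using F'(3) by (simp only: True)
      ultimately have "row_per X a x ((?n - 1)\<^sup>2 + 1)"
        by (intro row_per_hamiltonian[where F = F'] x n2 F'(1,4))
      then show ?thesis using n2 by (simp add: Wi_def)
    qed
  next
    case False
    then have n2: "2 \<le> ?n" using ln l0 by simp
    obtain j where "crit j x z" using z by (auto simp: component_def)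
    then have j: "crit (1 * j) x z" by simp
    have "F 0 \<in> Y" using l0 by (auto simp: Y_def)
    then have zY: "z \<in> Y" using F(1) by simp
    obtain m h where h: "h 0 = x" "h m \<in> Y" "\<And>i. h i \<in> X" "\<And>i. i < m \<Longrightarrow> h i \<notin> Y"
        "\<And>i j. i \<le> j \<Longrightarrow> j \<le> m \<Longrightarrow> crit (1 * (j - i)) (h i) (h j)" "inj_on h {..<m}"
      using shortest_crit_walk[OF j zY x subset_trans[OF YX comp_subset]] by blast
    have "h ` {..<m} \<subseteq> component x - Y"
    proof
      fix y assume "y \<in> h ` {..<m}"
      then obtain i where i: "i < m" "y = h i" by auto
      then show "y \<in> component x - Y"
        using h(4)[of i] h(5)[of 0 i] h(1,3) crit_in_comp[of i x "h i"] by auto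
    qed
    then have "card (h ` {..<m}) \<le> card (component x - Y)"
      using finite_comp by (intro card_mono) auto
    then have "m \<le> card (component x) - l"
      using card_image[OF h(6)] card_Diff_subset[of Y "component x"] YX cY finite_subset[OF YX finite_comp]
      by simp
    then have m: "m \<le> ?n - l" using card_mono[OF fin comp_subset[of x]] by simp
    have "row_per X a (h m) (l * (?n - 1))"
      using row_per_restrict_loop[of X l "h m"] loops h(2,3) l0 by simp
    then have rp: "row_per X a x (l * (?n - 1) + m)"
      using row_per_propagate[of m x "h m"] h(1,3) h(5)[of 0 m] x by simp
    \<comment> \<open>With \<open>n' = ?n - 2\<close> the bound l * n' + ?n grows with
      \<open>l\<close>. At the largest remaining value l = ?n - 1 it is Wielandt's number.\<close>
    obtain n' where n': "?n = n' + 2" using n2 by (metis le_iff_add add.commute)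
    have "l * (?n - 1) + m \<le> l * (n' + 1) + (n' + 2 - l)" using m n' by simp
    also have "\<dots> = l * n' + (n' + 2)" using ln n' by simp
    also have "\<dots> \<le> (n' + 1) * n' + (n' + 2)" using False ln n' by (intro add_mono mult_right_mono) auto
    also have "\<dots> = Wi ?n" using n' by (simp add: Wi_def power2_eq_square)
    finally show ?thesis by (rule row_per_mono[OF rp])
  qed
qed

end

subsection \<open>Cyclic classes\<close>

text \<open>Otherwise all \<open>d\<close> classes have at least \<open>r div d\<close> nodes and
  the first \<open>r mod d + 1\<close> of them have one more, which exceeds \<open>r\<close> in
  total.\<close>

lemma small_class:
  fixes sz :: "nat \<Rightarrow> nat"
  assumes "0 < d" "(\<Sum>i<d. sz i) = r"
  shows "(\<exists>i<d. sz i < r div d) \<or> (\<exists>i\<le>r mod d. sz i \<le> r div d)"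
proof (rule ccontr)
  assume neg: "\<not> ?thesis"
  have "r div d + of_bool (i \<le> r mod d) \<le> sz i" if "i < d" for i
  proof (cases "i \<le> r mod d")
    case True
    then have "\<not> sz i \<le> r div d" using neg by blast
    then show ?thesis using True by simp
  next
    case False
    have "\<not> sz i < r div d" using neg that by blast
    then show ?thesis using False by simp
  qed
  then have "(\<Sum>i<d. r div d + of_bool (i \<le> r mod d)) \<le> (\<Sum>i<d. sz i)"
    by (intro sum_mono) auto
  moreover have "(\<Sum>i<d. of_bool (i \<le> r mod d)) = Suc (r mod d)"
  proof -
    have "{i. i < d \<and> i \<le> r mod d} = {..r mod d}"
      using mod_less_divisor[OF assms(1), of r] by auto
    then show ?thesis by (simp add: sum.If_cases Int_def of_bool_def)
  qed
  ultimately have "d * (r div d) + Suc (r mod d) \<le> r"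
    using assms by (simp add: sum.distrib)
  then show False by (metis mult_div_mod_eq not_less_eq_eq order_refl add_Suc_right)
qed

lemma cong_double: "[2 * i = 2 * j] (mod 2 * m) \<longleftrightarrow> [i = j] (mod m)" for i j m :: int
proof -
  have "2 * i - 2 * j = 2 * (i - j)" by simp
  then have "[2 * i = 2 * j] (mod 2 * m) \<longleftrightarrow> 2 * m dvd 2 * (i - j)"
    by (simp only: cong_iff_dvd_diff)
  also have "\<dots> \<longleftrightarrow> m dvd i - j" unfolding dvd_mult_cancel_left by simp
  finally show ?thesis by (simp only: cong_iff_dvd_diff)
qed

text \<open>\<open>N\<close> is the number of double steps before cycles are cut out. The budget
  \<open>B\<close> also contains the \<open>g\<close> nodes of the cycle reached, and this surplus
  turns \<open>q - 1\<close> into \<open>q - 2\<close>. The right side is an integer because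
  \<open>q\<close> may be 1.\<close>

lemma transient_arith:
  assumes "1 \<le> s" "s \<le> q" "N + g \<le> B"
  shows "int (g * (s - 1) + N) \<le> (int q - 2) * int g + int B"
proof -
  have "int (g * (s - 1)) \<le> int g * (int q - 1)"
    using assms by (simp add: of_nat_diff mult_left_mono)
  then show ?thesis using assms(3) by (simp add: algebra_simps)
qed

text \<open>For an irreducible matrix, \<open>cls\<close> is the cyclic class of a node in the bipartite digraph of
  \<open>block_mat\<close>, whose cyclicity is \<open>2 * d\<close>. In general \<open>d = 1\<close> is always possible: the two classes
  are the two sides of the bipartition.\<close>

locale cyc_walks = crit_walks +
  fixes cls :: "'a \<Rightarrow> int" and d :: nat
  assumes d0: "0 < d"
    and cls_arc: "x \<in> X \<Longrightarrow> y \<in> X \<Longrightarrow> 0 < a x y \<Longrightarrow> [cls y = cls x + 1] (mod 2 * int d)"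
begin

definition cl :: "int \<Rightarrow> 'a set" where
  "cl c = {y \<in> X. [cls y = c] (mod 2 * int d)}"

text \<open>In the block matrix, where \<open>cls\<close> is even exactly on the first
  \<open>n\<close> nodes, these are the factor nodes.\<close>

definition odds :: "'a set" where
  "odds = {y \<in> X. odd (cls y)}"

lemma cl_cong: "[c = c'] (mod 2 * int d) \<Longrightarrow> cl c = cl c'"
  unfolding cl_def using cong_trans[of _ c "2 * int d" c'] cong_trans[of _ c' "2 * int d" c] cong_sym[of c c'] by blast

lemma even_cong: "[b = c] (mod 2 * int d) \<Longrightarrow> even b \<longleftrightarrow> even c"
proof -
  assume "[b = c] (mod 2 * int d)"
  then have "2 * int d dvd b - c" by (simp only: cong_iff_dvd_diff)
  then have "even (b - c)" using dvd_mult_left by blast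
  then show ?thesis by simp
qed

lemma finite_cl: "finite (cl c)" using fin by (simp add: cl_def)

lemma cl_subset: "cl c \<subseteq> X" by (auto simp: cl_def)

lemma cls_pw:
  assumes "0 < pw t x y" "x \<in> X" "y \<in> X"
  shows "[cls y = cls x + int t] (mod 2 * int d)"
  using assms(1,3)
proof (induction t arbitrary: y)
  case 0
  then show ?case by (cases "x = y") auto
next
  case (Suc t)
  obtain l where l: "l \<in> X" "pw (Suc t) x y = pw t x l * a l y" using pw_SucE[OF Suc.prems(1)] .
  then have "0 < pw t x l" "0 < a l y"
    using Suc.prems nonneg[OF l(1) Suc.prems(2)] pw_nonneg[of t x l]
    by (auto simp: zero_less_mult_iff simp del: pw_nonneg)
  then have "[cls l = cls x + int t] (mod 2 * int d)" "[cls y = cls l + 1] (mod 2 * int d)"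
    using Suc l cls_arc by auto
  then have "[cls y = cls x + int t + 1] (mod 2 * int d)"
    by (meson cong_add_rcancel cong_trans)
  then show ?case by (simp add: algebra_simps)
qed

lemma cls_crit:
  assumes "crit t x y" "x \<in> X" "y \<in> X"
  shows "[cls y = cls x + int t] (mod 2 * int d)"
  using cls_pw[OF crit_pos[OF assms(1)] assms(2,3)] .

lemma cl_closed:
  assumes "2 * d dvd q" "x \<in> cl c" "y \<in> X" "0 < pw q x y"
  shows "y \<in> cl c"
proof -
  have xc: "[cls x = c] (mod 2 * int d)" "x \<in> X" using assms by (auto simp: cl_def)
  have "2 * int d dvd int q" using assms(1) by (metis int_dvd_int_iff of_nat_mult of_nat_numeral)
  then have "[int q = 0] (mod 2 * int d)" by (simp add: cong_0_iff)
  then have "[cls x + int q = c + 0] (mod 2 * int d)" using xc by (intro cong_add)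
  then have "[cls y = c] (mod 2 * int d)"
    using cong_trans[OF cls_pw[OF assms(4) xc(2) assms(3)]] by simp
  then show ?thesis using assms(3) by (simp add: cl_def)
qed

text \<open>The modulus is even, so each class has one parity, and the \<open>d\<close> classes
  listed are all the odd ones.\<close>

lemma sum_cl:
  assumes "odd c"
  shows "(\<Sum>i<d. card (cl (c + 2 * int i))) = card odds"
proof -
  have "(\<Sum>i<d. card (cl (c + 2 * int i))) = card (\<Union>i\<in>{..<d}. cl (c + 2 * int i))"
  proof (rule card_UN_disjoint[symmetric])
    show "\<forall>i\<in>{..<d}. \<forall>j\<in>{..<d}. i \<noteq> j \<longrightarrow> cl (c + 2 * int i) \<inter> cl (c + 2 * int j) = {}"
    proof (intro ballI impI, rule ccontr)
      fix i j assume ij: "i \<in> {..<d}" "j \<in> {..<d}" "i \<noteq> j"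
        "cl (c + 2 * int i) \<inter> cl (c + 2 * int j) \<noteq> {}"
      then obtain y where "[cls y = c + 2 * int i] (mod 2 * int d)"
          "[cls y = c + 2 * int j] (mod 2 * int d)"
        unfolding cl_def by blast
      then have "[c + 2 * int i = c + 2 * int j] (mod 2 * int d)"
        using cong_trans[OF cong_sym] by blast
      then have "[2 * int i = 2 * int j] (mod 2 * int d)" by (simp add: cong_add_lcancel)
      then have "[int i = int j] (mod int d)" by (simp only: cong_double)
      then have "[i = j] (mod d)" by (simp add: cong_int_iff)
      then show False using ij by (simp add: cong_def)
    qed
  qed (auto simp: finite_cl)
  also have "(\<Union>i\<in>{..<d}. cl (c + 2 * int i)) = odds"
  proof (intro equalityI subsetI)
    fix y assume "y \<in> (\<Union>i\<in>{..<d}. cl (c + 2 * int i))"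
    then obtain i where i: "y \<in> cl (c + 2 * int i)" by blast
    then have "even (cls y) = even (c + 2 * int i)" by (intro even_cong) (simp add: cl_def)
    then show "y \<in> odds" using assms i by (simp add: cl_def odds_def)
  next
    fix y assume y: "y \<in> odds"
    define m where "m = (cls y - c) div 2"
    have m: "cls y = c + 2 * m" using y assms by (auto simp: odds_def m_def)
    let ?i = "nat (m mod int d)"
    have i: "int ?i = m mod int d" using d0 by simp
    have "[m = int ?i] (mod int d)" unfolding i by (simp add: cong_def)
    then have "[2 * m = 2 * int ?i] (mod 2 * int d)" by (simp only: cong_double)
    then have "[cls y = c + 2 * int ?i] (mod 2 * int d)" unfolding m by (simp only: cong_add_lcancel)
    moreover have "?i < d" using i d0 pos_mod_bound[of "int d" m] by linarith
    ultimately have "y \<in> cl (c + 2 * int ?i)" "?i \<in> {..<d}"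
      using y unfolding cl_def odds_def by blast+
    then show "y \<in> (\<Union>i\<in>{..<d}. cl (c + 2 * int i))" by blast
  qed
  finally show ?thesis .
qed

text \<open>A critical closed walk through \<open>k\<close> visits the odd classes cyclically, class
  \<open>i\<close> after \<open>2 * i + 1\<close> steps. Wielandt's bound inside the class, in steps
  of \<open>2 * d\<close>, is carried back to \<open>k\<close>, and \<open>i\<close> is chosen by
  class size.\<close>

lemma row_per_schwarz:
  assumes k: "k \<in> X" "even (cls k)" and t: "crit t k k" "0 < t"
  shows "row_per X a k (2 * (d * Wi (card odds div d) + card odds mod d) + 1)"
proof -
  let ?q = "card odds div d" and ?\<rho> = "card odds mod d"
  obtain F where F: "F 0 = k" "\<And>i. F i \<in> X" "\<And>i. F (i + t) = F i"
    "\<And>i j. crit j (F i) (F (i + j))"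
    using crit_cycle_walk[OF t(1) k(1) t(2)] by blast
  define sz where "sz i = card (cl (cls k + 1 + 2 * int i))" for i
  have main: "1 \<le> sz i \<and> row_per X a k (2 * d * Wi (sz i) + (2 * i + 1))" for i
  proof -
    let ?z = "F (2 * i + 1)" and ?S = "cl (cls k + 1 + 2 * int i)"
    have "[cls ?z = cls k + int (2 * i + 1)] (mod 2 * int d)"
      using cls_crit[OF F(4)[of "2 * i + 1" 0]] F(1,2) k by simp
    then have zS: "?z \<in> ?S" using F(2) by (simp add: cl_def algebra_simps)
    have closed: "y \<in> ?S" if "x \<in> ?S" "y \<in> X" "0 < pw (2 * d) x y" for x y
      using cl_closed[OF dvd_refl that] .
    interpret sub: crit_walks ?S "pw (2 * d)" by (rule crit_walks_restrict[OF cl_subset closed])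
    have "crit t ?z ?z" using F(4)[of t "2 * i + 1"] by (simp only: F(3))
    \<comment> \<open>One step inside the class consists of \<open>2 * d\<close> arcs;
      \<open>2 * d\<close> rounds of the closed walk make it a closed walk of \<open>t\<close> such
      steps.\<close>
    then have "crit (t * (2 * d)) ?z ?z" using crit_power F(2) by blast
    then have "pw (2 * d * t) ?z ?z = 1" using crit_closed F(2) by (simp add: mult.commute)
    moreover have "sub.pw t ?z ?z = pw (2 * d * t) ?z ?z"
      using zS by (intro mpow_restrict[OF cl_subset closed])
    ultimately have "sub.crit t ?z ?z" using sub.crit_closed zS by simp
    then have "row_per ?S (pw (2 * d)) ?z (Wi (sz i))"
      using sub.row_per_Wi zS t(2) by (simp add: sz_def)
    then have "row_per X a ?z (2 * d * Wi (sz i))"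
      using zS d0 by (intro row_per_restrict[OF cl_subset closed]) auto
    then have "row_per X a k (2 * d * Wi (sz i) + (2 * i + 1))"
      using row_per_propagate[of "2 * i + 1" k ?z] F(4)[of "2 * i + 1" 0] F(1,2) k by simp
    moreover have "1 \<le> sz i" using zS finite_cl by (auto simp: sz_def Suc_le_eq card_gt_0_iff)
    ultimately show ?thesis by simp
  qed
  have "(\<Sum>i<d. sz i) = card odds" unfolding sz_def by (rule sum_cl) (use k in simp)
  from small_class[OF d0 this] show ?thesis
  proof (elim disjE exE conjE)
    fix i assume i: "i < d" "sz i < ?q"
    \<comment> \<open>A smaller class lowers Wielandt's number by at least 1, which multiplied by
      \<open>d\<close> outweighs the \<open>i < d\<close> double steps needed to reach it.\<close>
    have "Wi (sz i) + 1 \<le> Wi ?q" using Wi_less[of "sz i" ?q] main[of i] i by simp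
    then have "d * (Wi (sz i) + 1) \<le> d * Wi ?q" by (rule mult_left_mono) simp
    then have "2 * d * Wi (sz i) + (2 * i + 1) \<le> 2 * (d * Wi ?q + ?\<rho>) + 1"
      using i by (simp only: distrib_left mult.assoc)
    with conjunct2[OF main] show ?thesis by (rule row_per_mono)
  next
    fix i assume i: "i \<le> ?\<rho>" "sz i \<le> ?q"
    have "d * Wi (sz i) \<le> d * Wi ?q" using Wi_mono[OF i(2)] by (rule mult_left_mono) simp
    then have "2 * d * Wi (sz i) + (2 * i + 1) \<le> 2 * (d * Wi ?q + ?\<rho>) + 1"
      using i by (simp only: distrib_left mult.assoc)
    with conjunct2[OF main] show ?thesis by (rule row_per_mono)
  qed
qed

end

section \<open>Paths to a shortest critical cycle and the girth bound\<close>

context cyc_walks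
begin

definition same_parity :: "'a \<Rightarrow> 'a set" where
  "same_parity x = {y \<in> component x. even (cls y) \<longleftrightarrow> even (cls x)}"

lemma crit_dvd:
  assumes "crit t x x" "x \<in> X"
  shows "2 * d dvd t"
proof -
  have "[cls x + 0 = cls x + int t] (mod 2 * int d)" using cls_crit[OF assms assms(2)] by simp
  then have "[0 = int t] (mod 2 * int d)" by (simp only: cong_add_lcancel)
  then have "2 * int d dvd int t" by (metis cong_0_iff cong_sym)
  then show ?thesis by (metis int_dvd_int_iff of_nat_mult of_nat_numeral)
qed

lemma cls_crit_even: "crit (2 * j) x y \<Longrightarrow> x \<in> X \<Longrightarrow> y \<in> X \<Longrightarrow> even (cls y) \<longleftrightarrow> even (cls x)"
  using even_cong[OF cls_crit[of "2 * j" x y]] by simp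

text \<open>\<open>P\<close> takes double steps, so it stays on the side of \<open>x\<close>: it
  first follows a shortest critical path to \<open>D\<close>, the nodes of a shortest critical cycle
  on that side, and from position \<open>l\<close> on runs round that cycle. The last property gives
  the neighbours on the other side, for paths on the side opposite to the factor nodes.\<close>

lemma crit_path_to_girth_cycle:
  assumes x: "x \<in> X" and z: "z \<in> component x" "crit (2 * g) z z" and g: "0 < g"
    and least: "\<forall>y\<in>component x. \<forall>m>0. crit m y y \<longrightarrow> 2 * g \<le> m"
  obtains P l D where "P 0 = x" "\<And>i. P i \<in> same_parity x"
    "\<And>i j. crit (2 * j) (P i) (P (i + j))"
    "inj_on P {..<l}" "\<And>i. i < l \<Longrightarrow> P i \<notin> D" "\<And>i. l \<le> i \<Longrightarrow> P i \<in> D"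
    "\<And>i. l \<le> i \<Longrightarrow> inj_on P {i..<i + g}" "D \<subseteq> same_parity x" "card D = g"
    "\<And>i. l \<le> i \<Longrightarrow> crit (2 * g) (P i) (P i)"
    "\<And>i. l \<le> i \<Longrightarrow> \<exists>w\<in>X. crit 1 (P i) w \<and> crit (2 * g) w w"
proof -
  have zX: "z \<in> X" using z comp_subset by auto
  obtain F where F: "F 0 = z" "\<And>i. F i \<in> X" "\<And>i. F (i + 2 * g) = F i"
    "\<And>i j. crit j (F i) (F (i + j))"
    using crit_cycle_walk[OF z(2) zX] g by auto
  have Fc: "F i \<in> component x" for i
    using crit_comp[OF z(1) x] crit_in_comp[of i z "F i"] F(1,2) F(4)[of i 0] by simp
  have inj: "inj_on F {i..<i + 2 * g}" for i
    by (rule minimal_cycle_inj[OF F(2) F(4)]) (use least Fc in blast)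
  have Floop: "crit (2 * g) (F i) (F i)" for i using F(4)[of "2 * g" i] by (simp only: F(3))
  have parF: "even (cls (F i)) \<longleftrightarrow> even (cls z + int i)" for i
    using even_cong[OF cls_crit[OF F(4)[of i 0] F(2,2)]] F(1) by simp
  \<comment> \<open>An offset of 0 or 1 along the cycle selects its nodes on the side of
    \<open>x\<close>.\<close>
  define o' :: nat where "o' = (if even (cls z) = even (cls x) then 0 else 1)"
  define E where "E i = F (o' + 2 * i)" for i
  have Ec: "E i \<in> same_parity x" for i
    using Fc parF[of "o' + 2 * i"] by (auto simp: same_parity_def E_def o'_def)
  have Eg: "E (i + g) = E i" for i
    using F(3)[of "o' + 2 * i"] by (simp add: E_def algebra_simps)
  have Estep: "crit (2 * j) (E i) (E (i + j))" for i j
    using F(4)[of "2 * j" "o' + 2 * i"] by (simp add: E_def algebra_simps)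
  have Einj: "inj_on E {i..<i + g}" for i
  proof (rule inj_onI)
    fix u v assume uv: "u \<in> {i..<i + g}" "v \<in> {i..<i + g}" "E u = E v"
    have "o' + 2 * u = o' + 2 * v"
      using inj_onD[OF inj[of "o' + 2 * i"], of "o' + 2 * u" "o' + 2 * v"] uv by (auto simp: E_def)
    then show "u = v" by simp
  qed
  define D where "D = E ` {..<g}"
  have cD: "card D = g" using Einj[of 0] by (simp add: D_def card_image atLeast0LessThan)
  have Emod: "E (i mod g) = E i" for i
  proof -
    have "E (j + g * m) = E j" for j m
    proof (induction m)
      case (Suc m)
      then show ?case using Eg[of "j + g * m"] by (simp add: algebra_simps)
    qed simp
    then show ?thesis by (metis mod_mult_div_eq)
  qed
  have ED: "E i \<in> D" for i
    using g Emod[of i] mod_less_divisor[of g i] unfolding D_def by (metis imageI lessThan_iff)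
  have DC: "D \<subseteq> same_parity x" using Ec by (auto simp: D_def)
  have DX: "D \<subseteq> X" using DC comp_subset by (auto simp: same_parity_def)
  have E0X: "E i \<in> X" for i using ED DX by blast
  obtain j where j: "crit j x (E 0)" using Ec[of 0] by (auto simp: same_parity_def component_def)
  have "even (cls (E 0)) \<longleftrightarrow> even (cls x + int j)" by (rule even_cong[OF cls_crit[OF j x E0X]])
  then have "even j" using Ec[of 0] by (auto simp: same_parity_def)
  then obtain j' where "j = 2 * j'" by blast
  with j have j': "crit (2 * j') x (E 0)" by simp
  obtain l h where h: "h 0 = x" "h l \<in> D" "\<And>i. h i \<in> X" "\<And>i. i < l \<Longrightarrow> h i \<notin> D"
    "\<And>i j. i \<le> j \<Longrightarrow> j \<le> l \<Longrightarrow> crit (2 * (j - i)) (h i) (h j)" "inj_on h {..<l}"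
    using shortest_crit_walk[OF j' ED x DX] by blast
  obtain i0 where i0: "h l = E i0" using h(2) by (auto simp: D_def)
  define P where "P i = (if i < l then h i else E (i0 + (i - l)))" for i
  have Pl: "P l = E i0" by (simp add: P_def)
  have PX: "P i \<in> X" for i using h(3) E0X by (simp add: P_def)
  have Pge: "P (l + i) = E (i0 + i)" for i by (simp add: P_def)
  have Pstep: "crit (2 * 1) (P i) (P (Suc i))" for i
  proof (cases "i < l")
    case True
    then have "P (Suc i) = h (Suc i)" using i0 by (auto simp: P_def dest: less_antisym)
    then show ?thesis using h(5)[of i "Suc i"] True by (simp add: P_def)
  next
    case False
    then have "Suc i = l + Suc (i - l)" "i = l + (i - l)" by auto
    then show ?thesis using Estep[of 1 "i0 + (i - l)"] Pge[of "i - l"] Pge[of "Suc (i - l)"] by simp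
  qed
  have Pc: "crit (2 * j) (P i) (P (i + j))" for i j
  proof (induction j)
    case (Suc j)
    then show ?case
      using crit_trans[OF Suc Pstep[of "i + j"] PX PX PX] by (simp add: add.commute)
  qed simp
  have P0: "P 0 = x" using h(1) i0 by (cases "l = 0") (auto simp: P_def)
  have Pgel: "P i = E (i0 + (i - l))" if "l \<le> i" for i using that by (simp add: P_def)
  show ?thesis
  proof (rule that)
    show "P 0 = x" by (rule P0)
    show "P i \<in> same_parity x" for i
      using crit_in_comp[OF Pc[of i 0] PX] cls_crit_even[OF Pc[of i 0] PX PX]
      by (simp add: same_parity_def P0)
    show "crit (2 * j) (P i) (P (i + j))" for i j by (rule Pc)
    show "inj_on P {..<l}" using h(6) by (simp add: P_def inj_on_def)
    show "P i \<notin> D" if "i < l" for i using h(4)[OF that] that by (simp add: P_def)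
    show "P i \<in> D" if "l \<le> i" for i using ED Pgel[OF that] by simp
    show "inj_on P {i..<i + g}" if "l \<le> i" for i
    proof (rule inj_onI)
      fix u v assume uv: "u \<in> {i..<i + g}" "v \<in> {i..<i + g}" "P u = P v"
      then have "E (i0 + (u - l)) = E (i0 + (v - l))" using Pgel that by simp
      moreover have "i0 + (u - l) \<in> {i0 + (i - l)..<i0 + (i - l) + g}"
        "i0 + (v - l) \<in> {i0 + (i - l)..<i0 + (i - l) + g}" using uv that by auto
      ultimately have "i0 + (u - l) = i0 + (v - l)" using Einj by (meson inj_onD)
      then show "u = v" using uv that by auto
    qed
    show "D \<subseteq> same_parity x" "card D = g" by fact+
    show "crit (2 * g) (P i) (P i)" if "l \<le> i" for i using Floop Pgel[OF that] by (simp add: E_def)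
    show "\<exists>w\<in>X. crit 1 (P i) w \<and> crit (2 * g) w w" if "l \<le> i" for i
    proof (intro bexI conjI)
      let ?w = "F (o' + 2 * (i0 + (i - l)) + 1)"
      show "crit 1 (P i) ?w" using F(4)[of 1 "o' + 2 * (i0 + (i - l))"] Pgel[OF that] by (simp add: E_def)
      show "crit (2 * g) ?w ?w" by (rule Floop)
      show "?w \<in> X" by (rule F(2))
    qed
  qed
qed

text \<open>All nodes reached from \<open>k\<close> in \<open>2 * i + 1\<close> steps lie in this
  class, so \<open>i\<close> is at once a class and a waiting time.\<close>

definition csz :: "'a \<Rightarrow> nat \<Rightarrow> nat" where
  "csz k i = card (cl (cls k + 1 + 2 * int i))"

lemma csz_period: "csz k (i + d * j) = csz k i"
proof -
  have "[2 * int (d * j) = 0] (mod 2 * int d)" by (simp add: cong_0_iff)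
  then have "[cls k + 1 + 2 * int i + 2 * int (d * j) = cls k + 1 + 2 * int i + 0] (mod 2 * int d)"
    by (intro cong_add cong_refl)
  then show ?thesis unfolding csz_def by (metis (no_types, lifting) add.assoc add.right_neutral
    cl_cong distrib_left of_nat_add)
qed

lemma small_csz:
  assumes "even (cls k)"
  shows "(\<exists>i<d. csz k (l + i) < card odds div d) \<or>
    (\<exists>i\<le>card odds mod d. csz k (l + i) \<le> card odds div d)"
proof (rule small_class[OF d0])
  have "(\<Sum>i<d. csz k (l + i)) = (\<Sum>i<d. card (cl (cls k + 1 + 2 * int l + 2 * int i)))"
    by (simp add: csz_def algebra_simps)
  also have "\<dots> = card odds" using assms by (intro sum_cl) simp
  finally show "(\<Sum>i<d. csz k (l + i)) = card odds" .
qed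

lemma row_per_csz:
  assumes k: "k \<in> X" and w: "w \<in> X" "crit (2 * i + 1) k w" "crit (2 * g) w w" and g: "0 < g"
  shows "1 \<le> csz k i \<and> row_per X a k (2 * (g * (csz k i - 1) + i) + 1)"
proof -
  let ?S = "cl (cls k + 1 + 2 * int i)"
  have wS: "w \<in> ?S" using cls_crit[OF w(2) k w(1)] w(1) by (simp add: cl_def algebra_simps)
  \<comment> \<open>As the length of a critical closed walk, \<open>2 * g\<close> is a multiple of
    \<open>2 * d\<close>, so \<open>2 * g\<close> steps preserve the class.\<close>
  have closed: "y \<in> ?S" if "x \<in> ?S" "y \<in> X" "0 < pw (2 * g) x y" for x y
    using cl_closed[OF crit_dvd[OF w(3,1)] that] .
  have "row_per X a w (2 * g * (card ?S - 1))"
    using g by (intro row_per_restrict_loop[OF cl_subset closed] wS w(3)) auto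
  from row_per_propagate[OF w(2) k w(1) this]
  have "row_per X a k (2 * (g * (csz k i - 1) + i) + 1)"
    unfolding csz_def by (simp only: distrib_left mult.assoc add.assoc)
  moreover have "1 \<le> csz k i"
    using wS finite_cl by (auto simp: csz_def Suc_le_eq card_gt_0_iff)
  ultimately show ?thesis by simp
qed

text \<open>From \<open>l\<close> on, every odd position meets a critical closed walk of length
  \<open>2 * g\<close>, so the class may be chosen among the following ones: a smaller one within
  \<open>d\<close> positions, or one of at most average size within \<open>\<rho> + 1\<close>
  positions.\<close>

lemma transient_bound_reach:
  fixes g k l m
  defines "q \<equiv> card odds div d" and "\<rho> \<equiv> card odds mod d"
  assumes k: "k \<in> X" "even (cls k)" and g: "0 < g"
    and w: "\<And>i. l \<le> i \<Longrightarrow> \<exists>w\<in>X. crit (2 * i + 1) k w \<and> crit (2 * g) w w"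
    and lm: "l + g \<le> m"
  shows "\<exists>T. row_per X a k (2 * T + 1) \<and> int T \<le> (int q - 2) * int g + int (m + \<rho>)"
    and "csz k i < q \<Longrightarrow> \<exists>T. row_per X a k (2 * T + 1) \<and> int T \<le> (int q - 2) * int g + int m"
proof -
  have per: "1 \<le> csz k i \<and> row_per X a k (2 * (g * (csz k i - 1) + i) + 1)" if "l \<le> i" for i
    using w[OF that] row_per_csz k g by blast
  have dg: "d \<le> g"
  proof -
    obtain u where "u \<in> X" "crit (2 * g) u u" using w[of l] by auto
    then have "2 * d dvd 2 * g" using crit_dvd by blast
    then show ?thesis using g by (simp add: dvd_imp_le)
  qed
  have small: "\<exists>T. row_per X a k (2 * T + 1) \<and> int T \<le> (int q - 2) * int g + int m"
    if e: "e < d" "csz k (l + e) < q" for e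
  proof -
    \<comment> \<open>A class of at most \<open>q - 1\<close> nodes lowers the bound by
      \<open>g\<close>, and this pays for the wait because \<open>e < d\<close> and
      \<open>d \<le> g\<close>.\<close>
    have "int (g * (csz k (l + e) - 1) + (l + e)) \<le> (int (q - 1) - 2) * int g + int (m + g)"
      using e per[of "l + e"] lm dg by (intro transient_arith) auto
    also have "\<dots> = (int q - 2) * int g + int m" using e by (simp add: of_nat_diff algebra_simps)
    finally show ?thesis using conjunct2[OF per[OF le_add1]] by blast
  qed
  show "\<exists>T. row_per X a k (2 * T + 1) \<and> int T \<le> (int q - 2) * int g + int (m + \<rho>)"
    using small_csz[OF k(2), of l] unfolding q_def[symmetric] \<rho>_def[symmetric]
  proof (elim disjE exE conjE)
    fix e assume "e < d" "csz k (l + e) < q"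
    from small[OF this] show ?thesis by force
  next
    fix e assume e: "e \<le> \<rho>" "csz k (l + e) \<le> q"
    have "int (g * (csz k (l + e) - 1) + (l + e)) \<le> (int q - 2) * int g + int (m + \<rho>)"
      using e per[of "l + e"] lm by (intro transient_arith) auto
    then show ?thesis using conjunct2[OF per[OF le_add1]] by blast
  qed
  show "\<exists>T. row_per X a k (2 * T + 1) \<and> int T \<le> (int q - 2) * int g + int m" if "csz k i < q"
  proof -
    \<comment> \<open>The offset after \<open>l\<close> at which the class of \<open>i\<close>
      recurs; adding \<open>d * l\<close> keeps the subtraction from being truncated.\<close>
    let ?e = "(i + d * l - l) mod d"
    have le: "l \<le> i + d * l" using d0 by (simp add: trans_le_add2)
    have "l + (i + d * l - l) = i + d * l" using le by simp
    moreover have "i + d * l - l = ?e + d * ((i + d * l - l) div d)" by simp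
    ultimately have "csz k (l + ?e) = csz k i"
      using csz_period[of k "l + ?e" "(i + d * l - l) div d"] csz_period[of k i l]
      by (metis add.assoc)
    then show ?thesis using small[of ?e] that d0 by simp
  qed
qed

text \<open>If no class has fewer than \<open>q\<close> nodes, a class with exactly \<open>q\<close> nodes is reached within
  \<open>r - g\<close> double steps: otherwise, among the positions of the path, some class of size \<open>q\<close>
  occurs \<open>q - g/d + 1\<close> times outside the girth cycle, which contains \<open>g/d\<close> of its nodes.\<close>

lemma transient_bound_total:
  fixes g k
  defines "q \<equiv> card odds div d" and "\<rho> \<equiv> card odds mod d"
  assumes k: "k \<in> X" "even (cls k)" and x: "x \<in> X" "crit 1 k x"
    and P: "P 0 = x" "\<And>i. P i \<in> X" "\<And>i j. crit (2 * j) (P i) (P (i + j))"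
    "inj_on P {..<l}" "\<And>i. i < l \<Longrightarrow> P i \<notin> D" "\<And>i. l \<le> i \<Longrightarrow> P i \<in> D"
    "\<And>i. l \<le> i \<Longrightarrow> inj_on P {i..<i + g}"
    "\<And>i. l \<le> i \<Longrightarrow> crit (2 * g) (P i) (P i)"
    and g: "0 < g" and large: "\<And>i. q \<le> csz k i"
  shows "\<exists>T. row_per X a k (2 * T + 1) \<and> int T \<le> (int q - 2) * int g + int (card odds)"
proof -
  have kP: "crit (2 * i + 1) k (P i)" for i
    using crit_trans[OF x(2), of "2 * i" "P i"] P(3)[of i 0] P(1,2) k x by simp
  have clP: "P i \<in> cl (cls k + 1 + 2 * int i)" for i
    using cls_crit[OF kP k(1) P(2), of i] P(2) by (simp add: cl_def algebra_simps)
  have clP': "P (i + d * j) \<in> cl (cls k + 1 + 2 * int i)" for i j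
  proof -
    have "[2 * int (d * j) = 0] (mod 2 * int d)" by (simp add: cong_0_iff)
    then have "[cls k + 1 + 2 * int i + 2 * int (d * j) = cls k + 1 + 2 * int i + 0] (mod 2 * int d)"
      by (intro cong_add cong_refl)
    then have "cl (cls k + 1 + 2 * int (i + d * j)) = cl (cls k + 1 + 2 * int i)"
      using cl_cong by (simp add: distrib_left add.assoc)
    then show ?thesis using clP[of "i + d * j"] by simp
  qed
  have "2 * d dvd 2 * g" using crit_dvd[OF P(8)[of l] P(2)] by simp
  then obtain u where u: "g = d * u" by auto
  \<comment> \<open>Since no class is smaller than \<open>q\<close>, any \<open>\<rho> + 1\<close>
    consecutive positions contain a class of exactly \<open>q\<close> nodes.\<close>
  have small: "\<exists>i\<le>\<rho>. csz k (s + i) \<le> q" for s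
    using small_csz[OF k(2), of s] large unfolding q_def \<rho>_def by (meson leD)
  define e where "e = (LEAST e. csz k (l + e) \<le> q)"
  have e: "csz k (l + e) \<le> q" unfolding e_def using small[of l] by (metis (mono_tags) LeastI)
  have e_least: "\<not> csz k (l + i) \<le> q" if "i < e" for i
    using that not_less_Least unfolding e_def by blast
  \<comment> \<open>Beyond \<open>l\<close> a window of \<open>g\<close> positions shows distinct
    nodes, and every \<open>d\<close>-th of them is in the given class, which makes
    \<open>u = g / d\<close>. Starting at \<open>i + d * l\<close> puts the window beyond
    \<open>l\<close> without changing the class.\<close>
  have count: "u \<le> card (D' \<inter> cl (cls k + 1 + 2 * int i))"
    if D': "D' = P ` {i + d * l..<i + d * l + g}" for i D'
  proof -
    have le: "l \<le> i + d * l" using d0 by (simp add: trans_le_add2)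
    have "(\<lambda>m. P (i + d * (l + m))) ` {..<u} \<subseteq> D' \<inter> cl (cls k + 1 + 2 * int i)"
    proof
      fix y assume "y \<in> (\<lambda>m. P (i + d * (l + m))) ` {..<u}"
      then obtain m where m: "m < u" "y = P (i + d * (l + m))" by auto
      have "d * m < g" using m d0 u by simp
      then have "y \<in> D'" unfolding D' m(2) by (intro imageI) (simp add: distrib_left)
      then show "y \<in> D' \<inter> cl (cls k + 1 + 2 * int i)" using clP' m by blast
    qed
    moreover have "inj_on (\<lambda>m. P (i + d * (l + m))) {..<u}"
    proof (rule inj_onI)
      fix m m' assume mm: "m \<in> {..<u}" "m' \<in> {..<u}" "P (i + d * (l + m)) = P (i + d * (l + m'))"
      have "d * m < g" "d * m' < g" using mm d0 u by auto
      then have "i + d * (l + m) = i + d * (l + m')"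
        using inj_onD[OF P(7)[OF le] mm(3)] by (simp add: distrib_left)
      then show "m = m'" using d0 by simp
    qed
    ultimately have "card {..<u} \<le> card (D' \<inter> cl (cls k + 1 + 2 * int i))"
      using finite_cl by (intro card_inj_on_le) auto
    then show ?thesis by simp
  qed
  have uq: "u \<le> q"
  proof -
    have "u \<le> csz k (l + e)"
      unfolding csz_def using count[OF refl, of "l + e"] finite_cl
      by (meson card_mono inf_le2 order_trans)
    then show ?thesis using e by simp
  qed
  have r: "card odds = d * q + \<rho>" by (simp add: q_def \<rho>_def)
  have "l + e \<le> d * (q - u) + \<rho>"
  proof (rule ccontr)
    assume neg: "\<not> ?thesis"
    \<comment> \<open>The window of \<open>\<rho> + 1\<close> positions from \<open>s\<close> on is
      placed so that \<open>q - u\<close> further rounds of \<open>d\<close> positions still end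
      before \<open>l + e\<close>.\<close>
    define s where "s = l + e - (d * (q - u) + \<rho> + 1)"
    have s: "l + e = s + (d * (q - u) + \<rho> + 1)" using neg by (simp add: s_def)
    obtain i where i: "i \<le> \<rho>" "csz k (s + i) \<le> q" using small by blast
    let ?c = "cl (cls k + 1 + 2 * int (s + i))"
    let ?D = "P ` {s + i + d * l..<s + i + d * l + g}"
    \<comment> \<open>These positions precede \<open>l + e\<close> and belong to a class of size at
      most \<open>q\<close>. By minimality of \<open>e\<close> they cannot be at or beyond
      \<open>l\<close>, so they give \<open>q - u + 1\<close> distinct nodes off the girth cycle;
      with \<open>u\<close> nodes on it the class would be too large.\<close>
    have lt: "s + i + d * m < l" if "m \<le> q - u" for m
    proof (rule ccontr)
      assume ge: "\<not> ?thesis"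
      have "d * m \<le> d * (q - u)" using that by simp
      then have "s + i + d * m < l + e" using s i by linarith
      then have "\<not> csz k (l + (s + i + d * m - l)) \<le> q" using ge by (intro e_least) auto
      then show False using i ge csz_period[of k "s + i" m] by simp
    qed
    have "(\<lambda>m. P (s + i + d * m)) ` {..q - u} \<subseteq> ?c - ?D"
    proof
      fix y assume "y \<in> (\<lambda>m. P (s + i + d * m)) ` {..q - u}"
      then obtain m where m: "m \<le> q - u" "y = P (s + i + d * m)" by auto
      have "y \<notin> D" using P(5) lt m by blast
      moreover have "?D \<subseteq> D"
      proof
        fix y assume "y \<in> ?D"
        then obtain v where "s + i + d * l \<le> v" "y = P v" by auto
        then show "y \<in> D" using P(6)[of v] d0 by (metis le_add2 le_trans mult_le_mono1 nat_mult_1 Suc_leI One_nat_def)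
      qed
      ultimately show "y \<in> ?c - ?D" using clP' m by blast
    qed
    moreover have "inj_on (\<lambda>m. P (s + i + d * m)) {..q - u}"
    proof (rule inj_onI)
      fix m m' assume mm: "m \<in> {..q - u}" "m' \<in> {..q - u}" "P (s + i + d * m) = P (s + i + d * m')"
      then have "s + i + d * m = s + i + d * m'" using inj_onD[OF P(4) mm(3)] lt by simp
      then show "m = m'" using d0 by simp
    qed
    ultimately have "card {..q - u} \<le> card (?c - ?D)"
      using finite_cl by (intro card_inj_on_le) auto
    moreover have "u \<le> card (?D \<inter> ?c)" using count[OF refl] .
    moreover have "card (?c - ?D) + card (?D \<inter> ?c) = card ?c"
      using card_Int_Diff[OF finite_cl, of "cls k + 1 + 2 * int (s + i)" ?D] by (simp add: Int_commute)
    ultimately have "Suc q \<le> csz k (s + i)" using uq by (simp add: csz_def)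
    then show False using i by simp
  qed
  then have "l + e + g \<le> card odds"
    unfolding r u using uq by (simp add: diff_mult_distrib2)
      (metis add.commute add_le_cancel_left diff_mult_distrib2 le_add_diff_inverse mult_le_mono2
        group_cancel.add1 trans_le_add1)
  moreover have per: "1 \<le> csz k (l + e) \<and> row_per X a k (2 * (g * (csz k (l + e) - 1) + (l + e)) + 1)"
    using row_per_csz[OF k(1) P(2) kP P(8) g, of "l + e"] by simp
  ultimately have "int (g * (csz k (l + e) - 1) + (l + e)) \<le> (int q - 2) * int g + int (card odds)"
    using e by (intro transient_arith) auto
  then show ?thesis using per by blast
qed

text \<open>The minimum combines three bounds: from a path on the side of \<open>k\<close>, with one
  more arc to the other side at the end; from a path on the odd side, starting at a critical
  successor of \<open>k\<close>; and from counting all odd nodes.\<close>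

lemma row_per_kim:
  fixes g k
  defines "q \<equiv> card odds div d" and "\<rho> \<equiv> card odds mod d"
  assumes k: "k \<in> X" "even (cls k)" and z: "z \<in> component k" "crit (2 * g) z z" and g: "0 < g"
    and least: "\<forall>y\<in>component k. \<forall>m>0. crit m y y \<longrightarrow> 2 * g \<le> m"
  shows "\<exists>T. row_per X a k (2 * T + 1) \<and> int T \<le> (int q - 2) * int g +
    int (min (card odds) (min (card {y \<in> component k. even (cls y)}) (card {y \<in> component k. odd (cls y)}) + \<rho>))"
proof -
  let ?mt = "card {y \<in> component k. even (cls y)}" and ?mb = "card {y \<in> component k. odd (cls y)}"
  have fin_sp: "finite (same_parity x)" for x using finite_comp by (simp add: same_parity_def)
  \<comment> \<open>The first \<open>l\<close> nodes of the path and the \<open>g\<close> nodes of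
    \<open>D\<close> are disjoint and lie on the same side.\<close>
  have reach: "l + g \<le> card (same_parity x)"
    if "x \<in> X" "P 0 = x" "\<And>i. P i \<in> same_parity x" "inj_on P {..<l}" "\<And>i. i < l \<Longrightarrow> P i \<notin> D"
      "D \<subseteq> same_parity x" "card D = g" for x P l D
  proof -
    have "l + g = card (P ` {..<l} \<union> D)"
      using that finite_subset[OF that(6) fin_sp]
      by (subst card_Un_disjoint) (auto simp: card_image)
    also have "\<dots> \<le> card (same_parity x)" using that fin_sp by (intro card_mono) auto
    finally show ?thesis .
  qed
  have top: "\<exists>T. row_per X a k (2 * T + 1) \<and> int T \<le> (int q - 2) * int g + int (?mt + \<rho>)"
  proof -
    obtain P l D where P: "P 0 = k" "\<And>i. P i \<in> same_parity k"
      "\<And>i j. crit (2 * j) (P i) (P (i + j))"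
      "inj_on P {..<l}" "\<And>i. i < l \<Longrightarrow> P i \<notin> D" "\<And>i. l \<le> i \<Longrightarrow> P i \<in> D"
      "\<And>i. l \<le> i \<Longrightarrow> inj_on P {i..<i + g}" "D \<subseteq> same_parity k" "card D = g"
      "\<And>i. l \<le> i \<Longrightarrow> crit (2 * g) (P i) (P i)"
      "\<And>i. l \<le> i \<Longrightarrow> \<exists>w\<in>X. crit 1 (P i) w \<and> crit (2 * g) w w"
      using crit_path_to_girth_cycle[OF k(1) z g least] by blast
    have PX: "P i \<in> X" for i using P(2) comp_subset by (auto simp: same_parity_def)
    have w: "\<exists>w\<in>X. crit (2 * i + 1) k w \<and> crit (2 * g) w w" if i: "l \<le> i" for i
    proof -
      obtain w where w: "w \<in> X" "crit 1 (P i) w" "crit (2 * g) w w" using P(11)[OF i] by blast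
      have "crit (2 * i) k (P i)" using P(3)[of i 0] P(1) by simp
      then show ?thesis using crit_trans[OF _ w(2) k(1) PX w(1)] w by blast
    qed
    have "same_parity k = {y \<in> component k. even (cls y)}" using k by (simp add: same_parity_def)
    then have "l + g \<le> ?mt" using reach[OF k(1) P(1,2,4,5,8,9)] by simp
    from transient_bound_reach(1)[OF k g w this] show ?thesis by (simp add: q_def \<rho>_def)
  qed
  obtain j where j: "crit j k z" using z by (auto simp: component_def)
  obtain s where s: "crit s z k" using crit_sym[OF j] by blast
  have zX: "z \<in> X" using z comp_subset by blast
  have "crit (j + 2 * g + s) k k"
    using crit_trans[OF crit_trans[OF j z(2) k(1) zX zX] s k(1) zX k(1)] .
  then obtain F where F: "F 0 = k" "\<And>i. F i \<in> X" "\<And>i j. crit j (F i) (F (i + j))"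
    using crit_cycle_walk[OF _ k(1)] g by (metis add_gr_0 mult_pos_pos pos2)
  \<comment> \<open>A critical successor of \<open>k\<close>, hence a node of the odd side in the
    same component.\<close>
  define x where "x = F 1"
  have x: "x \<in> X" "crit 1 k x" using F(2) F(3)[of 1 0] F(1) by (auto simp: x_def)
  have xc: "x \<in> component k" using crit_in_comp[OF x(2,1)] .
  have cx: "component x = component k" by (rule crit_comp[OF xc k(1)])
  have odd_x: "odd (cls x)" using even_cong[OF cls_crit[OF x(2) k(1) x(1)]] k by simp
  have spx: "same_parity x = {y \<in> component k. odd (cls y)}" using odd_x cx by (simp add: same_parity_def)
  obtain P l D where P: "P 0 = x" "\<And>i. P i \<in> same_parity x"
    "\<And>i j. crit (2 * j) (P i) (P (i + j))"
    "inj_on P {..<l}" "\<And>i. i < l \<Longrightarrow> P i \<notin> D" "\<And>i. l \<le> i \<Longrightarrow> P i \<in> D"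
    "\<And>i. l \<le> i \<Longrightarrow> inj_on P {i..<i + g}" "D \<subseteq> same_parity x" "card D = g"
    "\<And>i. l \<le> i \<Longrightarrow> crit (2 * g) (P i) (P i)"
    using crit_path_to_girth_cycle[OF x(1), unfolded cx, OF z g least] by blast
  have PX: "P i \<in> X" for i using P(2) comp_subset by (auto simp: same_parity_def)
  have w: "\<exists>w\<in>X. crit (2 * i + 1) k w \<and> crit (2 * g) w w" if i: "l \<le> i" for i
  proof (intro bexI conjI)
    show "crit (2 * i + 1) k (P i)"
      using crit_trans[OF x(2), of "2 * i" "P i"] P(3)[of i 0] P(1) PX k x by simp
    show "crit (2 * g) (P i) (P i)" using P(10)[OF i] .
    show "P i \<in> X" by (rule PX)
  qed
  have lm: "l + g \<le> ?mb" using reach[OF x(1) P(1,2,4,5,8,9)] spx by simp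
  have bot: "\<exists>T. row_per X a k (2 * T + 1) \<and> int T \<le> (int q - 2) * int g + int (?mb + \<rho>)"
    using transient_bound_reach(1)[OF k g w lm] by (simp add: q_def \<rho>_def)
  \<comment> \<open>A class below \<open>q\<close> makes the summand \<open>\<rho>\<close>
    disappear, and the odd part of the component has at most \<open>card odds\<close> nodes;
    otherwise the finer count applies.\<close>
  have total: "\<exists>T. row_per X a k (2 * T + 1) \<and> int T \<le> (int q - 2) * int g + int (card odds)"
  proof (cases "\<exists>i. csz k i < q")
    case True
    then obtain i where "csz k i < q" by blast
    then have "\<exists>T. row_per X a k (2 * T + 1) \<and> int T \<le> (int q - 2) * int g + int ?mb"
      using transient_bound_reach(2)[OF k g w lm, of i] by (simp add: q_def)
    moreover have "?mb \<le> card odds"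
      using fin comp_subset by (intro card_mono) (auto simp: odds_def)
    ultimately show ?thesis by force
  next
    case False
    then have large: "q \<le> csz k i" for i by (simp add: not_less)
    show ?thesis
      using transient_bound_total[OF k x P(1) PX P(3,4,5,6,7,10) g] large by (simp add: q_def)
  qed
  have "min (card odds) (min ?mt ?mb + \<rho>) \<in> {card odds, ?mt + \<rho>, ?mb + \<rho>}"
    by (auto simp: min_def)
  then show ?thesis using top bot total by (elim insertE) auto
qed

end

subsection \<open>Closed walks and cycles\<close>

text \<open>A closed walk that is not elementary contains a closed section \<open>r\<close>, and
  removing it leaves a closed walk again. Statements about cycles thus extend to closed walks if
  they are compatible with this splitting.\<close>

lemma (in wf_digraph) closed_awalk_induct [consumes 2, case_names cycle split]:
  assumes "awalk u p u" "p \<noteq> []"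
    and cyc: "\<And>p. cycle p \<Longrightarrow> P p"
    and split: "\<And>q r s u v. awalk u q v \<Longrightarrow> awalk v r v \<Longrightarrow> awalk v s u \<Longrightarrow> r \<noteq> [] \<Longrightarrow> q @ s \<noteq> [] \<Longrightarrow>
      P r \<Longrightarrow> P (q @ s) \<Longrightarrow> P (q @ r @ s)"
  shows "P p"
  using assms(1,2)
proof (induction "length p" arbitrary: u p rule: less_induct)
  case less
  show ?case
  proof (cases "cycle p")
    case True
    then show ?thesis by (rule cyc)
  next
    case False
    \<comment> \<open>\<open>cycle\<close> ignores the first entry of the node list, so the
      repetition is sought after the first arc. Keeping that arc also ensures that the rest is
      nonempty once \<open>r\<close> is removed.\<close>
    obtain e p' where p: "p = e # p'" using less.prems(2) by (cases p) auto
    have e: "e \<in> arcs G" "tail G e = u" "awalk (head G e) p' u"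
      using less.prems(1) unfolding p by (auto simp: awalk_Cons_iff)
    have "\<not> distinct (awalk_verts (head G e) p')"
      using False less.prems unfolding cycle_def p by auto
    from awalk_not_distinct_decomp[OF e(3) this] obtain q r s v where
      qrs: "p' = q @ r @ s" "0 < length r"
        "awalk (head G e) q v" "awalk v r v" "awalk v s u" by blast
    have eq: "awalk u (e # q) v" using qrs(3) e by (simp add: awalk_Cons_iff)
    have 1: "P r" using less.hyps[of r v] qrs p by auto
    have "awalk u ((e # q) @ s) u" using awalk_appendI[OF eq qrs(5)] .
    then have 2: "P ((e # q) @ s)" using less.hyps[of "(e # q) @ s" u] qrs p by auto
    show ?thesis using split[OF eq qrs(4,5) _ _ 1 2] qrs p by auto
  qed
qed

lemma (in wf_digraph) closed_awalk_contains_cycle: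
  assumes "awalk u p u" "p \<noteq> []"
  shows "\<exists>c. cycle c \<and> length c \<le> length p"
  using assms by (induction rule: closed_awalk_induct) force+

lemma (in wf_digraph) cyclicity_dvd_closed_awalk:
  assumes "awalk u p u"
  shows "cyclicity G dvd length p"
proof (cases "p = []")
  case False
  with assms show ?thesis
  proof (induction rule: closed_awalk_induct)
    case (cycle p)
    then show ?case unfolding cyclicity_def by (intro Gcd_dvd) auto
  next
    case (split q r s u v)
    then have "cyclicity G dvd length r + length (q @ s)" by (intro dvd_add)
    then show ?case by (simp add: add_ac)
  qed
qed simp

lemma mult_eq_upper_bounds:
  fixes p q a b :: real
  assumes "0 < p" "0 < q" "p \<le> a" "q \<le> b" "p * q = a * b"
  shows "p = a \<and> q = b"
proof -
  have "a * q \<le> a * b" using assms by (intro mult_left_mono) auto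
  then have "a * q \<le> p * q" unfolding assms(5) .
  then have "a \<le> p" using mult_le_cancel_right_pos[OF assms(2)] by blast
  then have pa: "p = a" using assms(3) by linarith
  then have "a * q = a * b" "a \<noteq> 0" using assms(1,5) by auto
  then show ?thesis using pa by simp
qed

section \<open>Eigenvalue, closed walks and critical cycles of a matrix\<close>

locale nonneg_matrix =
  fixes M :: "real mat" and n :: nat
  assumes M: "M \<in> carrier_mat n n" "nonneg_mat M"
begin

abbreviation ev where "ev \<equiv> max_eigenvalue M"
abbreviation D where "D \<equiv> digraph_of M"
abbreviation C where "C \<equiv> critical_digraph M"
abbreviation ent where "ent \<equiv> \<lambda>i j. M $$ (i, j)"

lemma D_simps [simp]: "verts D = {0..<n}" "tail D = fst" "head D = snd"
  "(i, j) \<in> arcs D \<longleftrightarrow> i < n \<and> j < n \<and> 0 < M $$ (i, j)"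
  using M by (auto simp: digraph_of_def)

lemma C_simps [simp]: "tail C = fst" "head C = snd"
  by (auto simp: critical_digraph_def)

sublocale D: fin_digraph D
proof
  show "finite (arcs D)"
    by (rule finite_subset[of _ "{0..<n} \<times> {0..<n}"]) auto
qed auto

sublocale max_walks "{0..<n}" ent
  using M by unfold_locales (auto simp: nonneg_mat_def)

lemma max_pow_eq:
  assumes "i < n" "j < n"
  shows "max_pow M t $$ (i, j) = pw t i j"
proof -
  have dims: "max_pow M t \<in> carrier_mat n n" for t
    using M by (induction t) (auto simp: max_mult_def)
  have "\<forall>j<n. max_pow M t $$ (i, j) = pw t i j"
  proof (induction t)
    case 0
    then show ?case using M assms(1) by auto
  next
    case (Suc t)
    show ?case
    proof (intro allI impI)
      fix j assume j: "j < n"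
      have d: "dim_row (max_pow M t) = n" "dim_col (max_pow M t) = n" "dim_col M = n"
        using dims[of t] M by auto
      have "max_pow M (Suc t) $$ (i, j) =
          max_sum (\<lambda>l. max_pow M t $$ (i, l) * M $$ (l, j)) {0..<n}"
        using j assms(1) by (simp add: max_mult_def d)
      also have "(\<lambda>l. max_pow M t $$ (i, l) * M $$ (l, j)) ` {0..<n} =
          (\<lambda>l. pw t i l * M $$ (l, j)) ` {0..<n}"
        using Suc by (intro image_cong) auto
      then have "max_sum (\<lambda>l. max_pow M t $$ (i, l) * M $$ (l, j)) {0..<n} = pw (Suc t) i j"
        by (simp add: max_sum_def mpow.simps(2))
      finally show "max_pow M (Suc t) $$ (i, j) = pw (Suc t) i j" .
    qed
  qed
  then show ?thesis using assms(2) by blast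
qed

lemma walk_weight_append [simp]: "walk_weight M (p @ q) = walk_weight M p * walk_weight M q"
  by (simp add: walk_weight_def)

lemma awalk_weight_pos: "D.awalk u p v \<Longrightarrow> 0 < walk_weight M p"
proof (induction p arbitrary: u)
  case (Cons e p)
  then show ?case by (cases e) (auto simp: D.awalk_Cons_iff walk_weight_def)
qed (simp add: walk_weight_def)

lemma awalk_weight_le_pw: "D.awalk u p v \<Longrightarrow> walk_weight M p \<le> pw (length p) u v"
proof (induction p arbitrary: u)
  case Nil
  then show ?case by (auto simp: D.awalk_Nil_iff walk_weight_def)
next
  case (Cons e p)
  obtain x y where e: "e = (x, y)" by fastforce
  have xy: "x = u" "x < n" "y < n" "0 < M $$ (x, y)" "D.awalk y p v"
    using Cons.prems by (auto simp: D.awalk_Cons_iff e)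
  have "v < n" using D.awalk_last_in_verts[OF xy(5)] by simp
  have "walk_weight M (e # p) = pw 1 x y * walk_weight M p"
    using xy pw_1[of x y] by (simp add: walk_weight_def e)
  also have "\<dots> \<le> pw 1 x y * pw (length p) y v"
    using Cons.IH[OF xy(5)] by (intro mult_left_mono) auto
  also have "\<dots> \<le> pw (length (e # p)) u v"
    using pw_mult_le[of y v 1 x "length p"] xy \<open>v < n\<close> by simp
  finally show ?case .
qed

lemma pw_awalk:
  assumes "0 < pw t u v" "u < n" "v < n"
  shows "\<exists>p. D.awalk u p v \<and> length p = t \<and> walk_weight M p = pw t u v"
  using assms(1,3)
proof (induction t arbitrary: v)
  case 0
  then have "u = v" by (cases "u = v") auto
  then show ?case using assms by (intro exI[of _ "[]"]) (auto simp: D.awalk_Nil_iff walk_weight_def)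
next
  case (Suc t)
  obtain l where l: "l \<in> {0..<n}" "pw (Suc t) u v = pw t u l * M $$ (l, v)"
    using pw_SucE[OF Suc.prems(1)] .
  have pos: "0 < pw t u l" "0 < M $$ (l, v)"
    using l Suc.prems nonneg[of l v] pw_nonneg[of t u l]
    by (auto simp: zero_less_mult_iff simp del: pw_nonneg)
  then obtain p where p: "D.awalk u p l" "length p = t" "walk_weight M p = pw t u l"
    using Suc.IH[of l] l by auto
  have "D.awalk l [(l, v)] v" using l pos Suc.prems by (auto simp: D.awalk_Cons_iff D.awalk_Nil_iff)
  then show ?case using D.awalk_appendI[OF p(1)] p l
    by (intro exI[of _ "p @ [(l, v)]"]) (auto simp: walk_weight_def)
qed

lemma finite_cycles: "finite {p. D.cycle p}"
proof (rule finite_subset)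
  show "{p. D.cycle p} \<subseteq> {p. set p \<subseteq> arcs D \<and> distinct p}"
    unfolding D.cycle_conv by auto
  show "finite {p. set p \<subseteq> arcs D \<and> distinct p}"
    by (rule finite_subset_distinct) simp
qed

lemma cycle_mean_power:
  assumes "D.cycle p"
  shows "0 < cycle_mean M p" "cycle_mean M p ^ length p = walk_weight M p"
proof -
  obtain u where "D.awalk u p u" "p \<noteq> []" using assms unfolding D.cycle_def by auto
  then have "0 < walk_weight M p" "0 < length p" using awalk_weight_pos by auto
  then show "0 < cycle_mean M p" "cycle_mean M p ^ length p = walk_weight M p"
    by (auto simp: cycle_mean_def)
qed

lemma eigenvalue_nonneg: "0 \<le> ev"
proof (cases "\<exists>p. D.cycle p")
  case True
  then have "ev \<in> cycle_mean M ` {p. D.cycle p}"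
    unfolding max_eigenvalue_def using finite_cycles by (auto intro!: Max_in)
  then obtain p where p: "D.cycle p" "ev = cycle_mean M p" by auto
  then show ?thesis using cycle_mean_power(1)[OF p(1)] by simp
qed (simp add: max_eigenvalue_def)

lemma cycle_weight_le:
  assumes "D.cycle p"
  shows "walk_weight M p \<le> ev ^ length p"
proof -
  have "cycle_mean M p \<le> ev"
    using assms finite_cycles by (auto simp: max_eigenvalue_def intro!: Max_ge)
  then show ?thesis using cycle_mean_power[OF assms] by (metis less_imp_le power_mono)
qed

text \<open>A form without roots, which is compatible with concatenation.\<close>

lemma critical_cycle_iff:
  "critical_cycle M p \<longleftrightarrow> D.cycle p \<and> walk_weight M p = ev ^ length p"
proof -
  have "cycle_mean M p = ev \<longleftrightarrow> walk_weight M p = ev ^ length p" if "D.cycle p"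
  proof -
    have "p \<noteq> []" using that unfolding D.cycle_def by auto
    then show ?thesis using cycle_mean_power[OF that] eigenvalue_nonneg
      by (metis length_greater_0_conv less_imp_le power_eq_imp_eq_base)
  qed
  then show ?thesis unfolding critical_cycle_def by blast
qed

lemma closed_awalk_weight_le:
  assumes "D.awalk u p u"
  shows "walk_weight M p \<le> ev ^ length p"
proof (cases "p = []")
  case False
  with assms show ?thesis
  proof (induction rule: D.closed_awalk_induct)
    case (split q r s u v)
    have "0 \<le> walk_weight M (q @ s)"
      using awalk_weight_pos[OF D.awalk_appendI[OF split(1,3)]] by simp
    then have "walk_weight M r * walk_weight M (q @ s) \<le> ev ^ length r * ev ^ length (q @ s)"
      using split eigenvalue_nonneg by (intro mult_mono) auto
    then show ?case by (simp add: power_add mult_ac)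
  qed (rule cycle_weight_le)
qed (simp add: walk_weight_def)

text \<open>The critical graph is defined by elementary cycles. When a closed walk of maximal weight
  is split, neither part can exceed its bound, so both attain it, down to elementary critical
  cycles.\<close>

lemma critical_closed_awalk_arcs:
  assumes "D.awalk u p u" "walk_weight M p = ev ^ length p"
  shows "set p \<subseteq> arcs C"
proof (cases "p = []")
  case False
  with assms(1) have "walk_weight M p = ev ^ length p \<longrightarrow> set p \<subseteq> arcs C"
  proof (induction rule: D.closed_awalk_induct)
    case (cycle p)
    then show ?case using critical_cycle_iff by (auto simp: critical_digraph_def)
  next
    case (split q r s u v)
    have qs: "D.awalk u (q @ s) u" using D.awalk_appendI[OF split(1,3)] .
    show ?case
    proof
      assume "walk_weight M (q @ r @ s) = ev ^ length (q @ r @ s)"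
      then have "walk_weight M r * walk_weight M (q @ s) = ev ^ length r * ev ^ length (q @ s)"
        by (simp add: power_add mult_ac)
      then have "walk_weight M r = ev ^ length r \<and> walk_weight M (q @ s) = ev ^ length (q @ s)"
        using awalk_weight_pos[OF split(2)] awalk_weight_pos[OF qs]
          closed_awalk_weight_le[OF split(2)] closed_awalk_weight_le[OF qs]
        by (intro mult_eq_upper_bounds)
      then show "set (q @ r @ s) \<subseteq> arcs C" using split by auto
    qed
  qed
  then show ?thesis using assms(2) by blast
qed simp

lemma pw_closed_le: "x < n \<Longrightarrow> pw t x x \<le> ev ^ t"
  using pw_awalk[of t x x] closed_awalk_weight_le eigenvalue_nonneg
  by (metis dual_order.trans linorder_not_less zero_le_power)

text \<open>Identifies the eigenvalue from powers alone, so that the block matrix can be treated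
  without describing its elementary cycles.\<close>

lemma eigenvalue_unique:
  assumes "\<And>x t. x < n \<Longrightarrow> pw t x x \<le> \<mu> ^ t" "x < n" "0 < t" "pw t x x = \<mu> ^ t" "0 < \<mu>"
  shows "ev = \<mu>"
proof (rule antisym)
  have "0 < pw t x x" using assms by simp
  then obtain p where "D.awalk x p x" "length p = t" using pw_awalk assms by blast
  then obtain c where "D.cycle c" using D.closed_awalk_contains_cycle[of x p] assms(3) by auto
  then have "ev \<in> cycle_mean M ` {p. D.cycle p}"
    unfolding max_eigenvalue_def using finite_cycles by (auto intro!: Max_in)
  then obtain p where p: "D.cycle p" "ev = cycle_mean M p" by auto
  then obtain u where u: "D.awalk u p u" "p \<noteq> []" unfolding D.cycle_def by auto
  have "u < n" using D.awalk_hd_in_verts[OF u(1)] by simp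
  then have "ev ^ length p \<le> \<mu> ^ length p"
    using awalk_weight_le_pw[OF u(1)] assms(1)[of u "length p"] cycle_mean_power[OF p(1)] p(2) by simp
  then show "ev \<le> \<mu>" using u(2) assms(5) by (metis less_imp_le length_greater_0_conv power_mono_iff eigenvalue_nonneg)
  have "\<mu> ^ t \<le> ev ^ t" using assms pw_closed_le by metis
  then show "\<mu> \<le> ev" using assms(3,5) eigenvalue_nonneg by (metis less_imp_le power_mono_iff)
qed

end

subsection \<open>The critical graph\<close>

locale normalised_matrix = nonneg_matrix +
  assumes ev_pos: "0 < max_eigenvalue M"
begin

definition nent :: "nat \<Rightarrow> nat \<Rightarrow> real" where
  "nent i j = M $$ (i, j) / ev"

lemma mpow_nent:
  assumes "i < n" "j < n"
  shows "mpow {0..<n} nent t i j = pw t i j / ev ^ t"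
  using mpow_scale[of "{0..<n}" "1 / ev" "\<lambda>_. 1" i j ent t] assms ev_pos
  by (simp add: nent_def[abs_def] power_divide)

sublocale norm: crit_walks "{0..<n}" nent
proof
  fix x t assume "x \<in> {0..<n}"
  then show "mpow {0..<n} nent t x x \<le> 1"
    using mpow_nent[of x x t] pw_closed_le[of x t] ev_pos by simp
qed (use nonneg ev_pos in \<open>auto simp: nent_def\<close>)

lemma closed_awalk_crit:
  assumes "D.awalk u (p @ q) u" "D.awalk u p v" "walk_weight M (p @ q) = ev ^ length (p @ q)"
  shows "norm.crit (length p) u v"
proof -
  have q: "D.awalk v q u" using assms(1,2) D.awalk_append_iff D.awalk_ends_eqD by fastforce
  have uv: "u < n" "v < n"
    using D.awalk_hd_in_verts[OF assms(2)] D.awalk_last_in_verts[OF assms(2)] by auto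
  have "1 = (walk_weight M p / ev ^ length p) * (walk_weight M q / ev ^ length q)"
    using assms(3) ev_pos by (simp add: power_add)
  also have "\<dots> \<le> norm.pw (length p) u v * norm.pw (length q) v u"
    using awalk_weight_le_pw[OF assms(2)] awalk_weight_le_pw[OF q] ev_pos uv
      awalk_weight_pos[OF assms(2)] awalk_weight_pos[OF q]
    by (intro mult_mono) (auto simp: mpow_nent divide_right_mono less_imp_le)
  finally show ?thesis using norm.crit_iff_ge uv by auto
qed

lemma critical_cycle_at:
  assumes "e \<in> arcs C"
  obtains p where "D.awalk (fst e) (e # p) (fst e)" "walk_weight M (e # p) = ev ^ length (e # p)"
proof -
  obtain p where p: "critical_cycle M p" "e \<in> set p"
    using assms by (auto simp: critical_digraph_def)
  then obtain u where u: "D.awalk u p u" unfolding critical_cycle_iff D.cycle_def by auto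
  obtain q s where qs: "p = q @ e # s" using p(2) by (meson split_list)
  have 1: "D.awalk u q (fst e)" "D.awalk (fst e) (e # s) u"
    using u unfolding qs by (auto simp: D.awalk_Cons_iff)
  have "D.awalk (fst e) (e # s @ q) (fst e)" using D.awalk_appendI[OF 1(2,1)] by simp
  moreover have "walk_weight M (e # s @ q) = walk_weight M p"
    unfolding qs by (simp add: walk_weight_def)
  then have "walk_weight M (e # s @ q) = ev ^ length (e # s @ q)"
    using p(1) unfolding critical_cycle_iff qs by (simp add: add_ac)
  ultimately show ?thesis using that by blast
qed

lemma arcs_C_crit:
  assumes "e \<in> arcs C"
  shows "norm.crit 1 (fst e) (snd e)" "fst e < n" "snd e < n"
proof -
  obtain p where p: "D.awalk (fst e) (e # p) (fst e)" "walk_weight M (e # p) = ev ^ length (e # p)"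
    using critical_cycle_at[OF assms] .
  have e: "e \<in> arcs D" using p(1) by (simp add: D.awalk_Cons_iff)
  then show "fst e < n" "snd e < n" by (cases e; simp)+
  then have "D.awalk (fst e) [e] (snd e)" using e by (simp add: D.awalk_Cons_iff D.awalk_Nil_iff)
  then show "norm.crit 1 (fst e) (snd e)"
    using closed_awalk_crit[of "fst e" "[e]" p "snd e"] p by simp
qed

lemma verts_C:
  assumes "x \<in> verts C"
  obtains e where "e \<in> arcs C" "fst e = x"
  using assms by (auto simp: critical_digraph_def)

lemma verts_C_crit:
  assumes "x \<in> verts C"
  shows "x < n" "\<exists>t>0. norm.crit t x x"
proof -
  obtain e where e: "e \<in> arcs C" "fst e = x" using verts_C[OF assms] .
  obtain p where p: "D.awalk x (e # p) x" "walk_weight M (e # p) = ev ^ length (e # p)"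
    using critical_cycle_at[OF e(1)] e(2) by blast
  show "x < n" using arcs_C_crit(2)[OF e(1)] e by simp
  show "\<exists>t>0. norm.crit t x x"
    using closed_awalk_crit[of x "e # p" "[]" x] p by (intro exI[of _ "length (e # p)"]) auto
qed

sublocale C: wf_digraph C
proof
  fix e assume e: "e \<in> arcs C"
  then show "tail C e \<in> verts C" by (auto simp: critical_digraph_def)
  obtain p where p: "D.awalk (fst e) (e # p) (fst e)" "walk_weight M (e # p) = ev ^ length (e # p)"
    using critical_cycle_at[OF e] .
  have s: "set (e # p) \<subseteq> arcs C" using critical_closed_awalk_arcs[OF p] .
  \<comment> \<open>The nodes are defined as tails: the head of \<open>e\<close> is the tail of the
    next arc of the closed walk, or of \<open>e\<close> itself if it is a loop.\<close>
  show "head C e \<in> verts C"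
  proof (cases p)
    case Nil
    then have "snd e = fst e" using p(1) by (simp add: D.awalk_simps)
    then show ?thesis using e by (auto simp: critical_digraph_def)
  next
    case (Cons e' p')
    then have "snd e = fst e'" using p(1) by (simp add: D.awalk_simps)
    then show ?thesis using s Cons by (auto simp: critical_digraph_def)
  qed
qed

lemma cas_C: "C.cas = D.cas"
  by (rule compatible_cas) (simp add: compatible_def)

lemma reachable_C_comp:
  assumes "x \<rightarrow>\<^sup>*\<^bsub>C\<^esub> y"
  shows "y \<in> norm.component x"
  using assms
proof (induction rule: C.reachable_induct)
  case base
  then show ?case using verts_C_crit norm.self_in_comp by auto
next
  case (step y z)
  then obtain e where e: "e \<in> arcs C" "fst e = y" "snd e = z" by (auto simp: arcs_ends_conv)
  have "x < n" using step.hyps(1) C.reachable_in_verts(1) verts_C_crit by blast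
  then have "norm.component y = norm.component x" using norm.crit_comp[OF step.IH] by simp
  then show ?case using norm.crit_in_comp[OF arcs_C_crit(1)[OF e(1)]] arcs_C_crit(3)[OF e(1)] e by auto
qed

text \<open>The second alternative is the empty walk, which is critical at every node, even at nodes
  outside the critical graph.\<close>

lemma crit_closed_awalk:
  assumes "norm.crit j x y" "norm.crit s y x" "x < n" "y < n"
  obtains p q where "C.awalk x p y" "C.awalk y q x" "length p = j" "length q = s" | "j = 0" "s = 0"
proof (cases "j + s = 0")
  case False
  have "norm.pw j x y * norm.pw s y x = 1" using norm.crit_inverse assms by simp
  then have 1: "pw j x y * pw s y x = ev ^ (j + s)"
    using assms ev_pos by (simp add: mpow_nent power_add)
  then have "pw j x y \<noteq> 0" "pw s y x \<noteq> 0" using ev_pos by auto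
  then have "0 < pw j x y" "0 < pw s y x" using pw_nonneg[of j x y] pw_nonneg[of s y x] by linarith+
  then obtain p q where p: "D.awalk x p y" "length p = j" "walk_weight M p = pw j x y"
    and q: "D.awalk y q x" "length q = s" "walk_weight M q = pw s y x"
    using pw_awalk assms by meson
  have "set (p @ q) \<subseteq> arcs C"
    using critical_closed_awalk_arcs[OF D.awalk_appendI[OF p(1) q(1)]] p q 1 by simp
  then have sub: "set p \<subseteq> arcs C" "set q \<subseteq> arcs C" by auto
  have in_C: "u \<in> verts C" if "D.awalk u r v" "r \<noteq> []" "set r \<subseteq> arcs C" for u r v
  proof (cases r)
    case (Cons e r')
    then have "fst e = u" "e \<in> arcs C" using that by (auto simp: D.awalk_Cons_iff)
    then show ?thesis using C.tail_in_verts[of e] by simp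
  qed (use that in simp)
  have xC: "x \<in> verts C"
  proof (cases "p = []")
    case True
    then have "x = y" using p(1) by (simp add: D.awalk_simps)
    then show ?thesis using in_C[OF q(1) _ sub(2)] False True p q by auto
  qed (use in_C[OF p(1) _ sub(1)] in blast)
  have yC: "y \<in> verts C"
  proof (cases "q = []")
    case True
    then have "x = y" using q(1) by (simp add: D.awalk_simps)
    then show ?thesis using xC by simp
  qed (use in_C[OF q(1) _ sub(2)] in blast)
  have "C.awalk x p y" "C.awalk y q x"
    using p(1) q(1) sub xC yC by (auto simp: C.awalk_def D.awalk_def cas_C)
  then show ?thesis using that p q by blast
qed (use that in auto)

lemma comp_reachable_C:
  assumes "x \<in> verts C" "y \<in> norm.component x"
  shows "x \<rightarrow>\<^sup>*\<^bsub>C\<^esub> y \<and> y \<rightarrow>\<^sup>*\<^bsub>C\<^esub> x"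
proof -
  have x: "x < n" using verts_C_crit assms by blast
  have y: "y < n" using assms(2) norm.comp_subset[of x] by auto
  obtain j where j: "norm.crit j x y" using assms(2) by (auto simp: norm.component_def)
  obtain s where s: "norm.crit s y x" using norm.crit_sym[OF j] by blast
  show ?thesis
  proof (rule crit_closed_awalk[OF j s x y])
    assume "j = 0"
    then have "x = y" using norm.crit_pos[OF j] by (cases "x = y") auto
    then show ?thesis using assms(1) by (simp add: C.reachable_refl)
  qed (auto intro: C.reachable_awalkI)
qed

lemma scc_verts_eq_comp:
  assumes H: "H \<in> C.sccs" "k \<in> verts H"
  shows "verts H = norm.component k"
proof -
  have S: "verts H \<in> C.sccs_verts" using H by (intro C.in_sccs_vertsI_sccs) auto
  have k: "k \<in> verts C"
    using H by (auto simp: C.sccs_def induced_subgraph_def subgraph_def)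
  show ?thesis
  proof (intro equalityI subsetI)
    fix y assume "y \<in> verts H"
    then have "k \<rightarrow>\<^sup>*\<^bsub>C\<^esub> y" using S H(2) by (auto simp: C.sccs_verts_def)
    then show "y \<in> norm.component k" by (rule reachable_C_comp)
  next
    fix y assume "y \<in> norm.component k"
    then have "k \<rightarrow>\<^sup>*\<^bsub>C\<^esub> y" "y \<rightarrow>\<^sup>*\<^bsub>C\<^esub> k" using comp_reachable_C[OF k] by auto
    then show "y \<in> verts H" using S H(2) unfolding C.sccs_verts_def by blast
  qed
qed

text \<open>A critical closed walk through a node of the component has all its arcs in
  \<open>H\<close>, so it contains a cycle of \<open>H\<close> that is no longer. Conversely the
  arcs of \<open>H\<close> are critical and critical walks compose. Hence the girth is the least
  length of a nonempty critical closed walk in the component.\<close>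

lemma girth_scc:
  assumes H: "H \<in> C.sccs" "k \<in> verts H"
  shows "0 < girth H" "\<exists>x\<in>norm.component k. norm.crit (girth H) x x"
    and "\<And>x l. x \<in> norm.component k \<Longrightarrow> 0 < l \<Longrightarrow> norm.crit l x x \<Longrightarrow> girth H \<le> l"
proof -
  have ind: "induced_subgraph H C" using H by (auto simp: C.sccs_def)
  then have Hs: "verts H \<subseteq> verts C" "wf_digraph H" "tail H = fst" "head H = snd"
    "arcs H = {e \<in> arcs C. fst e \<in> verts H \<and> snd e \<in> verts H}"
    by (auto simp: induced_subgraph_def subgraph_def compatible_def)
  interpret H: wf_digraph H by fact
  have vH: "verts H = norm.component k" by (rule scc_verts_eq_comp[OF H])
  have kC: "k \<in> verts C" using H(2) Hs by auto
  have k: "k < n" using verts_C_crit kC by blast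
  have casH: "H.cas = C.cas" by (rule compatible_cas) (simp add: compatible_def Hs)
  have short: "\<exists>c. H.cycle c \<and> length c \<le> l"
    if x: "x \<in> norm.component k" and l: "0 < l" "norm.crit l x x" for x l
  proof -
    have xn: "x < n" using x norm.comp_subset[of k] by auto
    obtain p where p: "C.awalk x p x" "length p = l"
      using crit_closed_awalk[OF l(2) norm.crit_0 xn xn] l(1) by auto
    have "set p \<subseteq> arcs H"
    proof
      fix e assume e: "e \<in> set p"
      then obtain q s where qs: "p = q @ e # s" by (meson split_list)
      have "C.awalk x q (fst e)" "e \<in> arcs C"
        using p(1) unfolding qs by (auto simp: C.awalk_Cons_iff)
      then have "fst e \<in> norm.component x" using reachable_C_comp C.reachable_awalkI by blast
      then have 1: "fst e \<in> norm.component k" using norm.crit_comp[OF x] k by simp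
      have "snd e \<in> norm.component (fst e)"
        using norm.crit_in_comp[OF arcs_C_crit(1)] arcs_C_crit(3) \<open>e \<in> arcs C\<close> by auto
      then have "snd e \<in> norm.component k" using norm.crit_comp[OF 1] k by simp
      with 1 show "e \<in> arcs H" using Hs \<open>e \<in> arcs C\<close> vH by auto
    qed
    then have "H.awalk x p x" using p(1) x vH by (simp add: H.awalk_def C.awalk_def casH)
    then show ?thesis using H.closed_awalk_contains_cycle[of x p] p l by auto
  qed
  show le: "girth H \<le> l" if "x \<in> norm.component k" "0 < l" "norm.crit l x x" for x l
  proof -
    from short[OF that] obtain c where "H.cycle c" "length c \<le> l" by blast
    then have "girth H \<le> length c" unfolding girth_def by (intro Least_le) blast
    then show ?thesis using \<open>length c \<le> l\<close> by simp
  qed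
  obtain t where t: "t > 0" "norm.crit t k k" using verts_C_crit(2)[OF kC] by blast
  obtain c0 where "H.cycle c0" using short[OF norm.self_in_comp t] k by auto
  then have "\<exists>l p. H.cycle p \<and> length p = l" by blast
  from LeastI_ex[OF this] have "\<exists>p. H.cycle p \<and> length p = girth H" unfolding girth_def .
  then obtain c where c: "H.cycle c" "length c = girth H" by blast
  then obtain u where u: "H.awalk u c u" "c \<noteq> []" unfolding H.cycle_def by auto
  show "0 < girth H" using c(2)[symmetric] u(2) by simp
  have "norm.crit (length p) x y" if "H.awalk x p y" for x p y
    using that
  proof (induction p arbitrary: x)
    case Nil
    then show ?case by (simp add: H.awalk_Nil_iff)
  next
    case (Cons e p)
    have e: "e \<in> arcs C" "fst e = x" "H.awalk (snd e) p y"
      using Cons.prems Hs by (auto simp: H.awalk_Cons_iff)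
    have "y \<in> norm.component k" using H.awalk_last_in_verts[OF Cons.prems] vH by simp
    then have "y < n" using norm.comp_subset[of k] by auto
    then show ?case
      using norm.crit_trans[OF arcs_C_crit(1)[OF e(1)] Cons.IH[OF e(3)]] arcs_C_crit[OF e(1)] e(2)
      by simp
  qed
  then show "\<exists>x\<in>norm.component k. norm.crit (girth H) x x"
    using u(1) c(2) H.awalk_hd_in_verts[OF u(1)] vH by metis
qed

end

subsection \<open>Transposition\<close>

context crit_walks
begin

lemma crit_walks_transpose: "crit_walks X (\<lambda>x y. a y x)"
proof
  fix x t assume "x \<in> X"
  then show "mpow X (\<lambda>x y. a y x) t x x \<le> 1" using mpow_transpose closed_le by simp
qed (use fin nonneg in auto)

lemma crit_transpose:
  assumes "x \<in> X" "y \<in> X"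
  shows "crit_walks.crit X (\<lambda>x y. a y x) j x y \<longleftrightarrow> crit j y x"
proof -
  interpret tr: crit_walks X "\<lambda>x y. a y x" by (rule crit_walks_transpose)
  show ?thesis unfolding tr.crit_def crit_def using assms by (simp add: mpow_transpose)
qed

lemma comp_transpose:
  assumes "x \<in> X"
  shows "crit_walks.component X (\<lambda>x y. a y x) x = component x"
proof -
  interpret tr: crit_walks X "\<lambda>x y. a y x" by (rule crit_walks_transpose)
  show ?thesis unfolding tr.component_def component_def using crit_transpose assms crit_sym by blast
qed

end

text \<open>Negated classes rise by one along reversed arcs and keep their parity, so the row bounds
  yield the column bounds.\<close>

lemma (in cyc_walks) cyc_walks_transpose: "cyc_walks X (\<lambda>x y. a y x) (\<lambda>x. - cls x) d"
proof -
  interpret tr: crit_walks X "\<lambda>x y. a y x" by (rule crit_walks_transpose)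
  show ?thesis
  proof
    fix x y assume "x \<in> X" "y \<in> X" "0 < a y x"
    then have "[cls x = cls y + 1] (mod 2 * int d)" using cls_arc by blast
    then show "[- cls y = - cls x + 1] (mod 2 * int d)"
      by (simp add: cong_iff_dvd_diff algebra_simps)
  qed (rule d0)
qed

subsection \<open>Factorised matrices\<close>

text \<open>A zero vector makes its outer product vanish, and dropping it contradicts the minimality
  of \<open>r\<close>. This gives every factor node an arc in and an arc out.\<close>

lemma rank_factorization_nonzero:
  assumes A: "A \<in> carrier_mat n n" and rank: "factor_rank A = r"
    and rep: "max_factorization n r A v w" and \<alpha>: "\<alpha> < r"
  shows "(\<exists>i<n. v \<alpha> $ i \<noteq> 0) \<and> (\<exists>j<n. w \<alpha> $ j \<noteq> 0)"
proof (rule ccontr)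
  assume neg: "\<not> ?thesis"
  \<comment> \<open>Enumerates the indices other than \<open>\<alpha>\<close> by skipping
    it.\<close>
  define sk where "sk \<beta> = (if \<beta> < \<alpha> then \<beta> else Suc \<beta>)" for \<beta>
  have sk: "insert \<alpha> (sk ` {0..<r - 1}) = {0..<r}"
  proof (intro equalityI subsetI)
    fix \<beta> assume b: "\<beta> \<in> {0..<r}"
    consider "\<beta> < \<alpha>" | "\<beta> = \<alpha>" | "\<alpha> < \<beta>" by linarith
    then show "\<beta> \<in> insert \<alpha> (sk ` {0..<r - 1})"
    proof cases
      case 1
      then have "\<beta> = sk \<beta>" "\<beta> \<in> {0..<r - 1}" using \<alpha> by (auto simp: sk_def)
      then show ?thesis by blast
    next
      case 3
      then have "\<beta> = sk (\<beta> - 1)" "\<beta> - 1 \<in> {0..<r - 1}" using b by (auto simp: sk_def)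
      then show ?thesis by blast
    qed simp
  qed (use \<alpha> in \<open>auto simp: sk_def\<close>)
  have eq: "max_sum (\<lambda>\<beta>. v \<beta> $ i * w \<beta> $ j) {0..<r} =
      max_sum (\<lambda>\<beta>. v (sk \<beta>) $ i * w (sk \<beta>) $ j) {0..<r - 1}" if "i < n" "j < n" for i j
  proof -
    have "v \<alpha> $ i * w \<alpha> $ j = 0" using neg that by auto
    then have "insert 0 ((\<lambda>\<beta>. v \<beta> $ i * w \<beta> $ j) ` {0..<r}) =
        insert 0 ((\<lambda>\<beta>. v (sk \<beta>) $ i * w (sk \<beta>) $ j) ` {0..<r - 1})"
      unfolding sk[symmetric] by auto
    then show ?thesis by (simp add: max_sum_def)
  qed
  have "sk \<beta> < r" if "\<beta> < r - 1" for \<beta> using that by (auto simp: sk_def)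
  then have "max_factorization n (r - 1) A (\<lambda>\<beta>. v (sk \<beta>)) (\<lambda>\<beta>. w (sk \<beta>))"
    using rep eq unfolding max_factorization_def by (auto intro!: eq_matI)
  then have "factor_rank A \<le> r - 1"
    using A unfolding factor_rank_def by (intro Least_le) auto
  then show False using rank \<alpha> by simp
qed

locale factored =
  fixes A :: "real mat" and n r :: nat and v w :: "nat \<Rightarrow> real vec" and k :: nat
  assumes A: "A \<in> carrier_mat n n" "nonneg_mat A"
    and rep: "max_factorization n r A v w"
    and k: "k \<in> verts (critical_digraph A)"
begin

abbreviation Zm where "Zm \<equiv> block_mat n r v w"
abbreviation zent where "zent \<equiv> \<lambda>i j. Zm $$ (i, j)"

lemma vw: "\<alpha> < r \<Longrightarrow> v \<alpha> \<in> carrier_vec n \<and> (\<forall>i<n. 0 \<le> v \<alpha> $ i) \<and> w \<alpha> \<in> carrier_vec n \<and> (\<forall>i<n. 0 \<le> w \<alpha> $ i)"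
  using rep unfolding max_factorization_def nonneg_vec_def by auto

lemma Zm_carrier: "Zm \<in> carrier_mat (n + r) (n + r)"
  unfolding block_mat_def Let_def by (rule carrier_matI) simp_all

lemma Zm_entries:
  assumes "x < n + r" "y < n + r"
  shows "Zm $$ (x, y) = (if x < n \<and> n \<le> y then v (y - n) $ x
    else if n \<le> x \<and> y < n then w (x - n) $ y else 0)"
  using assms by (auto simp: block_mat_def Let_def mat_of_cols_index)

sublocale A: normalised_matrix A n
proof -
  interpret A: nonneg_matrix A n by unfold_locales (use A in auto)
  obtain p where p: "critical_cycle A p" using k by (auto simp: critical_digraph_def)
  then have "A.D.cycle p" "cycle_mean A p = max_eigenvalue A" by (auto simp: critical_cycle_def)
  then have "0 < max_eigenvalue A" using A.cycle_mean_power(1) by metis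
  then show "normalised_matrix A n" by unfold_locales
qed

lemma nonneg_Zm: "nonneg_mat Zm"
  unfolding nonneg_mat_def using Zm_carrier vw by (auto simp: Zm_entries)

sublocale Z0: nonneg_matrix Zm "n + r"
  by unfold_locales (use Zm_carrier nonneg_Zm in auto)

lemma A_entry: "i < n \<Longrightarrow> j < n \<Longrightarrow> A $$ (i, j) = Max (insert 0 ((\<lambda>\<alpha>. v \<alpha> $ i * w \<alpha> $ j) ` {0..<r}))"
  using rep unfolding max_factorization_def max_sum_def by simp

lemma Z_parity:
  assumes "0 < Z0.pw t x y" "x < n + r" "y < n + r"
  shows "even t \<longleftrightarrow> (x < n \<longleftrightarrow> y < n)"
  using assms(1,3)
proof (induction t arbitrary: y)
  case 0
  then show ?case by (cases "x = y") auto
next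
  case (Suc t)
  obtain l where l: "l \<in> {0..<n + r}" "Z0.pw (Suc t) x y = Z0.pw t x l * zent l y"
    using Z0.pw_SucE[OF Suc.prems(1)] .
  then have "0 < Z0.pw t x l" "zent l y \<noteq> 0"
    using Suc.prems Z0.pw_nonneg[of t x l]
    by (auto simp: zero_less_mult_iff simp del: Z0.pw_nonneg)
  then show ?case using Suc.IH[of l] l Suc.prems by (auto simp: Zm_entries split: if_splits)
qed

lemma Z_pw_2:
  assumes ij: "i < n" "j < n"
  shows "Z0.pw 2 i j = A $$ (i, j)"
proof (rule antisym)
  let ?f = "\<lambda>\<alpha>. v \<alpha> $ i * w \<alpha> $ j"
  have A0: "0 \<le> A $$ (i, j)" using A.nonneg[of i j] ij by simp
  show "Z0.pw 2 i j \<le> A $$ (i, j)"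
  proof (cases "0 < Z0.pw (1 + 1) i j")
    case True
    obtain l where l: "l \<in> {0..<n + r}" "Z0.pw (1 + 1) i j = Z0.pw 1 i l * Z0.pw 1 l j"
      using Z0.pw_splitE[OF True] ij by auto
    then have eq: "Z0.pw 2 i j = zent i l * zent l j"
      using Z0.pw_1[of i l] Z0.pw_1[of l j] ij by (simp add: numeral_2_eq_2)
    then have "zent i l \<noteq> 0" using True by (auto simp: numeral_2_eq_2)
    then have "n \<le> l" using ij l(1) by (auto simp: Zm_entries split: if_splits)
    then have "Z0.pw 2 i j = ?f (l - n)" "l - n \<in> {0..<r}" using eq ij l(1) by (auto simp: Zm_entries)
    then have "Z0.pw 2 i j \<in> insert 0 (?f ` {0..<r})" by blast
    then show ?thesis unfolding A_entry[OF ij] by (intro Max_ge) auto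
  next
    case False
    then have "Z0.pw 2 i j \<le> 0" by (simp add: numeral_2_eq_2)
    then show ?thesis using A0 by simp
  qed
  show "A $$ (i, j) \<le> Z0.pw 2 i j"
  proof -
    have "A $$ (i, j) \<in> insert 0 (?f ` {0..<r})" unfolding A_entry[OF ij] by (intro Max_in) auto
    then consider "A $$ (i, j) = 0" | \<alpha> where "\<alpha> < r" "A $$ (i, j) = ?f \<alpha>" by auto
    then show ?thesis
    proof cases
      case 2
      then have "A $$ (i, j) = Z0.pw 1 i (n + \<alpha>) * Z0.pw 1 (n + \<alpha>) j"
        using ij Z0.pw_1[of i "n + \<alpha>"] Z0.pw_1[of "n + \<alpha>" j] by (simp add: Zm_entries)
      also have "\<dots> \<le> Z0.pw (1 + 1) i j" using ij 2 by (intro Z0.pw_mult_le) auto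
      finally show ?thesis by (simp add: numeral_2_eq_2)
    qed simp
  qed
qed

lemma Z_pw_double:
  assumes ij: "i < n" "j < n"
  shows "Z0.pw (2 * t) i j = A.pw t i j"
proof -
  have "mpow {0..<n} (Z0.pw 2) t i j = Z0.pw (2 * t) i j"
  proof (rule Z0.mpow_restrict)
    show "y \<in> {0..<n}" if "x \<in> {0..<n}" "y \<in> {0..<n + r}" "0 < Z0.pw 2 x y" for x y
      using Z_parity[OF that(3)] that by auto
  qed (use ij in auto)
  moreover have "mpow {0..<n} (Z0.pw 2) t i j = A.pw t i j"
    using ij by (intro mpow_cong) (auto simp: Z_pw_2)
  ultimately show ?thesis by simp
qed

lemma k_less: "k < n"
  using A.verts_C_crit(1)[OF k] .

lemma Z_closed_le:
  assumes x: "x < n + r"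
  shows "Z0.pw t x x \<le> sqrt A.ev ^ t"
proof -
  have top: "Z0.pw t x x \<le> sqrt A.ev ^ t" if "x < n" for t x
  proof (cases "0 < Z0.pw t x x")
    case True
    then have "even t" using Z_parity that by simp
    then obtain s where s: "t = 2 * s" by blast
    show ?thesis
      using Z_pw_double[OF that that] A.pw_closed_le[OF that, of s] A.ev_pos
      by (simp add: s power_mult)
  next
    case False
    then show ?thesis using A.ev_pos by (meson less_imp_le not_less order_trans real_sqrt_ge_0_iff zero_le_power)
  qed
  show ?thesis
  proof (cases "x < n \<or> t = 0 \<or> \<not> 0 < Z0.pw t x x")
    case True
    then show ?thesis using top A.ev_pos
      by (auto simp: not_less intro: order_trans[OF _ zero_le_power])
  next
    case False
    \<comment> \<open>A closed walk at a factor node is rotated by one arc, to start at a node of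
      \<open>A\<close>.\<close>
    then obtain s where s: "t = 1 + s" by (metis Suc_eq_plus1_left not0_implies_Suc)
    have p: "0 < Z0.pw (1 + s) x x" using False s by simp
    obtain y where y: "y \<in> {0..<n + r}" "Z0.pw (1 + s) x x = Z0.pw 1 x y * Z0.pw s y x"
      using Z0.pw_splitE[OF p] x by auto
    then have "Z0.pw 1 x y \<noteq> 0" using p by auto
    then have "0 < Z0.pw 1 x y" using Z0.pw_nonneg[of 1 x y] by linarith
    then have yn: "y < n" using Z_parity[of 1 x y] False x y(1) by auto
    have "Z0.pw t x x = Z0.pw s y x * Z0.pw 1 x y" using y(2) s by (simp add: mult.commute)
    also have "\<dots> \<le> Z0.pw (s + 1) y y" using x y by (intro Z0.pw_mult_le) auto
    also have "\<dots> \<le> sqrt A.ev ^ (s + 1)" by (rule top[OF yn])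
    finally show ?thesis using s by simp
  qed
qed

text \<open>One arc of \<open>A\<close> corresponds to two arcs of the block matrix, hence the
  square root.\<close>

lemma Z_eigenvalue: "max_eigenvalue Zm = sqrt A.ev"
proof -
  obtain t where t: "0 < t" "A.norm.crit t k k" using A.verts_C_crit(2)[OF k] by blast
  then have "A.norm.pw t k k = 1" using A.norm.crit_closed k_less by simp
  then have "A.pw t k k = A.ev ^ t" using A.mpow_nent k_less A.ev_pos by simp
  then have "Z0.pw (2 * t) k k = sqrt A.ev ^ (2 * t)"
    using Z_pw_double[OF k_less k_less] A.ev_pos by (simp add: power_mult)
  then show ?thesis
    using Z0.eigenvalue_unique[OF Z_closed_le, of k "2 * t"] t(1) k_less A.ev_pos by simp
qed

sublocale Z: normalised_matrix Zm "n + r"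
  by unfold_locales (use Z_eigenvalue A.ev_pos in simp)

abbreviation X where "X \<equiv> {0..<n + r}"

lemma norm_pw_double:
  assumes "i < n" "j < n"
  shows "Z.norm.pw (2 * t) i j = A.norm.pw t i j"
  using assms Z_pw_double[OF assms] A.ev_pos
  by (simp add: Z.mpow_nent A.mpow_nent Z_eigenvalue power_mult)

lemma norm_parity:
  assumes "0 < Z.norm.pw t x y" "x < n + r" "y < n + r"
  shows "even t \<longleftrightarrow> (x < n \<longleftrightarrow> y < n)"
proof (rule Z_parity)
  show "0 < Z0.pw t x y"
    using assms Z.mpow_nent[of x y t] Z.ev_pos by (simp add: zero_less_divide_iff)
qed (use assms in auto)

lemma norm_crit_parity:
  assumes "Z.norm.crit t x y" "x < n + r" "y < n + r"
  shows "even t \<longleftrightarrow> (x < n \<longleftrightarrow> y < n)"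
  using norm_parity[OF Z.norm.crit_pos[OF assms(1)] assms(2,3)] .

text \<open>The return walk between two nodes of \<open>A\<close> also has even length, so it too is
  a walk of \<open>A\<close>.\<close>

lemma norm_crit_double:
  assumes "x < n" "y < n"
  shows "Z.norm.crit (2 * j) x y \<longleftrightarrow> A.norm.crit j x y"
proof
  assume c: "Z.norm.crit (2 * j) x y"
  then obtain s where s: "Z.norm.crit s y x" using Z.norm.crit_sym by blast
  then have "even s" using norm_crit_parity assms by simp
  then obtain s' where s': "s = 2 * s'" by blast
  have "Z.norm.pw (2 * j) x y * Z.norm.pw (2 * s') y x = 1"
    using Z.norm.crit_inverse[OF c s] assms s' by simp
  then show "A.norm.crit j x y" using assms norm_pw_double unfolding A.norm.crit_def by metis
next
  assume "A.norm.crit j x y"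
  then show "Z.norm.crit (2 * j) x y"
    using assms norm_pw_double unfolding A.norm.crit_def Z.norm.crit_def by metis
qed

text \<open>Hence \<open>H\<close> consists of the nodes of \<open>G\<close> below \<open>n\<close>,
  so |H| and m' are the sizes of the two sides of one component.\<close>

lemma comp_top: "{y \<in> Z.norm.component k. y < n} = A.norm.component k"
proof (intro equalityI subsetI)
  fix y assume y: "y \<in> {y \<in> Z.norm.component k. y < n}"
  then obtain j where j: "Z.norm.crit j k y" by (auto simp: Z.norm.component_def)
  then have "even j" using norm_crit_parity[OF j] k_less y by simp
  then obtain j' where "j = 2 * j'" by blast
  then have "A.norm.crit j' k y" using j norm_crit_double k_less y by simp
  then show "y \<in> A.norm.component k" using A.norm.crit_in_comp y by simp
next
  fix y assume y: "y \<in> A.norm.component k"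
  then obtain j where j: "A.norm.crit j k y" and yn: "y < n" by (auto simp: A.norm.component_def)
  then have "Z.norm.crit (2 * j) k y" using norm_crit_double k_less by simp
  then show "y \<in> {y \<in> Z.norm.component k. y < n}" using Z.norm.crit_in_comp yn by simp
qed

lemma k_Zcrit: "k \<in> verts Z0.C"
proof -
  obtain t where t: "0 < t" "A.norm.crit t k k" using A.verts_C_crit(2)[OF k] by blast
  then have "Z.norm.crit (2 * t) k k" using norm_crit_double k_less by simp
  then obtain p where "Z.C.awalk k p k"
    using Z.crit_closed_awalk[of "2 * t" k k 0] t(1) k_less by auto
  then show ?thesis by (rule Z.C.awalk_hd_in_verts)
qed

text \<open>One step of \<open>A\<close> is two steps of the block matrix, which is where the summand 1 in all
  bounds comes from.\<close>

lemma transients_bounded: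
  assumes "row_per X Z.nent k (2 * T + 1)" "row_per X (\<lambda>x y. Z.nent y x) k (2 * T' + 1)"
    and "int T + 1 \<le> b" "int T' + 1 \<le> b"
  shows "transients_bounded_by A k b"
proof -
  have Apow: "max_pow A s $$ (i, j) = A.ev ^ s * Z.norm.pw (2 * s) i j" if "i < n" "j < n" for s i j
    using that A.max_pow_eq[OF that] A.mpow_nent[OF that] norm_pw_double[OF that] A.ev_pos by simp
  \<comment> \<open>Only an even period of the block matrix gives a period of \<open>A\<close>, so
    the period is doubled.\<close>
  have double: "\<forall>t\<ge>2 * T + 1. \<forall>y\<in>X. mpow X b' (t + 2 * p) k y = mpow X b' t k y"
    if "\<forall>t\<ge>2 * T + 1. \<forall>y\<in>X. mpow X b' (t + p) k y = mpow X b' t k y" for T p b'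
  proof (intro allI impI ballI)
    fix t y assume ty: "2 * T + 1 \<le> t" "y \<in> X"
    have "mpow X b' (t + p + p) k y = mpow X b' (t + p) k y" using that ty by simp
    then show "mpow X b' (t + 2 * p) k y = mpow X b' t k y"
      using that ty by (simp add: mult_2 add.assoc)
  qed
  have dims: "dim_row A = n" "dim_col A = n" using A by auto
  \<comment> \<open>The even times \<open>2 * s\<close> from \<open>2 * T + 1\<close> on are those
    with \<open>T + 1 \<le> s\<close>.\<close>
  have row: "row_periodic_from A k (T + 1)"
  proof -
    obtain p where p: "p > 0" "\<forall>t\<ge>2 * T + 1. \<forall>y\<in>X. Z.norm.pw (t + p) k y = Z.norm.pw t k y"
      using assms(1) unfolding row_per_def by blast
    have "max_pow A (s + p) $$ (k, i) = A.ev ^ p * max_pow A s $$ (k, i)" if "i < n" "T + 1 \<le> s" for i s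
      using double[OF p(2)] that k_less by (simp add: Apow power_add)
    then show ?thesis unfolding row_periodic_from_def dims using p(1) by blast
  qed
  have col: "col_periodic_from A k (T' + 1)"
  proof -
    obtain p where p: "p > 0" "\<forall>t\<ge>2 * T' + 1. \<forall>y\<in>X.
        mpow X (\<lambda>x y. Z.nent y x) (t + p) k y = mpow X (\<lambda>x y. Z.nent y x) t k y"
      using assms(2) unfolding row_per_def by blast
    have "max_pow A (s + p) $$ (i, k) = A.ev ^ p * max_pow A s $$ (i, k)" if "i < n" "T' + 1 \<le> s" for i s
    proof -
      have "mpow X (\<lambda>x y. Z.nent y x) (2 * s + 2 * p) k i = mpow X (\<lambda>x y. Z.nent y x) (2 * s) k i"
        using double[OF p(2)] that by simp
      then have "Z.norm.pw (2 * s + 2 * p) i k = Z.norm.pw (2 * s) i k"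
        using Z.norm.mpow_transpose[of k i] that k_less by simp
      then show ?thesis using that k_less by (simp add: Apow power_add)
    qed
    then show ?thesis unfolding col_periodic_from_def dims using p(1) by blast
  qed
  have "row_transient A k \<le> T + 1" "col_transient A k \<le> T' + 1"
    unfolding row_transient_def col_transient_def using row col by (auto intro: Least_le)
  then show ?thesis unfolding transients_bounded_by_def using row col assms(3,4) by auto
qed

text \<open>Kept general in \<open>cls\<close> and \<open>d\<close>, so that the bounds for
  arbitrary and for irreducible matrices are instances of the same statement.\<close>

lemma bounds_from_classes:
  assumes cyc: "cyc_walks X Z.nent cls d" and par: "\<And>x. x < n + r \<Longrightarrow> even (cls x) \<longleftrightarrow> x < n"
    and H: "H \<in> A.C.sccs" "k \<in> verts H" and G: "G \<in> Z.C.sccs" "k \<in> verts G"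
    and h: "h = min (card (verts H)) (card (verts G \<inter> {n..<n + r}))"
  shows "transients_bounded_by A k (int d * int (Wi (r div d)) + int (r mod d) + 1)"
    and "transients_bounded_by A k
      ((int (r div d) - 2) * int (girth H) + int (min r (h + r mod d)) + 1)"
proof -
  interpret cyc: cyc_walks X Z.nent cls d by (rule cyc)
  interpret tr: cyc_walks X "\<lambda>x y. Z.nent y x" "\<lambda>x. - cls x" d by (rule cyc.cyc_walks_transpose)
  have kX: "k \<in> X" and ek: "even (cls k)" using k_less par by auto
  have "cyc.odds = {n..<n + r}" by (auto simp: cyc.odds_def par)
  then have odds: "card cyc.odds = r" "card tr.odds = r" by (auto simp: cyc.odds_def tr.odds_def)
  obtain t where t: "0 < t" "Z.norm.crit t k k" using Z.verts_C_crit(2)[OF k_Zcrit] by blast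
  have "row_per X Z.nent k (2 * (d * Wi (r div d) + r mod d) + 1)"
    using cyc.row_per_schwarz[OF kX ek t(2,1)] odds by simp
  moreover have "row_per X (\<lambda>x y. Z.nent y x) k (2 * (d * Wi (r div d) + r mod d) + 1)"
    using tr.row_per_schwarz[of k t] kX ek t odds Z.norm.crit_transpose by simp
  ultimately show "transients_bounded_by A k (int d * int (Wi (r div d)) + int (r mod d) + 1)"
    by (rule transients_bounded) auto
  let ?g = "girth H"
  have vH: "verts H = A.norm.component k" by (rule A.scc_verts_eq_comp[OF H])
  have vG: "verts G = Z.norm.component k" by (rule Z.scc_verts_eq_comp[OF G])
  have "{y \<in> Z.norm.component k. even (cls y)} = {y \<in> Z.norm.component k. y < n}"
    using par Z.norm.comp_subset[of k] by auto
  then have mt: "card {y \<in> Z.norm.component k. even (cls y)} = card (verts H)"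
    by (simp add: comp_top vH)
  have "{y \<in> Z.norm.component k. odd (cls y)} = verts G \<inter> {n..<n + r}"
    using par Z.norm.comp_subset[of k] vG by auto
  then have h': "min (card {y \<in> Z.norm.component k. even (cls y)}) (card {y \<in> Z.norm.component k. odd (cls y)}) = h"
    using mt h by simp
  obtain z where z: "z \<in> A.norm.component k" "A.norm.crit ?g z z" using A.girth_scc(2)[OF H] by blast
  have zZ: "z \<in> Z.norm.component k" "z < n" using z(1) comp_top by auto
  have zc: "Z.norm.crit (2 * ?g) z z" using norm_crit_double[OF zZ(2,2)] z(2) by simp
  have g0: "0 < ?g" by (rule A.girth_scc(1)[OF H])
  have least: "2 * ?g \<le> m" if y: "y \<in> Z.norm.component k" and m: "0 < m" "Z.norm.crit m y y" for y m
  proof -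
    have yX: "y < n + r" using y Z.norm.comp_subset[of k] by auto
    have top: "2 * ?g \<le> m" if "y \<in> Z.norm.component k" "y < n" "Z.norm.crit m y y" for y
    proof -
      have "even m" using norm_crit_parity[OF that(3)] that by simp
      then obtain l where l: "m = 2 * l" by blast
      have "y \<in> A.norm.component k" using that comp_top by auto
      moreover have "A.norm.crit l y y" using norm_crit_double that l by simp
      ultimately have "?g \<le> l" using A.girth_scc(3)[OF H] m l by simp
      then show ?thesis using l by simp
    qed
    show ?thesis
    proof (cases "y < n")
      case False
      \<comment> \<open>A critical closed walk at a factor node is followed for one arc, to a node
        of \<open>A\<close> with a critical closed walk of the same length.\<close>
      obtain F where F: "F 0 = y" "\<And>i. F i \<in> X" "\<And>i. F (i + m) = F i"
        "\<And>i j. Z.norm.crit j (F i) (F (i + j))"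
        using Z.norm.crit_cycle_walk[OF m(2) _ m(1)] yX by auto
      have c: "Z.norm.crit 1 y (F 1)" using F(4)[of 1 0] F(1) by simp
      have F1: "F 1 < n + r" using F(2)[of 1] by simp
      then have "F 1 < n" using norm_crit_parity[OF c yX] False by auto
      moreover have "F 1 \<in> Z.norm.component k"
        using Z.norm.crit_in_comp[OF c] Z.norm.crit_comp[OF y] kX F(2) by auto
      moreover have "Z.norm.crit m (F 1) (F 1)" using F(4)[of m 1] by (simp only: F(3))
      ultimately show ?thesis using top by blast
    qed (use top y m in blast)
  qed
  have compT: "tr.component k = Z.norm.component k" by (rule Z.norm.comp_transpose[OF kX])
  obtain T where T: "row_per X Z.nent k (2 * T + 1)"
    "int T \<le> (int (r div d) - 2) * int ?g + int (min r (h + r mod d))"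
    using cyc.row_per_kim[OF kX ek zZ(1) zc g0] least unfolding odds h' by blast
  have "even (- cls k)" using ek by simp
  moreover have "z \<in> tr.component k" using zZ compT by simp
  moreover have "tr.crit (2 * ?g) z z" using Z.norm.crit_transpose zZ(2) zc by simp
  moreover have "\<forall>y\<in>tr.component k. \<forall>m>0. tr.crit m y y \<longrightarrow> 2 * ?g \<le> m"
    using least Z.norm.crit_transpose Z.norm.comp_subset compT by blast
  moreover have "{y \<in> tr.component k. even (- cls y)} = {y \<in> Z.norm.component k. even (cls y)}"
    "{y \<in> tr.component k. odd (- cls y)} = {y \<in> Z.norm.component k. odd (cls y)}" using compT by auto
  ultimately obtain T' where T': "row_per X (\<lambda>x y. Z.nent y x) k (2 * T' + 1)"
    "int T' \<le> (int (r div d) - 2) * int ?g + int (min r (h + r mod d))"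
    using tr.row_per_kim[OF kX _ _ _ g0, of z] odds(2) h' by auto
  show "transients_bounded_by A k
      ((int (r div d) - 2) * int (girth H) + int (min r (h + r mod d)) + 1)"
    by (rule transients_bounded[OF T(1) T'(1)]) (use T(2) T'(2) in auto)
qed

lemma bipartite_classes: "cyc_walks X Z.nent (\<lambda>x. of_bool (n \<le> x)) 1"
proof
  fix x y assume xy: "x \<in> X" "y \<in> X" "0 < Z.nent x y"
  then have "Zm $$ (x, y) \<noteq> 0" by (auto simp: Z.nent_def)
  then have "x < n \<longleftrightarrow> n \<le> y" using xy by (auto simp: Zm_entries split: if_splits)
  then show "[of_bool (n \<le> y) = of_bool (n \<le> x) + 1] (mod 2 * int 1)"
    by (auto simp: cong_def)
qed simp

text \<open>The class of a node is the length of some walk from \<open>k\<close>. Two walks to the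
  same node, completed by the same return, are closed at \<open>k\<close>, so their lengths agree
  modulo \<open>2 * d\<close>.\<close>

lemma cyclic_classes:
  assumes irr: "irreducible_mat A" and rank: "factor_rank A = r"
    and d: "d = cyclicity (digraph_of A)"
  obtains cls where "cyc_walks X Z.nent cls d" "\<And>x. x < n + r \<Longrightarrow> even (cls x) \<longleftrightarrow> x < n"
proof -
  have npos: "0 < Z.nent x y" if "x < n + r" "y < n + r" "0 < zent x y" for x y
    using that Z.ev_pos by (simp add: Z.nent_def)
  have Areach: "\<exists>t. 0 < Z.norm.pw t i j" if ij: "i < n" "j < n" for i j
  proof -
    have "i \<rightarrow>\<^sup>*\<^bsub>A.D\<^esub> j"
      using irr that unfolding irreducible_mat_def strongly_connected_def by simp
    then obtain p where p: "A.D.awalk i p j" by (auto simp: A.D.reachable_awalk)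
    have "0 < A.pw (length p) i j" using A.awalk_weight_pos[OF p] A.awalk_weight_le_pw[OF p] by simp
    then have "0 < Z.norm.pw (2 * length p) i j"
      using norm_pw_double[OF ij] A.mpow_nent[OF ij] A.ev_pos by simp
    then show ?thesis by blast
  qed
  have trans: "0 < Z.norm.pw (s + t) x z"
    if "0 < Z.norm.pw s x y" "0 < Z.norm.pw t y z" "y \<in> X" "z \<in> X" for s t x y z
    using Z.norm.pw_mult_le[OF that(3,4), of s x t] that(1,2)
    by (meson mult_pos_pos order_less_le_trans)
  have arc: "0 < Z.norm.pw 1 x y" if "x < n + r" "y < n + r" "0 < zent x y" for x y
    using npos[OF that] Z.norm.pw_1[of x y] that by simp
  have both: "(\<exists>t. 0 < Z.norm.pw t k x) \<and> (\<exists>s. 0 < Z.norm.pw s x k)" if x: "x < n + r" for x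
  proof (cases "x < n")
    case True
    then show ?thesis using Areach k_less by blast
  next
    case False
    define \<alpha> where "\<alpha> = x - n"
    have \<alpha>: "\<alpha> < r" "x = n + \<alpha>" using False x by (auto simp: \<alpha>_def)
    \<comment> \<open>Irreducibility of \<open>A\<close> connects only the first \<open>n\<close>
      nodes; a factor node is attached to them by nonzero entries of its two vectors.\<close>
    obtain i j where ij: "i < n" "v \<alpha> $ i \<noteq> 0" "j < n" "w \<alpha> $ j \<noteq> 0"
      using rank_factorization_nonzero[OF A(1) rank rep \<alpha>(1)] by blast
    have "0 < v \<alpha> $ i" "0 < w \<alpha> $ j" using vw[OF \<alpha>(1)] ij by (auto simp: order_less_le)
    then have "0 < zent i x" "0 < zent x j" using ij \<alpha> by (auto simp: Zm_entries)
    then have a: "0 < Z.norm.pw 1 i x" "0 < Z.norm.pw 1 x j" using arc x ij by auto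
    obtain t where t: "0 < Z.norm.pw t k i" using Areach k_less ij by blast
    obtain s where s: "0 < Z.norm.pw s j k" using Areach k_less ij by blast
    show ?thesis using trans[OF t a(1)] trans[OF a(2) s] ij x k_less by auto
  qed
  have closed_dvd: "2 * d dvd t" if t: "0 < Z.norm.pw t k k" for t
  proof -
    have "even t" using norm_parity[OF t] k_less by simp
    then obtain s where s: "t = 2 * s" by blast
    have "0 < A.norm.pw s k k" using t norm_pw_double k_less s by simp
    then have "0 < A.pw s k k" using A.mpow_nent k_less A.ev_pos by (simp add: zero_less_divide_iff)
    then obtain p where "A.D.awalk k p k" "length p = s" using A.pw_awalk k_less by blast
    then show ?thesis using A.D.cyclicity_dvd_closed_awalk s d by auto
  qed
  define len where "len x = (SOME t. 0 < Z.norm.pw t k x)" for x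
  have len: "0 < Z.norm.pw (len x) k x" if "x < n + r" for x
    unfolding len_def using both[OF that] by (meson someI_ex)
  \<comment> \<open>\<open>Gcd\<close> of an empty set of lengths would be 0; the critical closed
    walk through \<open>k\<close> excludes this.\<close>
  have d0: "0 < d"
  proof -
    obtain t where t: "0 < t" "Z.norm.crit t k k" using Z.verts_C_crit(2)[OF k_Zcrit] by blast
    then show ?thesis using closed_dvd[OF Z.norm.crit_pos[OF t(2)]] by (auto intro: Nat.gr0I)
  qed
  show ?thesis
  proof (rule that)
    show "even (int (len x)) \<longleftrightarrow> x < n" if "x < n + r" for x
      using norm_parity[OF len[OF that]] that k_less by simp
    show "cyc_walks X Z.nent (\<lambda>x. int (len x)) d"
    proof
      fix x y assume xy: "x \<in> X" "y \<in> X" "0 < Z.nent x y"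
      obtain s where s: "0 < Z.norm.pw s y k" using both xy by auto
      have kX: "k \<in> X" using k_less by simp
      have lx: "0 < Z.norm.pw (len x) k x" using len xy by simp
      have "0 < Z.norm.pw 1 x y" using xy Z.norm.pw_1 by simp
      from trans[OF trans[OF lx this xy(1,2)] s xy(2) kX]
      have "0 < Z.norm.pw (len x + 1 + s) k k" .
      then have 1: "2 * d dvd len x + 1 + s" by (rule closed_dvd)
      have "0 < Z.norm.pw (len y + s) k k" using trans[OF len s] xy k_less by simp
      then have 2: "2 * d dvd len y + s" by (rule closed_dvd)
      have "int (2 * d) dvd int (len y + s) - int (len x + 1 + s)"
        using 1 2 by (intro dvd_diff) (simp_all only: int_dvd_int_iff)
      then show "[int (len y) = int (len x) + 1] (mod 2 * int d)"
        by (simp add: cong_iff_dvd_diff algebra_simps)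
    qed (rule d0)
  qed
qed

end

theorem theorem2:
  fixes A :: "real mat" and v w :: "nat \<Rightarrow> real vec" and n r k m' h d :: nat
    and H G :: "(nat, nat \<times> nat) pre_digraph"
  assumes A: "A \<in> carrier_mat n n" "nonneg_mat A"
    and rank: "factor_rank A = r"
    and k: "k \<in> verts (critical_digraph A)"
    and H: "H \<in> pre_digraph.sccs (critical_digraph A)" "k \<in> verts H"
    and rep: "max_factorization n r A v w"
    and G: "G \<in> pre_digraph.sccs (critical_digraph (block_mat n r v w))" "k \<in> verts G"
    and m': "m' = card (verts G \<inter> {n..<n + r})"
    and h: "h = min (card (verts H)) m'"
    and d: "d = cyclicity (digraph_of A)"
  shows "h \<le> min (card (verts H)) r
    \<and> transients_bounded_by A k (int (Wi r) + 1)
    \<and> transients_bounded_by A k ((int r - 2) * int (girth H) + int h + 1)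
    \<and> (irreducible_mat A \<longrightarrow>
         transients_bounded_by A k (int d * int (Wi (r div d)) + int (r mod d) + 1)
       \<and> transients_bounded_by A k
           ((int (r div d) - 2) * int (girth H) + int (min r (h + r mod d)) + 1))"
proof -
  interpret factored A n r v w k by unfold_locales (use A rep k in auto)
  have "m' \<le> card {n..<n + r}" unfolding m' by (intro card_mono) auto
  then have hr: "h \<le> r" "h \<le> card (verts H)" using h by auto
  note classes = bounds_from_classes[OF _ _ H G h[unfolded m']]
  \<comment> \<open>For \<open>d = 1\<close> the quotient is \<open>r\<close> and the remainder 0,
    so (i) and (ii) are the general bounds for the bipartition; in (ii) the minimum is
    \<open>h\<close> since \<open>h \<le> r\<close>.\<close>
  have 1: "transients_bounded_by A k (int (Wi r) + 1)"
    using classes(1)[OF bipartite_classes] by simp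
  have 2: "transients_bounded_by A k ((int r - 2) * int (girth H) + int h + 1)"
    using classes(2)[OF bipartite_classes] hr by (simp add: min_absorb2)
  have "transients_bounded_by A k (int d * int (Wi (r div d)) + int (r mod d) + 1)
      \<and> transients_bounded_by A k
          ((int (r div d) - 2) * int (girth H) + int (min r (h + r mod d)) + 1)"
    if irr: "irreducible_mat A"
  proof -
    obtain cls where "cyc_walks X Z.nent cls d" "\<And>x. x < n + r \<Longrightarrow> even (cls x) \<longleftrightarrow> x < n"
      using cyclic_classes[OF irr rank d] by blast
    then show ?thesis using classes by blast
  qed
  then show ?thesis using 1 2 hr by simp
qed

end
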